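(* Let $p=3$, $0<a<1/\Lambda$, $\lambda<b\lambda_1$, and let $u\in H(T_{\max})$ be a solution of the Kirchhoff problem (K) of the context with $u_0\in H^2(\Omega)\cap H_0^1(\Omega)$, $u_1\in H_0^1(\Omega)$. Suppose that $$(N_3\cup N_3^-)\cap H^2(\Omega)\ne\emptyset,$$ and that one of the following cases holds: (h1) $E(0)<0$; (h2) $E(0)=0$ and $\int_\Omega u_0u_1\,dx>0$; (h3) $0<E(0)<d_3$ and $u_0\in W_3^-$; (h4) $E(0)\ge d_3$, $\int_\Omega u_0u_1\,dx>0$, and $\|u_0\|_2^2>\dfrac{4}{b_0\lambda_1}E(0)$. Then the maximal existence time $T_{\max}$ of $u$ is finite. Moreover, $$\|\nabla u(t)\|_2^2\ge\frac{2b_0\Lambda}{1-a\Lambda}\qquad\text{for all } t\in[0,T_{\max}),$$ provided that $E(0)\le0$ and $\|\nabla u_0\|_2>0$.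
   Context: $\Omega\subset\mathbb{R}^3$ is a bounded open set with smooth boundary; $b>0$. $\|\cdot\|_q$ is the $L^q(\Omega)$ norm. Problem (K), with $p=3$: $$u_{tt}-\Big(a\int_\Omega|\nabla u|^2dx+b\Big)\Delta u=\lambda u+|u|^{2}u\ (t>0,\ x\in\Omega),\quad u(0,x)=u_0(x),\ u_t(0,x)=u_1(x)\ (x\in\Omega),\quad u=0\ (t\ge0,\ x\in\partial\Omega).$$ $H(T)=C([0,T);H_0^1(\Omega)\cap H^2(\Omega))\cap C^1([0,T);H_0^1(\Omega))\cap C^2([0,T);L^2(\Omega))$. For $u_0\in H^2(\Omega)\cap H_0^1(\Omega)$, $u_1\in H_0^1(\Omega)$, problem (K) has a unique solution in $H(T)$ for some $T>0$ (known local existence result); $T_{\max}\in(0,\infty]$ is its maximal existence time. If $T_{\max}<\infty$ then $\lim_{t\to T_{\max}^-}[\|\Delta u(t)\|_2+\|\nabla u_t(t)\|_2]=+\infty$ (part of the same known result). $u(t)$ denotes $u(t,\cdot)$. $\lambda_1>0$ is the principal Dirichlet eigenvalue of $-\Delta$ on $\Omega$. $\Lambda=\inf\{\|\nabla u\|_2^4:\ u\in H_0^1(\Omega),\ \|u\|_4=1\}>0$. $b_0=b-\lambda/\lambda_1$ if $\lambda\ge0$, $b_0=b$ if $\lambda<0$. $$J(u)=\frac a4\|\nabla u\|_2^4+\frac b2\|\nabla u\|_2^2-\frac\lambda2\|u\|_2^2-\frac14\|u\|_4^4,\qquad I(u)=a\|\nabla u\|_2^4+b\|\nabla u\|_2^2-\lambda\|u\|_2^2-\|u\|_4^4,$$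 $E(0)=\frac12\|u_1\|_2^2+J(u_0)$, $N_3=\{u\in H_0^1(\Omega)\setminus\{0\}: I(u)=0\}$, $N_3^-=\{u\in H_0^1(\Omega): I(u)<0\}$, $d_3=\inf_{N_3}J$, $W_3^-=\{u\in N_3^-:J(u)<d_3\}$. *)

theory Defs
  imports "HOL-Analysis.Analysis"
begin

text \<open>
  Functions on \<open>\<Omega>\<close> are total functions on the ambient space; only their values on \<open>\<Omega>\<close>, up to
  Lebesgue null sets, matter. In particular equality of functions is equality almost everywhere
  on \<open>\<Omega>\<close>.
\<close>

section \<open>Smooth functions and smooth boundaries\<close>

text \<open>Meant for open \<open>S\<close>: all partial derivatives up to order \<open>k\<close> exist and are continuous.\<close>

primrec Ck_on :: "nat \<Rightarrow> 'a::euclidean_space set \<Rightarrow> ('a \<Rightarrow> real) \<Rightarrow> bool" where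
  "Ck_on 0 S f \<longleftrightarrow> continuous_on S f"
| "Ck_on (Suc k) S f \<longleftrightarrow> f differentiable_on S \<and>
     (\<forall>i\<in>Basis. Ck_on k S (\<lambda>x. frechet_derivative f (at x) i))"

definition smooth_on :: "'a::euclidean_space set \<Rightarrow> ('a \<Rightarrow> real) \<Rightarrow> bool" where
  "smooth_on S f \<longleftrightarrow> (\<forall>k. Ck_on k S f)"

text \<open>
  Near each boundary point \<open>\<Omega>\<close> is the sublevel set of a smooth function without critical points;
  by the implicit function theorem this says that, locally, the boundary is the graph of a smooth
  function with \<open>\<Omega>\<close> lying on exactly one side of it.
\<close>

definition smooth_boundary :: "'a::euclidean_space set \<Rightarrow> bool" where
  "smooth_boundary \<Omega> \<longleftrightarrow>
     (\<forall>x\<in>frontier \<Omega>. \<exists>U \<rho>. open U \<and> x \<in> U \<and> smooth_on U \<rho> \<and>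
        (\<forall>y\<in>U. frechet_derivative \<rho> (at y) \<noteq> (\<lambda>_. 0)) \<and>
        \<Omega> \<inter> U = {y \<in> U. \<rho> y < 0})"

definition test_functions :: "'a::euclidean_space set \<Rightarrow> ('a \<Rightarrow> real) set" where
  "test_functions \<Omega> =
     {\<phi>. smooth_on UNIV \<phi> \<and> compact (closure {x. \<phi> x \<noteq> 0}) \<and> closure {x. \<phi> x \<noteq> 0} \<subseteq> \<Omega>}"

section \<open>Lebesgue and Sobolev spaces\<close>

definition zero_on :: "'a::euclidean_space set \<Rightarrow> ('a \<Rightarrow> real) \<Rightarrow> bool" where
  "zero_on \<Omega> f \<longleftrightarrow> (AE x in lebesgue_on \<Omega>. f x = 0)"

text \<open>
  As the Bochner integral of a non-integrable function is 0, this is the usual norm only on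
  elements of \<open>L\<^sup>q\<close>. Below it is applied with \<open>q = 2\<close> to square integrable functions and with
  \<open>q = 4\<close> to functions in \<open>H\<^sup>1\<^sub>0(\<Omega>)\<close>, which lie in \<open>L\<^sup>4(\<Omega>)\<close> in dimension 3.
\<close>

definition Lq_norm :: "'a::euclidean_space set \<Rightarrow> nat \<Rightarrow> ('a \<Rightarrow> 'b::real_normed_vector) \<Rightarrow> real" where
  "Lq_norm \<Omega> q f = root q (LINT x|lebesgue_on \<Omega>. norm (f x) ^ q)"

definition L2 :: "'a::euclidean_space set \<Rightarrow> ('a \<Rightarrow> real) set" where
  "L2 \<Omega> = {f \<in> borel_measurable (lebesgue_on \<Omega>). integrable (lebesgue_on \<Omega>) (\<lambda>x. (f x)\<^sup>2)}"

definition locally_integrable :: "'a::euclidean_space set \<Rightarrow> ('a \<Rightarrow> real) \<Rightarrow> bool" where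
  "locally_integrable \<Omega> f \<longleftrightarrow> (\<forall>K. compact K \<and> K \<subseteq> \<Omega> \<longrightarrow> integrable (lebesgue_on K) f)"

definition is_weak_partial ::
    "'a::euclidean_space set \<Rightarrow> 'a \<Rightarrow> ('a \<Rightarrow> real) \<Rightarrow> ('a \<Rightarrow> real) \<Rightarrow> bool" where
  "is_weak_partial \<Omega> i f g \<longleftrightarrow> locally_integrable \<Omega> f \<and> locally_integrable \<Omega> g \<and>
     (\<forall>\<phi>\<in>test_functions \<Omega>.
        (LINT x|lebesgue_on \<Omega>. f x * frechet_derivative \<phi> (at x) i)
          = - (LINT x|lebesgue_on \<Omega>. g x * \<phi> x))"

text \<open>A representative; weak derivatives are unique up to null sets.\<close>

definition weak_partial :: "'a::euclidean_space set \<Rightarrow> 'a \<Rightarrow> ('a \<Rightarrow> real) \<Rightarrow> ('a \<Rightarrow> real)" where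
  "weak_partial \<Omega> i f = (SOME g. is_weak_partial \<Omega> i f g)"

definition weak_grad :: "'a::euclidean_space set \<Rightarrow> ('a \<Rightarrow> real) \<Rightarrow> ('a \<Rightarrow> 'a)" where
  "weak_grad \<Omega> f = (\<lambda>x. \<Sum>i\<in>Basis. weak_partial \<Omega> i f x *\<^sub>R i)"

definition weak_laplacian :: "'a::euclidean_space set \<Rightarrow> ('a \<Rightarrow> real) \<Rightarrow> ('a \<Rightarrow> real)" where
  "weak_laplacian \<Omega> f = (\<lambda>x. \<Sum>i\<in>Basis. weak_partial \<Omega> i (weak_partial \<Omega> i f) x)"

definition H1 :: "'a::euclidean_space set \<Rightarrow> ('a \<Rightarrow> real) set" where
  "H1 \<Omega> = {f \<in> L2 \<Omega>. \<forall>i\<in>Basis. \<exists>g\<in>L2 \<Omega>. is_weak_partial \<Omega> i f g}"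

definition H1_norm :: "'a::euclidean_space set \<Rightarrow> ('a \<Rightarrow> real) \<Rightarrow> real" where
  "H1_norm \<Omega> f = sqrt ((Lq_norm \<Omega> 2 f)\<^sup>2 + (Lq_norm \<Omega> 2 (weak_grad \<Omega> f))\<^sup>2)"

definition H10 :: "'a::euclidean_space set \<Rightarrow> ('a \<Rightarrow> real) set" where
  "H10 \<Omega> = {f \<in> H1 \<Omega>. \<exists>\<phi>::nat \<Rightarrow> 'a \<Rightarrow> real. (\<forall>n. \<phi> n \<in> test_functions \<Omega>) \<and>
                (\<lambda>n. H1_norm \<Omega> (\<lambda>x. \<phi> n x - f x)) \<longlonglongrightarrow> 0}"

definition H2 :: "'a::euclidean_space set \<Rightarrow> ('a \<Rightarrow> real) set" where
  "H2 \<Omega> = {f \<in> H1 \<Omega>. \<forall>i\<in>Basis. weak_partial \<Omega> i f \<in> H1 \<Omega>}"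

definition H2_norm :: "'a::euclidean_space set \<Rightarrow> ('a \<Rightarrow> real) \<Rightarrow> real" where
  "H2_norm \<Omega> f = sqrt ((H1_norm \<Omega> f)\<^sup>2 +
     (\<Sum>i\<in>Basis. \<Sum>j\<in>Basis. (Lq_norm \<Omega> 2 (weak_partial \<Omega> j (weak_partial \<Omega> i f)))\<^sup>2))"

section \<open>The principal Dirichlet eigenvalue and the constant \<open>\<Lambda>\<close>\<close>

definition dirichlet_eigenvalue :: "'a::euclidean_space set \<Rightarrow> real \<Rightarrow> bool" where
  "dirichlet_eigenvalue \<Omega> \<mu> \<longleftrightarrow> (\<exists>\<phi>\<in>H10 \<Omega>. \<not> zero_on \<Omega> \<phi> \<and>
     (\<forall>\<psi>\<in>H10 \<Omega>. (LINT x|lebesgue_on \<Omega>. weak_grad \<Omega> \<phi> x \<bullet> weak_grad \<Omega> \<psi> x)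
                    = \<mu> * (LINT x|lebesgue_on \<Omega>. \<phi> x * \<psi> x)))"

definition principal_eigenvalue :: "'a::euclidean_space set \<Rightarrow> real" where
  "principal_eigenvalue \<Omega> = (LEAST \<mu>. dirichlet_eigenvalue \<Omega> \<mu>)"

definition Sobolev_Lambda :: "'a::euclidean_space set \<Rightarrow> real" where
  "Sobolev_Lambda \<Omega> = Inf {Lq_norm \<Omega> 2 (weak_grad \<Omega> v) ^ 4 | v. v \<in> H10 \<Omega> \<and> Lq_norm \<Omega> 4 v = 1}"

section \<open>Energy functionals and the Nehari manifold\<close>

definition b0 :: "'a::euclidean_space set \<Rightarrow> real \<Rightarrow> real \<Rightarrow> real" where
  "b0 \<Omega> b lam = (if lam \<ge> 0 then b - lam / principal_eigenvalue \<Omega> else b)"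

definition kirchhoff_J :: "'a::euclidean_space set \<Rightarrow> real \<Rightarrow> real \<Rightarrow> real \<Rightarrow> ('a \<Rightarrow> real) \<Rightarrow> real" where
  "kirchhoff_J \<Omega> a b lam v = a/4 * Lq_norm \<Omega> 2 (weak_grad \<Omega> v) ^ 4 + b/2 * (Lq_norm \<Omega> 2 (weak_grad \<Omega> v))\<^sup>2
      - lam/2 * (Lq_norm \<Omega> 2 v)\<^sup>2 - 1/4 * Lq_norm \<Omega> 4 v ^ 4"

definition kirchhoff_I :: "'a::euclidean_space set \<Rightarrow> real \<Rightarrow> real \<Rightarrow> real \<Rightarrow> ('a \<Rightarrow> real) \<Rightarrow> real" where
  "kirchhoff_I \<Omega> a b lam v = a * Lq_norm \<Omega> 2 (weak_grad \<Omega> v) ^ 4 + b * (Lq_norm \<Omega> 2 (weak_grad \<Omega> v))\<^sup>2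
      - lam * (Lq_norm \<Omega> 2 v)\<^sup>2 - Lq_norm \<Omega> 4 v ^ 4"

definition initial_energy ::
    "'a::euclidean_space set \<Rightarrow> real \<Rightarrow> real \<Rightarrow> real \<Rightarrow> ('a \<Rightarrow> real) \<Rightarrow> ('a \<Rightarrow> real) \<Rightarrow> real" where
  "initial_energy \<Omega> a b lam u0 u1 = 1/2 * (Lq_norm \<Omega> 2 u1)\<^sup>2 + kirchhoff_J \<Omega> a b lam u0"

definition N3 :: "'a::euclidean_space set \<Rightarrow> real \<Rightarrow> real \<Rightarrow> real \<Rightarrow> ('a \<Rightarrow> real) set" where
  "N3 \<Omega> a b lam = {v \<in> H10 \<Omega>. \<not> zero_on \<Omega> v \<and> kirchhoff_I \<Omega> a b lam v = 0}"

definition N3_minus :: "'a::euclidean_space set \<Rightarrow> real \<Rightarrow> real \<Rightarrow> real \<Rightarrow> ('a \<Rightarrow> real) set" where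
  "N3_minus \<Omega> a b lam = {v \<in> H10 \<Omega>. kirchhoff_I \<Omega> a b lam v < 0}"

definition d3 :: "'a::euclidean_space set \<Rightarrow> real \<Rightarrow> real \<Rightarrow> real \<Rightarrow> ereal" where
  "d3 \<Omega> a b lam = (INF v\<in>N3 \<Omega> a b lam. ereal (kirchhoff_J \<Omega> a b lam v))"

definition W3_minus :: "'a::euclidean_space set \<Rightarrow> real \<Rightarrow> real \<Rightarrow> real \<Rightarrow> ('a \<Rightarrow> real) set" where
  "W3_minus \<Omega> a b lam = {v \<in> N3_minus \<Omega> a b lam. ereal (kirchhoff_J \<Omega> a b lam v) < d3 \<Omega> a b lam}"

section \<open>Functions of time with values in a function space\<close>

text \<open>
  Below \<open>X\<close> is a space of functions with norm \<open>N\<close>. The requirement that the values lie in \<open>X\<close> is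
  essential, since \<open>N\<close> is not meaningful outside \<open>X\<close>. Derivatives at time 0 are one-sided.
\<close>

definition time_interval :: "ereal \<Rightarrow> real set" where
  "time_interval T = {t. 0 \<le> t \<and> ereal t < T}"

definition time_continuous ::
    "('a \<Rightarrow> real) set \<Rightarrow> (('a \<Rightarrow> real) \<Rightarrow> real) \<Rightarrow> ereal \<Rightarrow> (real \<Rightarrow> 'a \<Rightarrow> real) \<Rightarrow> bool" where
  "time_continuous X N T u \<longleftrightarrow> (\<forall>t\<in>time_interval T. u t \<in> X \<and>
     ((\<lambda>s. N (\<lambda>x. u s x - u t x)) \<longlongrightarrow> 0) (at t within time_interval T))"

definition has_time_deriv ::
    "('a \<Rightarrow> real) set \<Rightarrow> (('a \<Rightarrow> real) \<Rightarrow> real) \<Rightarrow> ereal \<Rightarrow>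
      (real \<Rightarrow> 'a \<Rightarrow> real) \<Rightarrow> (real \<Rightarrow> 'a \<Rightarrow> real) \<Rightarrow> bool" where
  "has_time_deriv X N T u u' \<longleftrightarrow> (\<forall>t\<in>time_interval T. u t \<in> X \<and> u' t \<in> X \<and>
     ((\<lambda>s. N (\<lambda>x. (u s x - u t x) / (s - t) - u' t x)) \<longlongrightarrow> 0) (at t within time_interval T))"

primrec time_Ck :: "nat \<Rightarrow> ('a \<Rightarrow> real) set \<Rightarrow> (('a \<Rightarrow> real) \<Rightarrow> real) \<Rightarrow> ereal \<Rightarrow>
      (real \<Rightarrow> 'a \<Rightarrow> real) \<Rightarrow> bool" where
  "time_Ck 0 X N T u \<longleftrightarrow> time_continuous X N T u"
| "time_Ck (Suc k) X N T u \<longleftrightarrow> (\<exists>u'. has_time_deriv X N T u u' \<and> time_Ck k X N T u')"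

definition H_space :: "'a::euclidean_space set \<Rightarrow> ereal \<Rightarrow> (real \<Rightarrow> 'a \<Rightarrow> real) set" where
  "H_space \<Omega> T = {u. time_Ck 0 (H10 \<Omega> \<inter> H2 \<Omega>) (H2_norm \<Omega>) T u \<and>
                     time_Ck 1 (H10 \<Omega>) (H1_norm \<Omega>) T u \<and>
                     time_Ck 2 (L2 \<Omega>) (Lq_norm \<Omega> 2) T u}"

section \<open>The Kirchhoff problem\<close>

text \<open>
  The equation holds in \<open>L\<^sup>2(\<Omega>)\<close>, i.e.\ almost everywhere in \<open>\<Omega>\<close>, at each time \<open>t > 0\<close>. The
  boundary condition is contained in membership of \<open>u t\<close> in \<open>H\<^sup>1\<^sub>0(\<Omega>)\<close>.
\<close>

definition kirchhoff_solution ::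
    "'a::euclidean_space set \<Rightarrow> real \<Rightarrow> real \<Rightarrow> real \<Rightarrow> ('a \<Rightarrow> real) \<Rightarrow> ('a \<Rightarrow> real) \<Rightarrow>
      ereal \<Rightarrow> (real \<Rightarrow> 'a \<Rightarrow> real) \<Rightarrow> bool" where
  "kirchhoff_solution \<Omega> a b lam u0 u1 T u \<longleftrightarrow> 0 < T \<and> u \<in> H_space \<Omega> T \<and>
     (\<exists>ut utt. has_time_deriv (L2 \<Omega>) (Lq_norm \<Omega> 2) T u ut \<and>
        has_time_deriv (L2 \<Omega>) (Lq_norm \<Omega> 2) T ut utt \<and>
        (\<forall>t>0. ereal t < T \<longrightarrow> (AE x in lebesgue_on \<Omega>.
           utt t x - (a * (LINT y|lebesgue_on \<Omega>. (norm (weak_grad \<Omega> (u t) y))\<^sup>2) + b)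
                       * weak_laplacian \<Omega> (u t) x
             = lam * u t x + \<bar>u t x\<bar>\<^sup>2 * u t x)) \<and>
        (AE x in lebesgue_on \<Omega>. u 0 x = u0 x) \<and>
        (AE x in lebesgue_on \<Omega>. ut 0 x = u1 x))"

text \<open>\<open>T \<in> (0, \<infinity>]\<close> is the maximal existence time of the solution \<open>u\<close>.\<close>

definition maximal_kirchhoff_solution ::
    "'a::euclidean_space set \<Rightarrow> real \<Rightarrow> real \<Rightarrow> real \<Rightarrow> ('a \<Rightarrow> real) \<Rightarrow> ('a \<Rightarrow> real) \<Rightarrow>
      ereal \<Rightarrow> (real \<Rightarrow> 'a \<Rightarrow> real) \<Rightarrow> bool" where
  "maximal_kirchhoff_solution \<Omega> a b lam u0 u1 T u \<longleftrightarrow> kirchhoff_solution \<Omega> a b lam u0 u1 T u \<and>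
     \<not> (\<exists>T' v. T < T' \<and> kirchhoff_solution \<Omega> a b lam u0 u1 T' v \<and>
          (\<forall>t\<in>time_interval T. AE x in lebesgue_on \<Omega>. v t x = u t x))"

end

theory Submission
  imports Defs "HOL-Complex_Analysis.Great_Picard"
begin

text \<open>
  Testing the equation with \<open>u\<^sub>t\<close> shows that the energy is conserved, and \<open>\<theta> = \<parallel>u\<parallel>\<^sub>2\<^sup>2\<close> satisfies
  \<open>\<theta>'' = 6 \<parallel>u\<^sub>t\<parallel>\<^sub>2\<^sup>2 + 2 B - 8 E(0)\<close> with
  \<open>B = b \<parallel>\<nabla>u\<parallel>\<^sub>2\<^sup>2 - \<lambda> \<parallel>u\<parallel>\<^sub>2\<^sup>2 \<ge> b\<^sub>0 \<parallel>\<nabla>u\<parallel>\<^sub>2\<^sup>2 \<ge> b\<^sub>0 \<lambda>\<^sub>1 \<theta>\<close>. In each of the four cases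
  \<open>2 B - 8 E(0) \<ge> 0\<close> along the flow (in the third one because the region \<open>I < 0\<close>, on which
  \<open>B \<ge> 4 d\<^sub>3\<close>, is invariant) and \<open>\<theta>\<close> eventually increases. Then \<open>\<theta> \<theta>'' \<ge> 3/2 \<theta>'\<^sup>2\<close> by
  Cauchy--Schwarz, so that \<open>\<theta>\<^sup>-\<^sup>1\<^sup>/\<^sup>2\<close> is concave and decreasing, which is impossible for all times.
  For the gradient bound, \<open>E(0) \<le> 0\<close> forces \<open>\<parallel>\<nabla>u\<parallel>\<^sub>2\<^sup>2\<close> to be \<open>0\<close> or above the threshold, and
  continuity in time rules out a jump.

  No Sobolev embedding is needed: \<open>\<Lambda> > 0\<close> is implied by \<open>0 < a < 1 / \<Lambda>\<close>, and \<open>u\<^sup>3\<close> is in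
  \<open>L\<^sup>2\<close>, continuously in time, because the equation expresses it by terms with this property.
  The existence of \<open>\<lambda>\<^sub>1\<close> as a least eigenvalue, and with it the Poincare inequality, rests on the
  compactness of the embedding of \<open>H\<^sup>1\<^sub>0\<close> into \<open>L\<^sup>2\<close>, obtained by comparing test functions with their
  averages over small balls.
\<close>

section \<open>The space L2\<close>

text \<open>What shapes the preparatory half is that \<open>weak_partial\<close> is picked by choice
  and \<open>principal_eigenvalue\<close> by \<open>LEAST\<close>: neither obeys any law until weak
  derivatives are known to be unique almost everywhere, respectively until the infimum of the
  Rayleigh quotient is known to be attained. A nonzero element of \<open>H10 \<Omega>\<close>,
  without which there is no eigenvalue at all, is supplied by the nonempty Nehari-type sets. One
  inequality for translated test functions gives both a Poincare inequality (shift the support off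
  itself) and compactness (small shifts). The constants: eliminating the quartic terms from
  \<open>2 (V - I(u))\<close> by energy conservation produces the coefficient 6 of V = norm of u_t
  squared; against \<theta>'^2 \<le> 4 \<theta> V this leaves the ratio 6/4 = 3/2, hence the
  exponent 1 - 3/2 = -1/2. The gradient threshold is the nonzero root A of a L A^2 + 2 b0 L A = A^2
  with L = \<Lambda>, the extreme case of nonpositive energy combined with the inequality defining
  \<Lambda>. Derivatives at time 0 are one-sided, so the comparison arguments use derivatives for t
  > 0 together with continuity down to 0.\<close>

definition L2_inner :: "'a::euclidean_space set \<Rightarrow> ('a \<Rightarrow> real) \<Rightarrow> ('a \<Rightarrow> real) \<Rightarrow> real" where
  "L2_inner \<Omega> f g = (LINT x|lebesgue_on \<Omega>. f x * g x)"

lemma L2_measurable: "f \<in> L2 \<Omega> \<Longrightarrow> f \<in> borel_measurable (lebesgue_on \<Omega>)"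
  by (simp add: L2_def)

lemma L2_square_integrable: "f \<in> L2 \<Omega> \<Longrightarrow> integrable (lebesgue_on \<Omega>) (\<lambda>x. (f x)\<^sup>2)"
  by (simp add: L2_def)

lemma L2_mult_integrable:
  assumes "f \<in> L2 \<Omega>" "g \<in> L2 \<Omega>"
  shows "integrable (lebesgue_on \<Omega>) (\<lambda>x. f x * g x)"
proof (rule Bochner_Integration.integrable_bound)
  show "integrable (lebesgue_on \<Omega>) (\<lambda>x. (f x)\<^sup>2 + (g x)\<^sup>2)"
    using assms by (intro Bochner_Integration.integrable_add L2_square_integrable)
  show "(\<lambda>x. f x * g x) \<in> borel_measurable (lebesgue_on \<Omega>)"
    using assms by (intro borel_measurable_times L2_measurable)
  have "\<bar>f x * g x\<bar> \<le> (f x)\<^sup>2 + (g x)\<^sup>2" for x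
  proof -
    have "2 * (\<bar>f x\<bar> * \<bar>g x\<bar>) \<le> (f x)\<^sup>2 + (g x)\<^sup>2"
      using sum_squares_bound[of "\<bar>f x\<bar>" "\<bar>g x\<bar>"] by simp
    moreover have "0 \<le> \<bar>f x\<bar> * \<bar>g x\<bar>" by simp
    ultimately show ?thesis unfolding abs_mult by linarith
  qed
  then show "AE x in lebesgue_on \<Omega>. norm (f x * g x) \<le> norm ((f x)\<^sup>2 + (g x)\<^sup>2)"
    by (intro AE_I2) (metis abs_ge_self order_trans real_norm_def)
qed

lemma L2_add: 
  assumes "f \<in> L2 \<Omega>" "g \<in> L2 \<Omega>"
  shows "(\<lambda>x. f x + g x) \<in> L2 \<Omega>"
proof -
  have "integrable (lebesgue_on \<Omega>) (\<lambda>x. (f x)\<^sup>2 + 2 * (f x * g x) + (g x)\<^sup>2)"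
    using assms by (intro Bochner_Integration.integrable_add L2_square_integrable
        integrable_mult_right L2_mult_integrable)
  moreover have "(f x + g x)\<^sup>2 = (f x)\<^sup>2 + 2 * (f x * g x) + (g x)\<^sup>2" for x
    by (simp add: power2_sum)
  ultimately show ?thesis
    using assms by (auto simp: L2_def intro!: borel_measurable_add)
qed

lemma L2_cmult: "f \<in> L2 \<Omega> \<Longrightarrow> (\<lambda>x. c * f x) \<in> L2 \<Omega>"
  by (auto simp: L2_def power_mult_distrib intro!: borel_measurable_times)

lemma L2_diff:
  assumes "f \<in> L2 \<Omega>" "g \<in> L2 \<Omega>"
  shows "(\<lambda>x. f x - g x) \<in> L2 \<Omega>"
  using L2_add[OF assms(1) L2_cmult[OF assms(2), of "-1"]] by simp

lemma L2_zero: "(\<lambda>x. 0) \<in> L2 \<Omega>"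
  by (simp add: L2_def)

lemma L2_sum: "(\<And>i. i \<in> I \<Longrightarrow> f i \<in> L2 \<Omega>) \<Longrightarrow> (\<lambda>x. \<Sum>i\<in>I. f i x) \<in> L2 \<Omega>"
  by (induction I rule: infinite_finite_induct) (auto simp: L2_zero L2_add)

lemma L2_inner_commute: "L2_inner \<Omega> f g = L2_inner \<Omega> g f"
  by (simp add: L2_inner_def mult.commute)

lemma L2_inner_add_left:
  assumes "f \<in> L2 \<Omega>" "g \<in> L2 \<Omega>" "h \<in> L2 \<Omega>"
  shows "L2_inner \<Omega> (\<lambda>x. f x + g x) h = L2_inner \<Omega> f h + L2_inner \<Omega> g h"
  using assms by (simp add: L2_inner_def distrib_right L2_mult_integrable)

lemma L2_inner_diff_left:
  assumes "f \<in> L2 \<Omega>" "g \<in> L2 \<Omega>" "h \<in> L2 \<Omega>"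
  shows "L2_inner \<Omega> (\<lambda>x. f x - g x) h = L2_inner \<Omega> f h - L2_inner \<Omega> g h"
  using assms by (simp add: L2_inner_def left_diff_distrib L2_mult_integrable)

lemma L2_inner_cmult_left: "L2_inner \<Omega> (\<lambda>x. c * f x) g = c * L2_inner \<Omega> f g"
  by (simp add: L2_inner_def mult.assoc)

lemma L2_inner_add_right:
  assumes "f \<in> L2 \<Omega>" "g \<in> L2 \<Omega>" "h \<in> L2 \<Omega>"
  shows "L2_inner \<Omega> h (\<lambda>x. f x + g x) = L2_inner \<Omega> h f + L2_inner \<Omega> h g"
  using L2_inner_add_left[OF assms] by (simp add: L2_inner_commute)

lemma L2_inner_diff_right:
  assumes "f \<in> L2 \<Omega>" "g \<in> L2 \<Omega>" "h \<in> L2 \<Omega>"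
  shows "L2_inner \<Omega> h (\<lambda>x. f x - g x) = L2_inner \<Omega> h f - L2_inner \<Omega> h g"
  using L2_inner_diff_left[OF assms] by (simp add: L2_inner_commute)

lemma L2_inner_cmult_right: "L2_inner \<Omega> g (\<lambda>x. c * f x) = c * L2_inner \<Omega> g f"
  using L2_inner_cmult_left[of \<Omega> c f g] by (simp add: L2_inner_commute)

lemma L2_inner_sum_left:
  assumes "\<And>i. i \<in> I \<Longrightarrow> f i \<in> L2 \<Omega>" "h \<in> L2 \<Omega>"
  shows "L2_inner \<Omega> (\<lambda>x. \<Sum>i\<in>I. f i x) h = (\<Sum>i\<in>I. L2_inner \<Omega> (f i) h)"
  using assms by (simp add: L2_inner_def sum_distrib_right L2_mult_integrable)

lemma Lq_norm_cong_AE: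
  fixes f g :: "'a::euclidean_space \<Rightarrow> 'b::euclidean_space"
  assumes "AE x in lebesgue_on \<Omega>. f x = g x"
    and "f \<in> borel_measurable (lebesgue_on \<Omega>)" "g \<in> borel_measurable (lebesgue_on \<Omega>)"
  shows "Lq_norm \<Omega> q f = Lq_norm \<Omega> q g"
proof -
  have "(LINT x|lebesgue_on \<Omega>. norm (f x) ^ q) = (LINT x|lebesgue_on \<Omega>. norm (g x) ^ q)"
    using assms by (intro integral_cong_AE) auto
  then show ?thesis by (simp add: Lq_norm_def)
qed

lemma L2_inner_cong_AE:
  assumes "AE x in lebesgue_on \<Omega>. f x = f' x" "AE x in lebesgue_on \<Omega>. g x = g' x"
    and "f \<in> L2 \<Omega>" "f' \<in> L2 \<Omega>" "g \<in> L2 \<Omega>" "g' \<in> L2 \<Omega>"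
  shows "L2_inner \<Omega> f g = L2_inner \<Omega> f' g'"
  unfolding L2_inner_def
proof (rule integral_cong_AE)
  show "AE x in lebesgue_on \<Omega>. f x * g x = f' x * g' x"
    using assms(1,2) by eventually_elim simp
qed (use assms in \<open>auto intro!: borel_measurable_times dest: L2_measurable\<close>)

lemma Lq_norm_nonneg: "q > 0 \<Longrightarrow> 0 \<le> Lq_norm \<Omega> q f"
  by (simp add: Lq_norm_def)

lemma Lq_norm_power: "q > 0 \<Longrightarrow> Lq_norm \<Omega> q f ^ q = (LINT x|lebesgue_on \<Omega>. norm (f x) ^ q)"
  by (simp add: Lq_norm_def)

lemma Lq_norm_cmult:
  "q > 0 \<Longrightarrow> Lq_norm \<Omega> q (\<lambda>x. c *\<^sub>R f x) = \<bar>c\<bar> * Lq_norm \<Omega> q f"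
  by (simp add: Lq_norm_def power_mult_distrib real_root_mult real_root_power_cancel)

lemma L2_norm_sq: "(Lq_norm \<Omega> 2 f)\<^sup>2 = L2_inner \<Omega> f f"
  by (simp only: Lq_norm_power[of 2, simplified] L2_inner_def) (simp add: power2_eq_square)

lemma L2_norm_nonneg: "0 \<le> Lq_norm \<Omega> 2 f"
  by (simp add: Lq_norm_nonneg)

lemma L2_norm_cmult:
  fixes f :: "'a::euclidean_space \<Rightarrow> real"
  shows "Lq_norm \<Omega> 2 (\<lambda>x. c * f x) = \<bar>c\<bar> * Lq_norm \<Omega> 2 f"
  using Lq_norm_cmult[of 2 \<Omega> c f] by simp

lemma L2_norm_add_sq:
  assumes "f \<in> L2 \<Omega>" "g \<in> L2 \<Omega>"
  shows "(Lq_norm \<Omega> 2 (\<lambda>x. f x + g x))\<^sup>2 =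
    (Lq_norm \<Omega> 2 f)\<^sup>2 + 2 * L2_inner \<Omega> f g + (Lq_norm \<Omega> 2 g)\<^sup>2"
  using assms by (simp add: L2_norm_sq L2_inner_add_left L2_inner_add_right L2_add
      L2_inner_commute[of \<Omega> g f])

lemma L2_norm_diff_sq:
  assumes "f \<in> L2 \<Omega>" "g \<in> L2 \<Omega>"
  shows "(Lq_norm \<Omega> 2 (\<lambda>x. f x - g x))\<^sup>2 =
    (Lq_norm \<Omega> 2 f)\<^sup>2 - 2 * L2_inner \<Omega> f g + (Lq_norm \<Omega> 2 g)\<^sup>2"
  using assms by (simp add: L2_norm_sq L2_inner_diff_left L2_inner_diff_right L2_diff
      L2_inner_commute[of \<Omega> g f])

text \<open>No sign of \<open>C\<close> is assumed, so the lemma applies to any quadratic form along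
  a line. Besides Cauchy--Schwarz it yields the Euler--Lagrange equation of a minimiser: for
  \<open>A = 0\<close> it forces \<open>B = 0\<close>.\<close>

lemma quadratic_nonneg_discriminant:
  fixes A B C :: real
  assumes "\<And>t. 0 \<le> A + 2 * t * B + t\<^sup>2 * C"
  shows "B\<^sup>2 \<le> A * C"
proof (cases "C = 0")
  case True
  have "B = 0"
  proof (rule ccontr)
    assume "B \<noteq> 0"
    then show False
      \<comment> \<open>At this point the affine function \<open>A + 2 t B\<close> has the value
        -1.\<close>
      using assms[of "- (A + 1) / (2 * B)"] True by (simp add: field_simps)
  qed
  with True show ?thesis by simp
next
  case False
  have "C > 0"
  proof (rule ccontr)
    assume "\<not> C > 0"
    then have C: "C < 0" using False by simp
    \<comment> \<open>Chosen so large that \<open>t C\<close> outweighs \<open>2 B\<close> and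
      \<open>A\<close>: the quadratic is then at most \<open>C\<close>, which is negative.\<close>
    define t where "t = 1 + (\<bar>A\<bar> + 2 * \<bar>B\<bar>) / (- C)"
    have t1: "t \<ge> 1" using C by (simp add: t_def divide_nonneg_neg)
    have eq: "(t - 1) * (- C) = \<bar>A\<bar> + 2 * \<bar>B\<bar>" using C by (simp add: t_def)
    have "A + 2 * t * B + t\<^sup>2 * C = A + t * (2 * B + t * C)" by (simp add: power2_eq_square algebra_simps)
    also have "2 * B + t * C = 2 * B + C - \<bar>A\<bar> - 2 * \<bar>B\<bar>" using eq by (simp add: algebra_simps)
    also have "A + t * (2 * B + C - \<bar>A\<bar> - 2 * \<bar>B\<bar>) \<le> A + 1 * (2 * B + C - \<bar>A\<bar> - 2 * \<bar>B\<bar>)"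
      using t1 C by (intro add_left_mono mult_right_mono_neg) auto
    also have "\<dots> < 0" using C by auto
    finally show False using assms[of t] by simp
  qed
  with assms[of "- B / C"] have "0 \<le> A - B\<^sup>2 / C"
    by (simp add: power2_eq_square field_simps)
  with \<open>C > 0\<close> show ?thesis by (simp add: field_simps)
qed

lemma L2_Cauchy_Schwarz_sq:
  assumes "f \<in> L2 \<Omega>" "g \<in> L2 \<Omega>"
  shows "(L2_inner \<Omega> f g)\<^sup>2 \<le> (Lq_norm \<Omega> 2 f)\<^sup>2 * (Lq_norm \<Omega> 2 g)\<^sup>2"
proof (rule quadratic_nonneg_discriminant)
  fix t
  have "0 \<le> (Lq_norm \<Omega> 2 (\<lambda>x. f x + t * g x))\<^sup>2" by simp
  also have "\<dots> = (Lq_norm \<Omega> 2 f)\<^sup>2 + 2 * t * L2_inner \<Omega> f g + t\<^sup>2 * (Lq_norm \<Omega> 2 g)\<^sup>2"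
    using assms by (simp add: L2_norm_add_sq L2_cmult L2_inner_cmult_right L2_norm_cmult power_mult_distrib)
  finally show "0 \<le> \<dots>" .
qed

lemma L2_Cauchy_Schwarz:
  assumes "f \<in> L2 \<Omega>" "g \<in> L2 \<Omega>"
  shows "\<bar>L2_inner \<Omega> f g\<bar> \<le> Lq_norm \<Omega> 2 f * Lq_norm \<Omega> 2 g"
  using L2_Cauchy_Schwarz_sq[OF assms] L2_norm_nonneg[of \<Omega> f] L2_norm_nonneg[of \<Omega> g]
  by (metis abs_le_square_iff abs_of_nonneg mult_nonneg_nonneg power_mult_distrib)

lemma L2_norm_triangle:
  assumes "f \<in> L2 \<Omega>" "g \<in> L2 \<Omega>"
  shows "Lq_norm \<Omega> 2 (\<lambda>x. f x + g x) \<le> Lq_norm \<Omega> 2 f + Lq_norm \<Omega> 2 g"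
proof (rule power2_le_imp_le)
  show "(Lq_norm \<Omega> 2 (\<lambda>x. f x + g x))\<^sup>2 \<le> (Lq_norm \<Omega> 2 f + Lq_norm \<Omega> 2 g)\<^sup>2"
    using L2_Cauchy_Schwarz[OF assms] by (simp add: L2_norm_add_sq[OF assms] power2_sum)
qed (simp add: L2_norm_nonneg)

lemma L2_norm_minus_commute:
  fixes f :: "'a::euclidean_space \<Rightarrow> real"
  shows "Lq_norm \<Omega> 2 (\<lambda>x. f x - g x) = Lq_norm \<Omega> 2 (\<lambda>x. g x - f x)"
  by (simp add: Lq_norm_def power2_commute)

lemma L2_norm_triangle_diff:
  assumes "f \<in> L2 \<Omega>" "g \<in> L2 \<Omega>" "h \<in> L2 \<Omega>"
  shows "Lq_norm \<Omega> 2 (\<lambda>x. f x - h x) \<le> Lq_norm \<Omega> 2 (\<lambda>x. f x - g x) + Lq_norm \<Omega> 2 (\<lambda>x. g x - h x)"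
  using L2_norm_triangle[OF L2_diff[OF assms(1,2)] L2_diff[OF assms(2,3)]] by simp

lemma L2_norm_triangle_sub:
  assumes "f \<in> L2 \<Omega>" "g \<in> L2 \<Omega>"
  shows "\<bar>Lq_norm \<Omega> 2 f - Lq_norm \<Omega> 2 g\<bar> \<le> Lq_norm \<Omega> 2 (\<lambda>x. f x - g x)"
  using L2_norm_triangle[OF L2_diff[OF assms] assms(2)]
    L2_norm_triangle[OF L2_diff[OF assms(2,1)] assms(1)]
  by (simp add: L2_norm_minus_commute[of \<Omega> g f])

lemma L2_norm_zero_iff:
  assumes "f \<in> L2 \<Omega>"
  shows "Lq_norm \<Omega> 2 f = 0 \<longleftrightarrow> zero_on \<Omega> f"
proof -
  have "Lq_norm \<Omega> 2 f = 0 \<longleftrightarrow> (LINT x|lebesgue_on \<Omega>. (f x)\<^sup>2) = 0"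
    by (simp add: Lq_norm_def)
  also have "\<dots> \<longleftrightarrow> (AE x in lebesgue_on \<Omega>. (f x)\<^sup>2 = 0)"
    by (intro integral_nonneg_eq_0_iff_AE L2_square_integrable assms) simp
  finally show ?thesis by (simp add: zero_on_def)
qed

lemma L2_zero_diff_imp_AE_eq:
  assumes "f \<in> L2 \<Omega>" "g \<in> L2 \<Omega>" "Lq_norm \<Omega> 2 (\<lambda>x. f x - g x) = 0"
  shows "AE x in lebesgue_on \<Omega>. f x = g x"
  using L2_norm_zero_iff[OF L2_diff[OF assms(1,2)]] assms(3) by (simp add: zero_on_def)

lemma L2_tendsto_norm:
  assumes "((\<lambda>s. Lq_norm \<Omega> 2 (\<lambda>x. f s x - g x)) \<longlongrightarrow> 0) F"
    and "\<forall>\<^sub>F s in F. f s \<in> L2 \<Omega>" "g \<in> L2 \<Omega>"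
  shows "((\<lambda>s. Lq_norm \<Omega> 2 (f s)) \<longlongrightarrow> Lq_norm \<Omega> 2 g) F"
proof (rule Lim_transform2[where f = "\<lambda>_. Lq_norm \<Omega> 2 g" and g = "\<lambda>s. Lq_norm \<Omega> 2 (f s)"])
  show "((\<lambda>s. Lq_norm \<Omega> 2 g - Lq_norm \<Omega> 2 (f s)) \<longlongrightarrow> 0) F"
  proof (rule Lim_null_comparison[OF _ assms(1)])
    show "\<forall>\<^sub>F s in F. norm (Lq_norm \<Omega> 2 g - Lq_norm \<Omega> 2 (f s)) \<le> Lq_norm \<Omega> 2 (\<lambda>x. f s x - g x)"
      using assms(2) by eventually_elim (use L2_norm_triangle_sub assms(3) in \<open>metis abs_minus_commute real_norm_def\<close>)
  qed
qed simp

lemma L2_tendsto_inner: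
  assumes f: "((\<lambda>s. Lq_norm \<Omega> 2 (\<lambda>x. f s x - f' x)) \<longlongrightarrow> 0) F"
    and g: "((\<lambda>s. Lq_norm \<Omega> 2 (\<lambda>x. g s x - g' x)) \<longlongrightarrow> 0) F"
    and fL: "\<forall>\<^sub>F s in F. f s \<in> L2 \<Omega>" and f'L: "f' \<in> L2 \<Omega>"
    and gL: "\<forall>\<^sub>F s in F. g s \<in> L2 \<Omega>" and g'L: "g' \<in> L2 \<Omega>"
  shows "((\<lambda>s. L2_inner \<Omega> (f s) (g s)) \<longlongrightarrow> L2_inner \<Omega> f' g') F"
proof -
  have "((\<lambda>s. L2_inner \<Omega> (f s) (g s) - L2_inner \<Omega> f' g') \<longlongrightarrow> 0) F"
  proof (rule Lim_null_comparison)
    show "\<forall>\<^sub>F s in F. norm (L2_inner \<Omega> (f s) (g s) - L2_inner \<Omega> f' g') \<le>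
        Lq_norm \<Omega> 2 (\<lambda>x. f s x - f' x) * Lq_norm \<Omega> 2 (g s) + Lq_norm \<Omega> 2 f' * Lq_norm \<Omega> 2 (\<lambda>x. g s x - g' x)"
      using fL gL
    proof eventually_elim
      case (elim s)
      have "L2_inner \<Omega> (f s) (g s) - L2_inner \<Omega> f' g' =
          L2_inner \<Omega> (\<lambda>x. f s x - f' x) (g s) + L2_inner \<Omega> f' (\<lambda>x. g s x - g' x)"
        using elim f'L g'L by (simp add: L2_inner_diff_left L2_inner_diff_right)
      also have "\<bar>\<dots>\<bar> \<le> \<bar>L2_inner \<Omega> (\<lambda>x. f s x - f' x) (g s)\<bar> + \<bar>L2_inner \<Omega> f' (\<lambda>x. g s x - g' x)\<bar>"
        by (rule abs_triangle_ineq)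
      also have "\<dots> \<le> Lq_norm \<Omega> 2 (\<lambda>x. f s x - f' x) * Lq_norm \<Omega> 2 (g s) + Lq_norm \<Omega> 2 f' * Lq_norm \<Omega> 2 (\<lambda>x. g s x - g' x)"
        using elim f'L g'L by (intro add_mono L2_Cauchy_Schwarz L2_diff) auto
      finally show ?case by simp
    qed
    show "((\<lambda>s. Lq_norm \<Omega> 2 (\<lambda>x. f s x - f' x) * Lq_norm \<Omega> 2 (g s) +
        Lq_norm \<Omega> 2 f' * Lq_norm \<Omega> 2 (\<lambda>x. g s x - g' x)) \<longlongrightarrow> 0) F"
      using tendsto_add[OF tendsto_mult[OF f L2_tendsto_norm[OF g gL g'L]] tendsto_mult[OF tendsto_const[of "Lq_norm \<Omega> 2 f'"] g]]
      by simp
  qed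
  then show ?thesis by (rule LIM_zero_cancel)
qed

text \<open>Completeness of Lebesgue measure lets measurability pass to any function that agrees
  almost everywhere. Both functions are extended by 0 outside \<Omega> to work in
  \<open>lebesgue\<close> itself. Weak partials, known only up to null sets, are seen to lie in
  \<open>L2\<close> this way.\<close>

lemma lebesgue_on_measurable_cong_AE:
  fixes f g :: "'a::euclidean_space \<Rightarrow> real"
  assumes "\<Omega> \<in> sets lebesgue" "g \<in> borel_measurable (lebesgue_on \<Omega>)" "AE x in lebesgue_on \<Omega>. f x = g x"
  shows "f \<in> borel_measurable (lebesgue_on \<Omega>)"
proof -
  define F where "F = (\<lambda>x. if x \<in> \<Omega> then f x else 0)"
  define G where "G = (\<lambda>x. if x \<in> \<Omega> then g x else 0)"
  have "AE x in lebesgue. x \<in> \<Omega> \<longrightarrow> f x = g x"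
    using assms(1,3) by (subst (asm) AE_restrict_space_iff) auto
  then have ae: "AE x in lebesgue. G x = F x"
    by eventually_elim (auto simp: F_def G_def)
  have G: "G \<in> borel_measurable lebesgue"
    unfolding G_def using assms(1,2) by (subst borel_measurable_if)
  have "F \<in> borel_measurable lebesgue"
  proof (rule measurableI)
    fix A :: "real set" assume "A \<in> sets borel"
    then have GA: "G -` A \<inter> space lebesgue \<in> sets lebesgue" using G by (rule measurable_sets[rotated])
    show "F -` A \<inter> space lebesgue \<in> sets lebesgue"
    proof (rule completion.in_sets_AE[OF _ GA])
      show "AE x in lebesgue. x \<in> G -` A \<inter> space lebesgue \<longleftrightarrow> x \<in> F -` A \<inter> space lebesgue"
        using ae by eventually_elim auto
    qed auto
  qed simp
  then show ?thesis unfolding F_def using assms(1) by (subst (asm) borel_measurable_if)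
qed

lemma L2_cong_AE:
  assumes "\<Omega> \<in> sets lebesgue" "g \<in> L2 \<Omega>" "AE x in lebesgue_on \<Omega>. f x = g x"
  shows "f \<in> L2 \<Omega>"
proof -
  have m: "f \<in> borel_measurable (lebesgue_on \<Omega>)"
    using lebesgue_on_measurable_cong_AE[OF assms(1) L2_measurable[OF assms(2)] assms(3)] .
  have "integrable (lebesgue_on \<Omega>) (\<lambda>x. (f x)\<^sup>2) \<longleftrightarrow> integrable (lebesgue_on \<Omega>) (\<lambda>x. (g x)\<^sup>2)"
    using assms m by (intro integrable_cong_AE) (auto dest: L2_measurable)
  with m show ?thesis using assms(2) by (simp add: L2_def)
qed

section \<open>Smooth bump functions\<close>

text \<open>The flat function exp(-1/t), with the powers of 1/t that its derivatives bring in, so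
  that the span of the family is closed under differentiation.\<close>

definition flat_exp :: "nat \<Rightarrow> real \<Rightarrow> real" where
  "flat_exp n t = (if t > 0 then exp (- (1 / t)) / t ^ n else 0)"

lemma flat_exp_nonneg: "0 \<le> flat_exp n t"
  by (simp add: flat_exp_def)

lemma flat_exp_tendsto_0: "((\<lambda>h. flat_exp n h) \<longlongrightarrow> 0) (at 0)"
  unfolding filterlim_at_split
proof
  show "(flat_exp n \<longlongrightarrow> 0) (at_left 0)"
  proof (rule Lim_transform_eventually[OF tendsto_const])
    show "\<forall>\<^sub>F h in at_left 0. 0 = flat_exp n h"
      using eventually_at_left_real[of "-1" 0] by (auto simp: flat_exp_def elim!: eventually_mono)
  qed
  have "((\<lambda>h. inverse h ^ n / exp (inverse h)) \<longlongrightarrow> (0::real)) (at_right 0)"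
    by (rule filterlim_compose[OF tendsto_power_div_exp_0 filterlim_inverse_at_top_right])
  then show "(flat_exp n \<longlongrightarrow> 0) (at_right 0)"
  proof (rule Lim_transform_eventually)
    have "\<forall>\<^sub>F h::real in at_right 0. h > 0"
      by (simp add: eventually_at_right_less)
    then show "\<forall>\<^sub>F h in at_right 0. inverse h ^ n / exp (inverse h) = flat_exp n h"
      by eventually_elim (simp add: flat_exp_def exp_minus field_simps)
  qed
qed

lemma flat_exp_deriv:
  "(flat_exp n has_real_derivative flat_exp (n + 2) t - real n * flat_exp (n + 1) t) (at t)"
proof (cases t "0::real" rule: linorder_cases)
  case less
  have "((\<lambda>_. 0) has_real_derivative 0) (at t)" by simp
  then have "(flat_exp n has_real_derivative 0) (at t)"
    by (rule has_field_derivative_transform_within_open[where S = "{..<0}"]) (use less in \<open>auto simp: flat_exp_def\<close>)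
  with less show ?thesis by (simp add: flat_exp_def)
next
  case equal
  \<comment> \<open>At 0 the difference quotient of one member of the family is the next member,
    whose limit is 0.\<close>
  have "((\<lambda>h. (flat_exp n (0 + h) - flat_exp n 0) / h) \<longlongrightarrow> 0) (at 0)"
  proof (rule Lim_transform_eventually[OF flat_exp_tendsto_0[of "Suc n"]])
    show "\<forall>\<^sub>F h in at 0. flat_exp (Suc n) h = (flat_exp n (0 + h) - flat_exp n 0) / h"
      by (simp add: flat_exp_def)
  qed
  with equal show ?thesis by (simp add: DERIV_def flat_exp_def)
next
  case greater
  define i where "i = inverse t"
  have inv: "(inverse has_real_derivative - (i * i)) (at t)"
    using DERIV_inverse[of t UNIV] greater by (simp add: i_def power2_eq_square)
  have "((\<lambda>t. exp (- inverse t)) has_real_derivative exp (- i) * (i * i)) (at t)"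
    using DERIV_fun_exp[OF DERIV_minus[OF inv]] by (simp add: i_def)
  from DERIV_mult[OF this DERIV_power[OF inv, of n]]
  have "((\<lambda>t. exp (- inverse t) * inverse t ^ n) has_real_derivative
      exp (- i) * (i * i) * i ^ n + real n * (- (i * i) * i ^ (n - 1)) * exp (- i)) (at t)"
    by (simp add: i_def)
  also have "exp (- i) * (i * i) * i ^ n + real n * (- (i * i) * i ^ (n - 1)) * exp (- i) =
      exp (- i) * i ^ (n + 2) - real n * (exp (- i) * i ^ (n + 1))"
    \<comment> \<open>For \<open>n = 0\<close> the exponent \<open>n - 1\<close> is truncated to 0;
      the factor \<open>real n\<close> annihilates that term.\<close>
    by (cases n) (simp_all add: algebra_simps)
  also have "\<dots> = flat_exp (n + 2) t - real n * flat_exp (n + 1) t"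
    using greater by (simp add: i_def flat_exp_def divide_inverse power_inverse)
  finally have "((\<lambda>t. exp (- (1 / t)) / t ^ n) has_real_derivative flat_exp (n + 2) t - real n * flat_exp (n + 1) t) (at t)"
    by (simp add: divide_inverse power_inverse)
  then show ?thesis
    by (rule has_field_derivative_transform_within_open[where S = "{0<..}"]) (use greater in \<open>auto simp: flat_exp_def\<close>)
qed

text \<open>An algebra of functions closed under differentiation, whence its elements are smooth.\<close>

inductive_set bump_algebra :: "('a::euclidean_space \<Rightarrow> real) set" where
  flat: "(\<lambda>x. flat_exp n (c * (x \<bullet> v) + d)) \<in> bump_algebra"
| const: "(\<lambda>x. c) \<in> bump_algebra"
| add: "f \<in> bump_algebra \<Longrightarrow> g \<in> bump_algebra \<Longrightarrow> (\<lambda>x. f x + g x) \<in> bump_algebra"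
| mult: "f \<in> bump_algebra \<Longrightarrow> g \<in> bump_algebra \<Longrightarrow> (\<lambda>x. f x * g x) \<in> bump_algebra"

lemma bump_algebra_has_derivative:
  fixes f :: "'a::euclidean_space \<Rightarrow> real"
  assumes "f \<in> bump_algebra"
  shows "\<exists>D. (\<forall>x. (f has_derivative (\<lambda>v. D v x)) (at x)) \<and> (\<forall>v. D v \<in> bump_algebra)"
  using assms
proof induction
  case (flat n c w d)
  define D where "D = (\<lambda>v::'a. \<lambda>x. (flat_exp (n + 2) (c * (x \<bullet> w) + d) + (- real n) * flat_exp (n + 1) (c * (x \<bullet> w) + d)) * (c * (v \<bullet> w)))"
  have "((\<lambda>x. flat_exp n (c * (x \<bullet> w) + d)) has_derivative (\<lambda>v. D v x)) (at x)" for x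
  proof -
    have "((\<lambda>x. c * (x \<bullet> w) + d) has_derivative (\<lambda>v. c * (v \<bullet> w))) (at x)"
      by (auto intro!: derivative_eq_intros)
    from DERIV_compose_FDERIV[OF flat_exp_deriv this]
    show ?thesis by (simp add: D_def algebra_simps)
  qed
  moreover have "D v \<in> bump_algebra" for v
    unfolding D_def by (intro bump_algebra.intros)
  ultimately show ?case by blast
next
  case (const c)
  show ?case by (rule exI[of _ "\<lambda>v x. 0"]) (auto intro: bump_algebra.const)
next
  case (add f g)
  then obtain Df Dg where D: "\<forall>x. (f has_derivative (\<lambda>v. Df v x)) (at x)" "\<forall>v. Df v \<in> bump_algebra"
    "\<forall>x. (g has_derivative (\<lambda>v. Dg v x)) (at x)" "\<forall>v. Dg v \<in> bump_algebra"
    by blast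
  show ?case
    by (rule exI[of _ "\<lambda>v x. Df v x + Dg v x"]) (use D in \<open>auto intro!: has_derivative_add bump_algebra.add\<close>)
next
  case (mult f g)
  then obtain Df Dg where D: "\<forall>x. (f has_derivative (\<lambda>v. Df v x)) (at x)" "\<forall>v. Df v \<in> bump_algebra"
    "\<forall>x. (g has_derivative (\<lambda>v. Dg v x)) (at x)" "\<forall>v. Dg v \<in> bump_algebra"
    by blast
  show ?case
    by (rule exI[of _ "\<lambda>v x. f x * Dg v x + Df v x * g x"])
      (use D mult.hyps in \<open>auto intro!: has_derivative_mult bump_algebra.add bump_algebra.mult\<close>)
qed

lemma bump_algebra_smooth:
  assumes "f \<in> bump_algebra"
  shows "smooth_on UNIV f"
proof -
  have "Ck_on k UNIV f" if "f \<in> bump_algebra" for k and f :: "'a \<Rightarrow> real"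
    using that
  proof (induction k arbitrary: f)
    case 0
    then obtain D where "\<forall>x. (f has_derivative (\<lambda>v. D v x)) (at x)"
      using bump_algebra_has_derivative by blast
    then show ?case by (auto intro!: continuous_at_imp_continuous_on has_derivative_continuous)
  next
    case (Suc k)
    then obtain D where D: "\<And>x. (f has_derivative (\<lambda>v. D v x)) (at x)" "\<And>v. D v \<in> bump_algebra"
      using bump_algebra_has_derivative by blast
    have "f differentiable_on UNIV"
      using D(1) by (auto simp: differentiable_on_def differentiable_def)
    moreover have "frechet_derivative f (at x) v = D v x" for x v
      using frechet_derivative_at[OF D(1)[of x]] by metis
    ultimately show ?case using Suc.IH D(2) by simp
  qed
  with assms show ?thesis by (simp add: smooth_on_def)
qed

lemma bump_algebra_prod:
  "finite I \<Longrightarrow> (\<And>i. i \<in> I \<Longrightarrow> f i \<in> bump_algebra) \<Longrightarrow> (\<lambda>x. \<Prod>i\<in>I. f i x) \<in> bump_algebra"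
  by (induction I rule: finite_induct) (auto intro: bump_algebra.intros)

text \<open>Smooth approximations of the indicator of \<open>box a b\<close> from below:
  \<open>flat_exp 0 (n t)\<close> tends to 1 for t > 0 and vanishes for t \<le> 0. Bounded by 1,
  they are suited to dominated convergence.\<close>

definition box_bump :: "nat \<Rightarrow> 'a \<Rightarrow> 'a \<Rightarrow> 'a::euclidean_space \<Rightarrow> real" where
  "box_bump n a b x = (\<Prod>i\<in>Basis. flat_exp 0 (real n * (x \<bullet> i - a \<bullet> i)) * flat_exp 0 (real n * (b \<bullet> i - x \<bullet> i)))"

lemma box_bump_smooth: "smooth_on UNIV (box_bump n a b)"
proof (rule bump_algebra_smooth)
  have *: "flat_exp 0 (real n * (x \<bullet> i - a \<bullet> i)) = flat_exp 0 (real n * (x \<bullet> i) + (- real n * (a \<bullet> i)))"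
    "flat_exp 0 (real n * (b \<bullet> i - x \<bullet> i)) = flat_exp 0 ((- real n) * (x \<bullet> i) + real n * (b \<bullet> i))" for x i
    by (simp_all add: algebra_simps)
  have "(\<lambda>x. \<Prod>i\<in>Basis. flat_exp 0 (real n * (x \<bullet> i) + (- real n * (a \<bullet> i))) * flat_exp 0 ((- real n) * (x \<bullet> i) + real n * (b \<bullet> i)))
      \<in> bump_algebra"
    by (intro bump_algebra_prod bump_algebra.mult bump_algebra.flat) auto
  then show "box_bump n a b \<in> bump_algebra"
    unfolding box_bump_def[abs_def] * .
qed

lemma box_bump_zero: 
  assumes "x \<notin> box a b"
  shows "box_bump n a b x = 0"
proof -
  obtain i where i: "i \<in> Basis" "x \<bullet> i \<le> a \<bullet> i \<or> b \<bullet> i \<le> x \<bullet> i"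
    using assms by (auto simp: mem_box not_less)
  then have "flat_exp 0 (real n * (x \<bullet> i - a \<bullet> i)) * flat_exp 0 (real n * (b \<bullet> i - x \<bullet> i)) = 0"
    by (auto simp: flat_exp_def zero_less_mult_iff)
  with i(1) show ?thesis unfolding box_bump_def by (intro prod_zero) auto
qed

lemma box_bump_bounds: "0 \<le> box_bump n a b x" "box_bump n a b x \<le> 1"
  unfolding box_bump_def
  by (auto intro!: prod_nonneg prod_le_1 mult_nonneg_nonneg mult_le_one flat_exp_nonneg simp: flat_exp_def)

lemma box_bump_tendsto: "(\<lambda>n. box_bump n a b x) \<longlonglongrightarrow> indicator (box a b) x"
proof (cases "x \<in> box a b")
  case True
  have *: "(\<lambda>n. flat_exp 0 (real n * t)) \<longlonglongrightarrow> 1" if "t > 0" for t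
  proof (rule Lim_transform_eventually)
    have "(\<lambda>n. exp (- (1 / (real n * t)))) \<longlonglongrightarrow> exp (- 0)"
    proof (intro tendsto_intros)
      have "filterlim (\<lambda>n. real n * t) at_top sequentially"
        using that by (intro filterlim_at_top_mult_tendsto_pos[OF tendsto_const] filterlim_real_sequentially)
      then show "(\<lambda>n. 1 / (real n * t)) \<longlonglongrightarrow> 0"
        by (intro tendsto_divide_0[OF tendsto_const] filterlim_at_top_imp_at_infinity)
    qed
    then show "(\<lambda>n. exp (- (1 / (real n * t)))) \<longlonglongrightarrow> 1" by simp
    show "\<forall>\<^sub>F n in sequentially. exp (- (1 / (real n * t))) = flat_exp 0 (real n * t)"
      using eventually_gt_at_top[of 0] by eventually_elim (use that in \<open>simp add: flat_exp_def\<close>)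
  qed
  have "(\<lambda>n. box_bump n a b x) \<longlonglongrightarrow> (\<Prod>i\<in>(Basis::'a set). 1 * 1)"
    unfolding box_bump_def using True by (intro tendsto_prod tendsto_mult *) (auto simp: mem_box)
  with True show ?thesis by simp
qed (simp add: box_bump_zero)

lemma box_bump_test_function:
  assumes "cbox a b \<subseteq> \<Omega>"
  shows "box_bump n a b \<in> test_functions \<Omega>"
proof -
  have "{x. box_bump n a b x \<noteq> 0} \<subseteq> cbox a b"
    using box_bump_zero box_subset_cbox by blast
  then have cl: "closure {x. box_bump n a b x \<noteq> 0} \<subseteq> cbox a b"
    by (intro closure_minimal) auto
  have "compact (closure {x. box_bump n a b x \<noteq> 0})"
    using cl bounded_subset[OF bounded_cbox] by (auto simp: compact_eq_bounded_closed)
  with cl assms show ?thesis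
    by (auto simp: test_functions_def box_bump_smooth)
qed

section \<open>The fundamental lemma of the calculus of variations\<close>

text \<open>Dynkin's argument: boxes are stable under intersection and generate the Borel sets, and
  the sets over which \<open>g\<close> integrates to 0 are closed under complements and disjoint
  unions. The sets where \<open>g\<close> is positive or negative are then available as domains of
  integration.\<close>

lemma AE_zero_if_box_integrals_zero_lborel:
  fixes g :: "'a::euclidean_space \<Rightarrow> real"
  assumes g: "integrable lborel g"
    and box: "\<And>a b. (LINT x:box a b|lborel. g x) = 0"
  shows "AE x in lborel. g x = 0"
proof -
  have si: "set_integrable lborel A g" if "A \<in> sets borel" for A
    unfolding set_integrable_def using g that by (intro integrable_mult_indicator) auto
  \<comment> \<open>Complements in the induction need the integral over the whole space, which is
    exhausted by growing cubes.\<close>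
  have tot: "(LINT x:UNIV|lborel. g x) = 0"
  proof (rule LIMSEQ_unique)
    show "(\<lambda>n. (LINT x:box (- (real n *\<^sub>R One)) (real n *\<^sub>R One)|lborel. g x)) \<longlonglongrightarrow> 0"
      by (simp add: box)
    show "(\<lambda>n. (LINT x:box (- (real n *\<^sub>R One)) (real n *\<^sub>R One)|lborel. g x)) \<longlonglongrightarrow> (LINT x:UNIV|lborel. g x)"
      unfolding set_lebesgue_integral_def
    proof (rule integral_dominated_convergence[where w = "\<lambda>x. \<bar>g x\<bar>"])
      show "AE x in lborel. (\<lambda>n. indicator (box (- (real n *\<^sub>R One)) (real n *\<^sub>R One)) x *\<^sub>R g x) \<longlonglongrightarrow> indicator UNIV x *\<^sub>R g x"
      proof (intro AE_I2 tendsto_scaleR tendsto_const)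
        fix x :: 'a
        obtain m :: nat where m: "x \<in> box (- (real m *\<^sub>R One)) (real m *\<^sub>R One)"
          using UN_box_eq_UNIV by blast
        have "\<forall>\<^sub>F n in sequentially. 1 = (indicator (box (- (real n *\<^sub>R One)) (real n *\<^sub>R One)) x :: real)"
          using eventually_ge_at_top[of m]
        proof eventually_elim
          case (elim n)
          have "box (- (real m *\<^sub>R One)) (real m *\<^sub>R One) \<subseteq> box (- (real n *\<^sub>R One)) (real n *\<^sub>R One :: 'a)"
            using elim by (intro subset_box_imp) auto
          with m show ?case by (auto simp: indicator_def)
        qed
        then show "(\<lambda>n. indicator (box (- (real n *\<^sub>R One)) (real n *\<^sub>R One)) x) \<longlonglongrightarrow> (indicator UNIV x :: real)"
          using Lim_transform_eventually[OF tendsto_const[of "1::real"]] by simp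
      qed
    qed (use g in \<open>auto simp: indicator_def\<close>)
  qed
  have all: "(LINT x:A|lborel. g x) = 0" if "A \<in> sets borel" for A
  proof -
    have "Int_stable (range (\<lambda>(a, b). box a b :: 'a set))"
      by (auto simp: Int_stable_def box_Int_box)
    moreover have "range (\<lambda>(a, b). box a b :: 'a set) \<subseteq> Pow UNIV" by simp
    moreover have "A \<in> sigma_sets UNIV (range (\<lambda>(a, b). box a b))"
      using that by (subst (asm) borel_eq_box) simp
    ultimately show ?thesis
    proof (induction rule: sigma_sets_induct_disjoint)
      case (basic A)
      then show ?case using box by auto
    next
      case empty
      then show ?case by (simp add: set_lebesgue_integral_def)
    next
      case (compl A)
      then have A: "A \<in> sets borel" by (subst borel_eq_box) simp
      have "(LINT x:UNIV|lborel. g x) = (LINT x:A|lborel. g x) + (LINT x:UNIV - A|lborel. g x)"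
        using set_integral_Un[of A "UNIV - A" lborel g] si A by auto
      then show ?case using tot compl by simp
    next
      case (union A)
      then have A: "A i \<in> sets borel" for i by (subst borel_eq_box) auto
      have "(LINT x:(\<Union>i. A i)|lborel. g x) = (\<Sum>i. LINT x:A i|lborel. g x)"
        using A union(1) si[of "\<Union>i. A i"]
        by (intro lebesgue_integral_countable_add) (auto simp: disjoint_family_on_def)
      then show ?case using union by simp
    qed
  qed
  have gm[measurable]: "g \<in> borel_measurable borel" using g by auto
  have "{x. g x > 0} \<in> sets borel" "{x. g x < 0} \<in> sets borel" by measurable
  note m = this
  have "AE x in lborel. indicator {x. g x > 0} x *\<^sub>R g x = 0"
    using all[OF m(1)] si[OF m(1)]
      integral_nonneg_eq_0_iff_AE[of lborel "\<lambda>x. indicator {x. g x > 0} x *\<^sub>R g x"]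
    by (auto simp: set_integrable_def set_lebesgue_integral_def indicator_def)
  moreover have "AE x in lborel. indicator {x. g x < 0} x *\<^sub>R (- g x) = 0"
    using all[OF m(2)] si[OF m(2)]
      integral_nonneg_eq_0_iff_AE[of lborel "\<lambda>x. indicator {x. g x < 0} x *\<^sub>R (- g x)"]
    by (auto simp: set_integrable_def set_lebesgue_integral_def indicator_def)
  ultimately show ?thesis
    by eventually_elim (auto simp: indicator_def split: if_splits)
qed

text \<open>Reduced to the Borel case by replacing \<open>g\<close> with a Borel function that
  differs from it on a null set only.\<close>

lemma AE_zero_if_box_integrals_zero:
  fixes g :: "'a::euclidean_space \<Rightarrow> real"
  assumes g: "integrable lebesgue g"
    and box: "\<And>a b. (LINT x|lebesgue. indicator (box a b) x * g x) = 0"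
  shows "AE x in lebesgue. g x = 0"
proof -
  obtain g' where g'[measurable]: "g' \<in> borel_measurable lborel" and ae: "AE x in lborel. g x = g' x"
    using completion_ex_borel_measurable_real[OF borel_measurable_integrable[OF g]] by blast
  have ae': "AE x in lebesgue. g x = g' x"
    using ae by (simp add: AE_completion_iff)
  have g'l: "g' \<in> borel_measurable lebesgue" using measurable_completion[OF g'] .
  have "integrable lebesgue g'"
    using integrable_cong_AE[OF borel_measurable_integrable[OF g] g'l ae'] g by simp
  then have int: "integrable lborel g'" using integrable_completion[OF g'] by simp
  have "AE x in lborel. g' x = 0"
  proof (rule AE_zero_if_box_integrals_zero_lborel[OF int])
    fix a b :: 'a
    have "(LINT x:box a b|lborel. g' x) = (LINT x|lebesgue. indicator (box a b) x * g' x)"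
      unfolding set_lebesgue_integral_def by (simp add: integral_completion)
    also have "\<dots> = (LINT x|lebesgue. indicator (box a b) x * g x)"
      using g g'l ae' by (intro integral_cong_AE borel_measurable_times borel_measurable_indicator) (auto elim: eventually_mono)
    finally show "(LINT x:box a b|lborel. g' x) = 0" using box by simp
  qed
  with ae have "AE x in lborel. g x = 0" by eventually_elim simp
  then show ?thesis by (simp add: AE_completion_iff)
qed


section \<open>Test functions: continuity, supports, stability under differentiation\<close>

lemma test_function_continuous: "\<phi> \<in> test_functions \<Omega> \<Longrightarrow> continuous_on UNIV \<phi>"
  using Ck_on.simps(1)[of UNIV \<phi>] by (simp add: test_functions_def smooth_on_def)

lemma test_function_borel: "\<phi> \<in> test_functions \<Omega> \<Longrightarrow> \<phi> \<in> borel_measurable borel"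
  by (intro borel_measurable_continuous_onI test_function_continuous)

lemma test_function_has_derivative:
  "\<phi> \<in> test_functions \<Omega> \<Longrightarrow> (\<phi> has_derivative frechet_derivative \<phi> (at x)) (at x)"
  using Ck_on.simps(2)[of 0 UNIV \<phi>]
  by (auto simp: test_functions_def smooth_on_def differentiable_on_def frechet_derivative_works simp del: Ck_on.simps)

lemma frechet_derivative_zero_outside_support:
  assumes "x \<notin> closure {x. \<phi> x \<noteq> 0}"
  shows "frechet_derivative \<phi> (at x) = (\<lambda>_. 0)"
proof -
  have "((\<lambda>_. 0) has_derivative (\<lambda>_. 0)) (at x)" by simp
  then have "(\<phi> has_derivative (\<lambda>_. 0)) (at x)"
  proof (rule has_derivative_transform_within_open[where s = "- closure {x. \<phi> x \<noteq> 0}"])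
    show "0 = \<phi> y" if "y \<in> - closure {x. \<phi> x \<noteq> 0}" for y
      using that closure_subset[of "{x. \<phi> x \<noteq> 0}"] by auto
  qed (use assms in auto)
  from frechet_derivative_at[OF this] show ?thesis by simp
qed

lemma test_function_partial:
  assumes "\<phi> \<in> test_functions \<Omega>" "i \<in> Basis"
  shows "(\<lambda>x. frechet_derivative \<phi> (at x) i) \<in> test_functions \<Omega>"
proof -
  have "Ck_on (Suc k) UNIV \<phi>" for k
    using assms(1) unfolding test_functions_def smooth_on_def by blast
  then have "smooth_on UNIV (\<lambda>x. frechet_derivative \<phi> (at x) i)"
    using assms(2) by (simp add: smooth_on_def)
  moreover have "{x. frechet_derivative \<phi> (at x) i \<noteq> 0} \<subseteq> closure {x. \<phi> x \<noteq> 0}"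
    by (intro subsetI, rule ccontr) (simp add: frechet_derivative_zero_outside_support)
  then have sub: "closure {x. frechet_derivative \<phi> (at x) i \<noteq> 0} \<subseteq> closure {x. \<phi> x \<noteq> 0}"
    by (simp add: closure_minimal)
  moreover have "compact (closure {x. \<phi> x \<noteq> 0})" "closure {x. \<phi> x \<noteq> 0} \<subseteq> \<Omega>"
    using assms(1) by (auto simp: test_functions_def)
  moreover from this sub have "compact (closure {x. frechet_derivative \<phi> (at x) i \<noteq> 0})"
    using compact_Int_closed[of "closure {x. \<phi> x \<noteq> 0}" "closure {x. frechet_derivative \<phi> (at x) i \<noteq> 0}"]
    by (simp add: Int_absorb1)
  ultimately show ?thesis by (auto simp: test_functions_def)
qed

lemma test_function_support:
  assumes "\<phi> \<in> test_functions \<Omega>"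
  obtains K where "compact K" "K \<subseteq> \<Omega>" "\<And>x. x \<notin> K \<Longrightarrow> \<phi> x = 0"
proof
  show "compact (closure {x. \<phi> x \<noteq> 0})" "closure {x. \<phi> x \<noteq> 0} \<subseteq> \<Omega>"
    using assms by (simp_all add: test_functions_def)
  show "\<phi> x = 0" if "x \<notin> closure {x. \<phi> x \<noteq> 0}" for x
    using that subsetD[OF closure_subset, of x "{x. \<phi> x \<noteq> 0}"] by auto
qed

lemma test_function_bounded:
  assumes "\<phi> \<in> test_functions \<Omega>"
  obtains B where "B > 0" "\<And>x. \<bar>\<phi> x\<bar> \<le> B"
proof -
  obtain K where K: "compact K" "\<And>x. x \<notin> K \<Longrightarrow> \<phi> x = 0"
    using test_function_support[OF assms] by metis
  have "compact (\<phi> ` K)"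
    using K(1) test_function_continuous[OF assms] by (auto intro!: compact_continuous_image elim: continuous_on_subset)
  then obtain B where B: "B > 0" "\<And>y. y \<in> \<phi> ` K \<Longrightarrow> norm y \<le> B"
    using compact_imp_bounded bounded_pos by metis
  have "\<bar>\<phi> x\<bar> \<le> B" for x
    using B K(2)[of x] by (cases "x \<in> K") auto
  with B(1) show thesis by (rule that)
qed

lemma locally_integrable_mult_test:
  fixes h :: "'a::euclidean_space \<Rightarrow> real"
  assumes "open \<Omega>" "locally_integrable \<Omega> h" "\<phi> \<in> test_functions \<Omega>"
  shows "integrable (lebesgue_on \<Omega>) (\<lambda>x. h x * \<phi> x)"
proof -
  obtain K where K: "compact K" "K \<subseteq> \<Omega>" "\<And>x. x \<notin> K \<Longrightarrow> \<phi> x = 0"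
    using test_function_support[OF assms(3)] by metis
  obtain B where B: "B > 0" "\<And>x. \<bar>\<phi> x\<bar> \<le> B" using test_function_bounded[OF assms(3)] by metis
  have "integrable (lebesgue_on K) h" using assms(2) K by (simp add: locally_integrable_def)
  then have int: "integrable lebesgue (\<lambda>x. indicator K x *\<^sub>R h x)"
    using K(1) by (subst (asm) integrable_restrict_space) (auto dest: lmeasurable_compact)
  have "integrable lebesgue (\<lambda>x. (indicator K x *\<^sub>R h x) * \<phi> x)"
  proof (rule Bochner_Integration.integrable_bound)
    show "integrable lebesgue (\<lambda>x. B * (indicator K x *\<^sub>R h x))" using int by simp
    have "\<phi> \<in> borel_measurable lebesgue"
      using test_function_borel[OF assms(3)] by (simp add: measurable_completion)
    then show "(\<lambda>x. (indicator K x *\<^sub>R h x) * \<phi> x) \<in> borel_measurable lebesgue"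
      using int by (intro borel_measurable_times) auto
    show "AE x in lebesgue. norm (indicator K x *\<^sub>R h x * \<phi> x) \<le> norm (B * (indicator K x *\<^sub>R h x))"
      using B by (intro AE_I2) (auto simp: abs_mult indicator_def mult.commute[of B] intro!: mult_left_mono)
  qed
  moreover have "(\<lambda>x. (indicator K x *\<^sub>R h x) * \<phi> x) = (\<lambda>x. indicator \<Omega> x *\<^sub>R (h x * \<phi> x))"
    using K by (intro ext) (auto simp: indicator_def)
  ultimately show ?thesis
    using assms(1) by (subst integrable_restrict_space) (auto intro: borel_open simp del: real_scaleR_def)
qed

text \<open>Testing with \<open>box_bump\<close> and letting the bumps increase to an indicator
  shows that \<open>h\<close> integrates to 0 over every box whose closure lies in \<Omega>.
  Countably many such closed boxes cover \<Omega>, so vanishing on each of them suffices.\<close>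

lemma fundamental_lemma_variations:
  fixes h :: "'a::euclidean_space \<Rightarrow> real"
  assumes "open \<Omega>" "locally_integrable \<Omega> h"
    and orth: "\<And>\<phi>. \<phi> \<in> test_functions \<Omega> \<Longrightarrow> (LINT x|lebesgue_on \<Omega>. h x * \<phi> x) = 0"
  shows "zero_on \<Omega> h"
proof -
  have \<Omega>: "\<Omega> \<in> sets lebesgue" using assms(1) by (simp add: borel_open)
  have int: "integrable lebesgue (\<lambda>x. indicator (cbox a b) x *\<^sub>R h x)" if "cbox a b \<subseteq> \<Omega>" for a b
    using assms(2) that by (subst integrable_restrict_space[symmetric]) (auto simp: locally_integrable_def)
  have box: "(LINT x|lebesgue. indicator (box a b) x * h x) = 0" if sub: "cbox a b \<subseteq> \<Omega>" for a b
  proof (rule LIMSEQ_unique)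
    have "(LINT x|lebesgue. (indicator (cbox a b) x *\<^sub>R h x) * box_bump n a b x) = 0" for n
    proof -
      have "(\<lambda>x. (indicator (cbox a b) x *\<^sub>R h x) * box_bump n a b x) = (\<lambda>x. indicator \<Omega> x *\<^sub>R (h x * box_bump n a b x))"
        using sub box_bump_zero[of _ a b n] box_subset_cbox[of a b]
        by (intro ext) (auto simp: indicator_def)
      then show ?thesis
        using orth[OF box_bump_test_function[OF sub, of n]] \<Omega> by (simp add: integral_restrict_space del: real_scaleR_def)
    qed
    then show "(\<lambda>n. LINT x|lebesgue. (indicator (cbox a b) x *\<^sub>R h x) * box_bump n a b x) \<longlonglongrightarrow> 0"
      by simp
    have eq: "indicator (box a b) x * h x = (indicator (cbox a b) x *\<^sub>R h x) * indicator (box a b) x" for x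
      using box_subset_cbox[of a b] by (auto simp: indicator_def)
    show "(\<lambda>n. LINT x|lebesgue. (indicator (cbox a b) x *\<^sub>R h x) * box_bump n a b x) \<longlonglongrightarrow>
        (LINT x|lebesgue. indicator (box a b) x * h x)"
      unfolding eq
    proof (rule integral_dominated_convergence[where w = "\<lambda>x. \<bar>indicator (cbox a b) x *\<^sub>R h x\<bar>"])
      show "AE x in lebesgue. (\<lambda>n. indicator (cbox a b) x *\<^sub>R h x * box_bump n a b x) \<longlonglongrightarrow>
          indicator (cbox a b) x *\<^sub>R h x * indicator (box a b) x"
        by (intro AE_I2 tendsto_mult tendsto_const box_bump_tendsto)
      show "AE x in lebesgue. norm (indicator (cbox a b) x *\<^sub>R h x * box_bump n a b x) \<le> \<bar>indicator (cbox a b) x *\<^sub>R h x\<bar>" for n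
        using box_bump_bounds[of n a b] by (intro AE_I2) (simp add: abs_mult mult_left_le)
      have "box_bump n a b \<in> borel_measurable lebesgue" for n
        using test_function_borel[OF box_bump_test_function[OF sub, of n]] by (simp add: measurable_completion)
      then show "(\<lambda>x. indicator (cbox a b) x *\<^sub>R h x * box_bump n a b x) \<in> borel_measurable lebesgue" for n
        using int[OF sub] by (intro borel_measurable_times) auto
      show "(\<lambda>x. indicator (cbox a b) x *\<^sub>R h x * indicator (box a b) x) \<in> borel_measurable lebesgue"
        using int[OF sub] by (intro borel_measurable_times borel_measurable_indicator) auto
    qed (use int[OF sub] in auto)
  qed
  have AE_cbox: "AE x in lebesgue. x \<in> cbox a b \<longrightarrow> h x = 0" if sub: "cbox a b \<subseteq> \<Omega>" for a b
  proof -
    have "AE x in lebesgue. indicator (box a b) x * h x = 0"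
    proof (rule AE_zero_if_box_integrals_zero)
      have "integrable lebesgue (\<lambda>x. indicator (box a b) x *\<^sub>R (indicator (cbox a b) x *\<^sub>R h x))"
        by (rule integrable_mult_indicator[OF _ int[OF sub]]) auto
      also have "(\<lambda>x. indicator (box a b) x *\<^sub>R (indicator (cbox a b) x *\<^sub>R h x)) = (\<lambda>x. indicator (box a b) x * h x)"
        using box_subset_cbox[of a b] by (intro ext) (auto simp: indicator_def)
      finally show "integrable lebesgue (\<lambda>x. indicator (box a b) x * h x)" .
      fix c d :: 'a
      \<comment> \<open>Cutting \<open>h\<close> down to \<open>box a b\<close> makes arbitrary
        boxes admissible, since the intersection of two boxes is again a box.\<close>
      obtain p q where pq: "box c d \<inter> box a b = box p q" using box_Int_box by blast
      have "(LINT x|lebesgue. indicator (box c d) x * (indicator (box a b) x * h x)) =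
          (LINT x|lebesgue. indicator (box p q) x * h x)"
        by (simp add: pq[symmetric] indicator_inter_arith mult.assoc)
      also have "\<dots> = 0"
      \<comment> \<open>The empty case is separate because only for a nonempty box is
        \<open>cbox p q\<close> the closure of \<open>box p q\<close>; for an empty one nothing
        places it inside \<Omega>.\<close>
      proof (cases "box p q = {}")
        case False
        have "closure (box p q) \<subseteq> cbox a b"
          using pq box_subset_cbox[of a b] by (intro closure_minimal) auto
        then show ?thesis using False sub by (intro box) simp
      qed simp
      finally show "(LINT x|lebesgue. indicator (box c d) x * (indicator (box a b) x * h x)) = 0" .
    qed
    \<comment> \<open>The bump argument says nothing on the faces of the box, but these form a null
      set.\<close>
    moreover have "AE x in lebesgue. x \<notin> cbox a b - box a b"
      using negligible_frontier_interval[of a b] by (intro AE_not_in) (simp add: negligible_iff_null_sets)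
    ultimately show ?thesis by eventually_elim (auto simp: indicator_def)
  qed
  obtain D where D: "countable D" "D \<subseteq> Pow \<Omega>" "\<And>X. X \<in> D \<Longrightarrow> \<exists>a b. X = cbox a b" "\<Union>D = \<Omega>"
    using open_countable_Union_open_cbox[OF assms(1)] by metis
  have "AE x in lebesgue. \<forall>X\<in>D. x \<in> X \<longrightarrow> h x = 0"
    using D(1)
  proof (subst AE_ball_countable, assumption, intro ballI)
    fix X assume X: "X \<in> D"
    then obtain a b where "X = cbox a b" using D(3) by blast
    with X D(2) show "AE x in lebesgue. x \<in> X \<longrightarrow> h x = 0" by (auto intro: AE_cbox)
  qed
  then have "AE x in lebesgue. x \<in> \<Omega> \<longrightarrow> h x = 0"
    by eventually_elim (use D(4) in blast)
  then show ?thesis using \<Omega> by (simp add: zero_on_def AE_restrict_space_iff)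
qed

section \<open>Weak derivatives\<close>

abbreviation pderiv_at :: "('a::euclidean_space \<Rightarrow> real) \<Rightarrow> 'a \<Rightarrow> 'a \<Rightarrow> real" where
  "pderiv_at \<phi> i \<equiv> \<lambda>x. frechet_derivative \<phi> (at x) i"

lemma open_in_sets_lebesgue: "open \<Omega> \<Longrightarrow> \<Omega> \<in> sets lebesgue"
  by (simp add: borel_open)

lemma indicator_compact_L2:
  assumes "open \<Omega>" "compact K"
  shows "indicator K \<in> L2 \<Omega>"
proof -
  have K: "K \<in> sets lebesgue" using assms(2) by (simp add: lmeasurable_compact fmeasurableD)
  have "emeasure lebesgue (\<Omega> \<inter> K) < \<infinity>"
  proof (rule le_less_trans[OF emeasure_mono])
    show "emeasure lebesgue K < \<infinity>" using assms(2) lmeasurable_compact fmeasurableD2 by (metis infinity_ennreal_def less_top)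
  qed (use K in auto)
  then have "integrable lebesgue (indicator (\<Omega> \<inter> K) :: 'a \<Rightarrow> real)"
    using K open_in_sets_lebesgue[OF assms(1)] by (intro integrable_real_indicator) auto
  then have "integrable (lebesgue_on \<Omega>) (indicator K :: 'a \<Rightarrow> real)"
    using open_in_sets_lebesgue[OF assms(1)]
    by (subst integrable_restrict_space) (auto simp: fun_eq_iff indicator_inter_arith elim!: back_subst[of "integrable lebesgue"])
  moreover have "(indicator K x :: real)\<^sup>2 = indicator K x" for x by (simp add: indicator_def)
  moreover have "(indicator K :: 'a \<Rightarrow> real) \<in> borel_measurable (lebesgue_on \<Omega>)"
    using K by (intro measurable_restrict_space1 borel_measurable_indicator)
  ultimately show ?thesis by (simp add: L2_def)
qed

lemma L2_dominated:
  assumes "g \<in> L2 \<Omega>" "f \<in> borel_measurable (lebesgue_on \<Omega>)" "\<And>x. x \<in> \<Omega> \<Longrightarrow> \<bar>f x\<bar> \<le> \<bar>g x\<bar>"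
  shows "f \<in> L2 \<Omega>"
proof -
  have "integrable (lebesgue_on \<Omega>) (\<lambda>x. (f x)\<^sup>2)"
  proof (rule Bochner_Integration.integrable_bound[OF L2_square_integrable[OF assms(1)]])
    show "AE x in lebesgue_on \<Omega>. norm ((f x)\<^sup>2) \<le> norm ((g x)\<^sup>2)"
      using assms(3) by (intro AE_I2) (simp add: abs_le_square_iff)
  qed (use assms(2) in measurable)
  with assms(2) show ?thesis by (simp add: L2_def)
qed

lemma L2_locally_integrable:
  assumes "open \<Omega>" "f \<in> L2 \<Omega>"
  shows "locally_integrable \<Omega> f"
  unfolding locally_integrable_def
proof (intro allI impI)
  fix K assume K: "compact K \<and> K \<subseteq> \<Omega>"
  have "integrable (lebesgue_on \<Omega>) (\<lambda>x. indicator K x * f x)"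
    using K assms by (intro L2_mult_integrable indicator_compact_L2) auto
  then have "integrable lebesgue (\<lambda>x. indicator \<Omega> x *\<^sub>R (indicator K x * f x))"
    using open_in_sets_lebesgue[OF assms(1)] by (subst (asm) integrable_restrict_space) auto
  also have "(\<lambda>x. indicator \<Omega> x *\<^sub>R (indicator K x * f x)) = (\<lambda>x. indicator K x *\<^sub>R f x)"
    using K by (intro ext) (auto simp: indicator_def)
  finally show "integrable (lebesgue_on K) f"
    using K by (subst integrable_restrict_space) (auto simp: lmeasurable_compact fmeasurableD)
qed

lemma test_function_L2:
  assumes "open \<Omega>" "\<phi> \<in> test_functions \<Omega>"
  shows "\<phi> \<in> L2 \<Omega>"
proof -
  obtain K where K: "compact K" "\<And>x. x \<notin> K \<Longrightarrow> \<phi> x = 0" using test_function_support[OF assms(2)] by metis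
  obtain B where B: "B > 0" "\<And>x. \<bar>\<phi> x\<bar> \<le> B" using test_function_bounded[OF assms(2)] by metis
  show ?thesis
  proof (rule L2_dominated)
    show "(\<lambda>x. B * indicator K x) \<in> L2 \<Omega>" by (intro L2_cmult indicator_compact_L2 assms K)
    show "\<phi> \<in> borel_measurable (lebesgue_on \<Omega>)"
      using test_function_borel[OF assms(2)] by (intro measurable_restrict_space1 measurable_completion) simp
    show "\<bar>\<phi> x\<bar> \<le> \<bar>B * indicator K x\<bar>" for x
      using B K(2)[of x] by (auto simp: indicator_def)
  qed
qed

text \<open>Uniqueness and invariance under change of representative in one statement: the testing
  identities of both pairs have the same left-hand side, so the fundamental lemma applies to
  \<open>g - g'\<close>.\<close>

lemma is_weak_partial_unique:
  assumes "open \<Omega>" "is_weak_partial \<Omega> i f g" "is_weak_partial \<Omega> i f' g'"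
    and "AE x in lebesgue_on \<Omega>. f x = f' x" and "i \<in> Basis"
  shows "AE x in lebesgue_on \<Omega>. g x = g' x"
proof -
  have li: "locally_integrable \<Omega> f" "locally_integrable \<Omega> f'" "locally_integrable \<Omega> g" "locally_integrable \<Omega> g'"
    using assms(2,3) by (auto simp: is_weak_partial_def)
  have "zero_on \<Omega> (\<lambda>x. g x - g' x)"
  proof (rule fundamental_lemma_variations[OF assms(1)])
    show "locally_integrable \<Omega> (\<lambda>x. g x - g' x)"
      using li by (simp add: locally_integrable_def)
    fix \<phi> assume \<phi>: "\<phi> \<in> test_functions \<Omega>"
    note int = locally_integrable_mult_test[OF assms(1) _ \<phi>]
      locally_integrable_mult_test[OF assms(1) _ test_function_partial[OF \<phi> assms(5)]]
    have "(LINT x|lebesgue_on \<Omega>. f x * pderiv_at \<phi> i x) = (LINT x|lebesgue_on \<Omega>. f' x * pderiv_at \<phi> i x)"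
      using assms(4) int(2) li by (intro integral_cong_AE borel_measurable_integrable) (auto elim: eventually_mono)
    then have "(LINT x|lebesgue_on \<Omega>. g x * \<phi> x) = (LINT x|lebesgue_on \<Omega>. g' x * \<phi> x)"
      using assms(2,3) \<phi> by (simp add: is_weak_partial_def)
    then show "(LINT x|lebesgue_on \<Omega>. (g x - g' x) * \<phi> x) = 0"
      using int(1) li by (simp add: left_diff_distrib)
  qed
  then show ?thesis by (simp add: zero_on_def)
qed

lemma is_weak_partial_L2:
  assumes "open \<Omega>" "f \<in> L2 \<Omega>" "g \<in> L2 \<Omega>"
  shows "is_weak_partial \<Omega> i f g \<longleftrightarrow>
    (\<forall>\<phi>\<in>test_functions \<Omega>. L2_inner \<Omega> f (pderiv_at \<phi> i) = - L2_inner \<Omega> g \<phi>)"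
  using L2_locally_integrable[OF assms(1)] assms by (simp add: is_weak_partial_def L2_inner_def)

lemma H1_subset_L2: "f \<in> H1 \<Omega> \<Longrightarrow> f \<in> L2 \<Omega>"
  by (simp add: H1_def)

text \<open>The premise on \<open>h\<close> secures that some weak partial exists, so that the
  choice behind \<open>weak_partial\<close> really returns one.\<close>

lemma weak_partial_eqI:
  assumes "open \<Omega>" "i \<in> Basis" "is_weak_partial \<Omega> i f' g" "AE x in lebesgue_on \<Omega>. f x = f' x"
    and "is_weak_partial \<Omega> i f h"
  shows "AE x in lebesgue_on \<Omega>. weak_partial \<Omega> i f x = g x"
proof (rule is_weak_partial_unique[OF assms(1) _ assms(3,4,2)])
  show "is_weak_partial \<Omega> i f (weak_partial \<Omega> i f)"
    unfolding weak_partial_def by (rule someI[of "is_weak_partial \<Omega> i f", OF assms(5)])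
qed

lemma H1_weak_partial:
  assumes "open \<Omega>" "f \<in> H1 \<Omega>" "i \<in> Basis"
  shows "is_weak_partial \<Omega> i f (weak_partial \<Omega> i f)" "weak_partial \<Omega> i f \<in> L2 \<Omega>"
proof -
  obtain g where g: "g \<in> L2 \<Omega>" "is_weak_partial \<Omega> i f g"
    using assms(2,3) by (auto simp: H1_def)
  show "is_weak_partial \<Omega> i f (weak_partial \<Omega> i f)"
    unfolding weak_partial_def by (rule someI[of "is_weak_partial \<Omega> i f", OF g(2)])
  have "AE x in lebesgue_on \<Omega>. weak_partial \<Omega> i f x = g x"
    using weak_partial_eqI[OF assms(1,3) g(2) _ g(2)] by simp
  then show "weak_partial \<Omega> i f \<in> L2 \<Omega>"
    using L2_cong_AE[OF open_in_sets_lebesgue[OF assms(1)] g(1)] by simp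
qed

text \<open>Square integrable candidates that pass the test against all test functions both prove
  membership in \<open>H1\<close> and pin down the chosen partials almost everywhere.\<close>

lemma H1_I:
  assumes "open \<Omega>" "f \<in> L2 \<Omega>" "\<And>i. i \<in> Basis \<Longrightarrow> g i \<in> L2 \<Omega>"
    and "\<And>i \<phi>. i \<in> Basis \<Longrightarrow> \<phi> \<in> test_functions \<Omega> \<Longrightarrow> L2_inner \<Omega> f (pderiv_at \<phi> i) = - L2_inner \<Omega> (g i) \<phi>"
  shows "f \<in> H1 \<Omega>" "i \<in> Basis \<Longrightarrow> AE x in lebesgue_on \<Omega>. weak_partial \<Omega> i f x = g i x"
proof -
  have w: "is_weak_partial \<Omega> i f (g i)" if "i \<in> Basis" for i
    using is_weak_partial_L2[OF assms(1,2) assms(3)[OF that]] assms(4)[OF that] by simp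
  with assms(2,3) show "f \<in> H1 \<Omega>" by (auto simp: H1_def)
  show "AE x in lebesgue_on \<Omega>. weak_partial \<Omega> i f x = g i x" if "i \<in> Basis"
    using weak_partial_eqI[OF assms(1) that w[OF that] _ w[OF that]] by simp
qed

lemma H1_inner_test:
  assumes "open \<Omega>" "f \<in> H1 \<Omega>" "i \<in> Basis" "\<phi> \<in> test_functions \<Omega>"
  shows "L2_inner \<Omega> f (pderiv_at \<phi> i) = - L2_inner \<Omega> (weak_partial \<Omega> i f) \<phi>"
  using is_weak_partial_L2[OF assms(1) H1_subset_L2[OF assms(2)] H1_weak_partial(2)[OF assms(1-3)]]
    H1_weak_partial(1)[OF assms(1-3)] assms(4) by blast

text \<open>The choice of representatives need not be linear, so linearity of the partials can be
  asserted only almost everywhere; norms and inner products do not see the difference.\<close>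

lemma H1_lincomb:
  assumes "open \<Omega>" "f \<in> H1 \<Omega>" "g \<in> H1 \<Omega>"
  shows "(\<lambda>x. c * f x + d * g x) \<in> H1 \<Omega>"
    and "i \<in> Basis \<Longrightarrow> AE x in lebesgue_on \<Omega>. weak_partial \<Omega> i (\<lambda>x. c * f x + d * g x) x =
      c * weak_partial \<Omega> i f x + d * weak_partial \<Omega> i g x"
proof -
  note L = H1_subset_L2[OF assms(2)] H1_subset_L2[OF assms(3)] H1_weak_partial(2)[OF assms(1,2)] H1_weak_partial(2)[OF assms(1,3)]
  have *: "L2_inner \<Omega> (\<lambda>x. c * f x + d * g x) (pderiv_at \<phi> i) =
      - L2_inner \<Omega> (\<lambda>x. c * weak_partial \<Omega> i f x + d * weak_partial \<Omega> i g x) \<phi>"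
    if "i \<in> Basis" "\<phi> \<in> test_functions \<Omega>" for i \<phi>
    using that L assms test_function_L2[OF assms(1)] test_function_partial[OF that(2,1)]
    by (simp add: L2_inner_add_left L2_cmult L2_inner_cmult_left H1_inner_test)
  have a: "(\<lambda>x. c * f x + d * g x) \<in> L2 \<Omega>" using L by (simp add: L2_add L2_cmult)
  have b: "(\<lambda>x. c * weak_partial \<Omega> i f x + d * weak_partial \<Omega> i g x) \<in> L2 \<Omega>" if "i \<in> Basis" for i
    using L that by (simp add: L2_add L2_cmult)
  show "(\<lambda>x. c * f x + d * g x) \<in> H1 \<Omega>" 
    using H1_I(1)[OF assms(1) a b *] by simp
  show "i \<in> Basis \<Longrightarrow> AE x in lebesgue_on \<Omega>. weak_partial \<Omega> i (\<lambda>x. c * f x + d * g x) x =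
      c * weak_partial \<Omega> i f x + d * weak_partial \<Omega> i g x"
    using H1_I(2)[OF assms(1) a b *] by simp
qed

lemma H1_diff:
  assumes "open \<Omega>" "f \<in> H1 \<Omega>" "g \<in> H1 \<Omega>"
  shows "(\<lambda>x. f x - g x) \<in> H1 \<Omega>"
    and "i \<in> Basis \<Longrightarrow> AE x in lebesgue_on \<Omega>. weak_partial \<Omega> i (\<lambda>x. f x - g x) x =
      weak_partial \<Omega> i f x - weak_partial \<Omega> i g x"
  using H1_lincomb[OF assms, where c = 1 and d = "-1"] by simp_all

lemma H1_norm_weak_partial_diff:
  assumes "open \<Omega>" "f \<in> H1 \<Omega>" "g \<in> H1 \<Omega>" "i \<in> Basis"
  shows "Lq_norm \<Omega> 2 (weak_partial \<Omega> i (\<lambda>x. f x - g x)) =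
    Lq_norm \<Omega> 2 (\<lambda>x. weak_partial \<Omega> i f x - weak_partial \<Omega> i g x)"
  using assms H1_diff[OF assms(1-3)]
  by (intro Lq_norm_cong_AE L2_measurable L2_diff H1_weak_partial(2)) auto

lemma H1_cong_AE:
  assumes "open \<Omega>" "f \<in> H1 \<Omega>" "AE x in lebesgue_on \<Omega>. g x = f x"
  shows "g \<in> H1 \<Omega>" "i \<in> Basis \<Longrightarrow> AE x in lebesgue_on \<Omega>. weak_partial \<Omega> i g x = weak_partial \<Omega> i f x"
proof -
  have g: "g \<in> L2 \<Omega>" 
    using L2_cong_AE[OF open_in_sets_lebesgue[OF assms(1)] H1_subset_L2[OF assms(2)] assms(3)] .
  have *: "L2_inner \<Omega> g (pderiv_at \<phi> i) = - L2_inner \<Omega> (weak_partial \<Omega> i f) \<phi>"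
    if "i \<in> Basis" "\<phi> \<in> test_functions \<Omega>" for i \<phi>
    using L2_inner_cong_AE[OF assms(3), of "pderiv_at \<phi> i" "pderiv_at \<phi> i"] g H1_subset_L2[OF assms(2)]
      test_function_L2[OF assms(1) test_function_partial[OF that(2,1)]] H1_inner_test[OF assms(1,2) that]
    by simp
  show "g \<in> H1 \<Omega>" "i \<in> Basis \<Longrightarrow> AE x in lebesgue_on \<Omega>. weak_partial \<Omega> i g x = weak_partial \<Omega> i f x"
    using H1_I[OF assms(1) g H1_weak_partial(2)[OF assms(1,2)] *] by simp_all
qed

text \<open>The Dirichlet form. Written with coordinates, it inherits bilinearity, convergence and
  differentiation in time from \<open>L2_inner\<close>; \<open>grad_inner_eq\<close> identifies it
  with the integral of the product of the gradients.\<close>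

definition grad_inner :: "'a::euclidean_space set \<Rightarrow> ('a \<Rightarrow> real) \<Rightarrow> ('a \<Rightarrow> real) \<Rightarrow> real" where
  "grad_inner \<Omega> f g = (\<Sum>i\<in>Basis. L2_inner \<Omega> (weak_partial \<Omega> i f) (weak_partial \<Omega> i g))"

lemma weak_grad_inner: "weak_grad \<Omega> f x \<bullet> weak_grad \<Omega> g x = (\<Sum>i\<in>Basis. weak_partial \<Omega> i f x * weak_partial \<Omega> i g x)"
  unfolding weak_grad_def by (simp add: inner_sum_left inner_sum_right inner_Basis if_distrib sum.delta mult.commute cong: if_cong)

lemma grad_inner_eq:
  assumes "open \<Omega>" "f \<in> H1 \<Omega>" "g \<in> H1 \<Omega>"
  shows "(LINT x|lebesgue_on \<Omega>. weak_grad \<Omega> f x \<bullet> weak_grad \<Omega> g x) = grad_inner \<Omega> f g"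
  unfolding weak_grad_inner grad_inner_def L2_inner_def
  by (intro Bochner_Integration.integral_sum L2_mult_integrable H1_weak_partial(2)[OF assms(1)] assms)

lemma grad_norm_sq:
  assumes "open \<Omega>" "f \<in> H1 \<Omega>"
  shows "(Lq_norm \<Omega> 2 (weak_grad \<Omega> f))\<^sup>2 = grad_inner \<Omega> f f"
  using grad_inner_eq[OF assms assms(2)]
  by (simp only: Lq_norm_power[of 2, simplified]) (simp add: power2_norm_eq_inner)

lemma grad_inner_self: "grad_inner \<Omega> f f = (\<Sum>i\<in>Basis. (Lq_norm \<Omega> 2 (weak_partial \<Omega> i f))\<^sup>2)"
  by (simp add: grad_inner_def L2_norm_sq)

lemma grad_inner_commute: "grad_inner \<Omega> f g = grad_inner \<Omega> g f"
  by (simp add: grad_inner_def L2_inner_commute)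

lemma grad_inner_lincomb_left:
  assumes "open \<Omega>" "f \<in> H1 \<Omega>" "g \<in> H1 \<Omega>" "h \<in> H1 \<Omega>"
  shows "grad_inner \<Omega> (\<lambda>x. c * f x + d * g x) h = c * grad_inner \<Omega> f h + d * grad_inner \<Omega> g h"
proof -
  have "L2_inner \<Omega> (weak_partial \<Omega> i (\<lambda>x. c * f x + d * g x)) (weak_partial \<Omega> i h) =
    c * L2_inner \<Omega> (weak_partial \<Omega> i f) (weak_partial \<Omega> i h) + d * L2_inner \<Omega> (weak_partial \<Omega> i g) (weak_partial \<Omega> i h)"
    if i: "i \<in> Basis" for i
  proof -
    note L = H1_weak_partial(2)[OF assms(1) _ i]
    have "L2_inner \<Omega> (weak_partial \<Omega> i (\<lambda>x. c * f x + d * g x)) (weak_partial \<Omega> i h) =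
      L2_inner \<Omega> (\<lambda>x. c * weak_partial \<Omega> i f x + d * weak_partial \<Omega> i g x) (weak_partial \<Omega> i h)"
      using H1_lincomb[OF assms(1-3)] L assms i by (intro L2_inner_cong_AE) (auto intro!: L2_add L2_cmult)
    also have "\<dots> = c * L2_inner \<Omega> (weak_partial \<Omega> i f) (weak_partial \<Omega> i h) + d * L2_inner \<Omega> (weak_partial \<Omega> i g) (weak_partial \<Omega> i h)"
      using L assms by (simp add: L2_inner_add_left L2_cmult L2_inner_cmult_left)
    finally show ?thesis .
  qed
  then show ?thesis by (simp add: grad_inner_def sum.distrib sum_distrib_left)
qed

lemma grad_inner_cong_AE:
  assumes "open \<Omega>" "f \<in> H1 \<Omega>" "g \<in> H1 \<Omega>" "AE x in lebesgue_on \<Omega>. f' x = f x" "AE x in lebesgue_on \<Omega>. g' x = g x"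
  shows "grad_inner \<Omega> f' g' = grad_inner \<Omega> f g"
  unfolding grad_inner_def
  using assms H1_cong_AE[OF assms(1,2,4)] H1_cong_AE[OF assms(1,3,5)] H1_weak_partial(2)[OF assms(1)]
  by (intro sum.cong L2_inner_cong_AE) auto

text \<open>Reduces convergence in \<open>H1\<close> to convergence in \<open>L2\<close> of the
  function and of each partial. Membership is required only eventually, as curves are controlled
  only inside their time interval.\<close>

lemma H1_norm_tendsto_iff:
  assumes "open \<Omega>" "\<forall>\<^sub>F s in F. f s \<in> H1 \<Omega>"
  shows "((\<lambda>s. H1_norm \<Omega> (f s)) \<longlongrightarrow> 0) F \<longleftrightarrow>
    ((\<lambda>s. Lq_norm \<Omega> 2 (f s)) \<longlongrightarrow> 0) F \<and>
    (\<forall>i\<in>Basis. ((\<lambda>s. Lq_norm \<Omega> 2 (weak_partial \<Omega> i (f s))) \<longlongrightarrow> 0) F)"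
    (is "?L \<longleftrightarrow> ?A \<and> ?B")
proof -
  have eq: "\<forall>\<^sub>F s in F. sqrt ((Lq_norm \<Omega> 2 (f s))\<^sup>2 + (\<Sum>i\<in>Basis. (Lq_norm \<Omega> 2 (weak_partial \<Omega> i (f s)))\<^sup>2)) = H1_norm \<Omega> (f s)"
    using assms(2) by eventually_elim (simp add: H1_norm_def grad_norm_sq[OF assms(1)] grad_inner_self)
  show ?thesis
  proof
    assume R: "?A \<and> ?B"
    have "((\<lambda>s. sqrt ((Lq_norm \<Omega> 2 (f s))\<^sup>2 + (\<Sum>i\<in>Basis. (Lq_norm \<Omega> 2 (weak_partial \<Omega> i (f s)))\<^sup>2))) \<longlongrightarrow>
        sqrt (0\<^sup>2 + (\<Sum>i\<in>(Basis::'a set). 0\<^sup>2))) F"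
      using R by (intro tendsto_real_sqrt tendsto_add tendsto_power tendsto_sum) auto
    with eq show ?L by (auto elim: Lim_transform_eventually)
  next
    assume L: ?L
    have "\<forall>\<^sub>F s in F. norm (Lq_norm \<Omega> 2 (f s)) \<le> H1_norm \<Omega> (f s)"
      using eq
    proof eventually_elim
      case (elim s)
      show ?case unfolding elim[symmetric]
        by (auto intro!: real_le_rsqrt sum_nonneg simp: L2_norm_nonneg)
    qed
    then have ?A by (rule Lim_null_comparison[OF _ L])
    moreover have ?B
    proof
      fix i :: 'a assume i: "i \<in> Basis"
      have "\<forall>\<^sub>F s in F. norm (Lq_norm \<Omega> 2 (weak_partial \<Omega> i (f s))) \<le> H1_norm \<Omega> (f s)"
        using eq
      proof eventually_elim
        case (elim s)
        have "(Lq_norm \<Omega> 2 (weak_partial \<Omega> i (f s)))\<^sup>2 \<le> (\<Sum>i\<in>Basis. (Lq_norm \<Omega> 2 (weak_partial \<Omega> i (f s)))\<^sup>2)"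
          using i by (intro member_le_sum) auto
        then show ?case unfolding elim[symmetric]
          by (auto intro!: real_le_rsqrt simp: L2_norm_nonneg add_increasing)
      qed
      then show "((\<lambda>s. Lq_norm \<Omega> 2 (weak_partial \<Omega> i (f s))) \<longlongrightarrow> 0) F" by (rule Lim_null_comparison[OF _ L])
    qed
    ultimately show "?A \<and> ?B" ..
  qed
qed

lemma H1_norm_diff_tendsto_iff:
  assumes "open \<Omega>" "\<forall>\<^sub>F s in F. f s \<in> H1 \<Omega>" "g \<in> H1 \<Omega>"
  shows "((\<lambda>s. H1_norm \<Omega> (\<lambda>x. f s x - g x)) \<longlongrightarrow> 0) F \<longleftrightarrow>
    ((\<lambda>s. Lq_norm \<Omega> 2 (\<lambda>x. f s x - g x)) \<longlongrightarrow> 0) F \<and>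
    (\<forall>i\<in>Basis. ((\<lambda>s. Lq_norm \<Omega> 2 (\<lambda>x. weak_partial \<Omega> i (f s) x - weak_partial \<Omega> i g x)) \<longlongrightarrow> 0) F)"
proof -
  have 1: "\<forall>\<^sub>F s in F. (\<lambda>x. f s x - g x) \<in> H1 \<Omega>"
    using assms(2) by eventually_elim (rule H1_diff(1)[OF assms(1) _ assms(3)])
  have 2: "((\<lambda>s. Lq_norm \<Omega> 2 (weak_partial \<Omega> i (\<lambda>x. f s x - g x))) \<longlongrightarrow> 0) F \<longleftrightarrow>
      ((\<lambda>s. Lq_norm \<Omega> 2 (\<lambda>x. weak_partial \<Omega> i (f s) x - weak_partial \<Omega> i g x)) \<longlongrightarrow> 0) F" if "i \<in> Basis" for i
    by (rule tendsto_cong, use assms(2) in eventually_elim) (use that assms(1,3) H1_norm_weak_partial_diff in blast)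
  show ?thesis using H1_norm_tendsto_iff[OF assms(1) 1] 2 by simp
qed

section \<open>Integration by parts\<close>

lemma integral_translate_lborel:
  fixes f :: "'a::euclidean_space \<Rightarrow> real"
  assumes "f \<in> borel_measurable borel"
  shows "(LINT x|lborel. f (x + c)) = (LINT x|lborel. f x)"
proof -
  have "(LINT x|lborel. f x) = (LINT x|distr lborel borel ((+) c). f x)"
    by (simp add: lborel_distr_plus)
  also have "\<dots> = (LINT x|lborel. f (c + x))"
    using assms by (intro integral_distr) auto
  finally show ?thesis by (simp add: add.commute)
qed

lemma integrable_compact_support:
  fixes f :: "'a::euclidean_space \<Rightarrow> real"
  assumes "f \<in> borel_measurable borel" "compact K" "\<And>x. x \<notin> K \<Longrightarrow> f x = 0" "\<And>x. \<bar>f x\<bar> \<le> B"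
  shows "integrable lborel f"
proof (rule Bochner_Integration.integrable_bound)
  show "integrable lborel (\<lambda>x. B * indicator K x :: real)"
    using assms(2) by (intro integrable_mult_right integrable_real_indicator)
      (auto intro: borel_compact compact_imp_closed simp: emeasure_bounded_finite[simplified] compact_imp_bounded)
  show "AE x in lborel. norm (f x) \<le> norm (B * indicator K x :: real)"
    using assms(3,4) by (intro AE_I2) (auto simp: indicator_def intro: order_trans[OF _ abs_ge_self])
qed (use assms(1) in simp)

lemma continuous_compact_support_bounded:
  fixes f :: "'a::euclidean_space \<Rightarrow> real"
  assumes "continuous_on UNIV f" "compact K" "\<And>x. x \<notin> K \<Longrightarrow> f x = 0"
  shows "\<exists>B\<ge>0. \<forall>x. \<bar>f x\<bar> \<le> B"
proof -
  have "compact (f ` K)"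
    using assms(1,2) by (auto intro!: compact_continuous_image elim: continuous_on_subset)
  then obtain B where B: "B > 0" "\<And>y. y \<in> f ` K \<Longrightarrow> norm y \<le> B"
    using compact_imp_bounded bounded_pos by metis
  have "\<bar>f x\<bar> \<le> B" for x using B assms(3)[of x] by (cases "x \<in> K") auto
  with B(1) show ?thesis by (intro exI[of _ B]) auto
qed

text \<open>The mean value theorem along segments bounds all quotients by the supremum of the
  directional derivative, and their supports stay in a common ball: exactly a dominating function
  for passing to the limit under the integral.\<close>

lemma difference_quotients:
  fixes h :: "'a::euclidean_space \<Rightarrow> real" and e :: 'a
  assumes der: "\<And>x. (h has_derivative D x) (at x)"
    and cont: "continuous_on UNIV (\<lambda>x. D x e)"
    and K: "compact K" "\<And>x. x \<notin> K \<Longrightarrow> h x = 0" "\<And>x. x \<notin> K \<Longrightarrow> D x e = 0"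
  defines "q \<equiv> \<lambda>n x. real (Suc n) * (h (x + (1 / real (Suc n)) *\<^sub>R e) - h x)"
  shows "\<exists>B R. \<forall>n x. \<bar>q n x\<bar> \<le> B * indicator (cball 0 R) x" "(\<lambda>n. q n x) \<longlonglongrightarrow> D x e"
proof -
  obtain B where B: "\<And>x. \<bar>D x e\<bar> \<le> B"
    using continuous_compact_support_bounded[OF cont K(1,3)] by blast
  define t where "t n = 1 / real (Suc n)" for n
  have t: "0 < t n" "t n \<le> 1" for n by (auto simp: t_def)
  have t0: "t \<longlonglongrightarrow> 0" unfolding t_def by (rule LIMSEQ_Suc[OF lim_1_over_n])
  have qt: "q n x = (h (x + t n *\<^sub>R e) - h x) / t n" for n x by (simp add: q_def t_def)
  have line: "((\<lambda>s. h (x + s *\<^sub>R e)) has_real_derivative D (x + s *\<^sub>R e) e) (at s)" for x s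
  proof -
    have "((\<lambda>s. x + s *\<^sub>R e) has_derivative (\<lambda>y. y *\<^sub>R e)) (at s)"
      by (auto intro!: derivative_eq_intros)
    from diff_chain_at[OF this der]
    have "((\<lambda>s. h (x + s *\<^sub>R e)) has_derivative (\<lambda>y. D (x + s *\<^sub>R e) (y *\<^sub>R e))) (at s)"
      by (simp add: o_def)
    moreover have "D (x + s *\<^sub>R e) (y *\<^sub>R e) = D (x + s *\<^sub>R e) e * y" for y
      using linear_cmul[OF has_derivative_linear[OF der]] by simp
    ultimately show ?thesis by (simp add: has_field_derivative_def)
  qed
  have qB: "\<bar>q n x\<bar> \<le> B" for n x
  proof -
    obtain z where "h (x + t n *\<^sub>R e) - h (x + 0 *\<^sub>R e) = (t n - 0) * D (x + z *\<^sub>R e) e"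
      using MVT2[OF t(1)[of n], of "\<lambda>s. h (x + s *\<^sub>R e)" "\<lambda>s. D (x + s *\<^sub>R e) e"] line by blast
    then have "q n x = D (x + z *\<^sub>R e) e" using t(1)[of n] by (simp add: qt)
    then show ?thesis using B by simp
  qed
  obtain R where R: "R > 0" "\<And>x. x \<in> K \<Longrightarrow> norm x \<le> R"
    using compact_imp_bounded[OF K(1)] bounded_pos by metis
  \<comment> \<open>The step lengths are at most 1, so a shift moves a point by at most
    \<open>norm e\<close>; hence the enlarged radius.\<close>
  have "\<bar>q n x\<bar> \<le> B * indicator (cball 0 (R + norm e)) x" for n x
  proof (cases "norm x \<le> R + norm e")
    case True
    then show ?thesis using qB by simp
  next
    case False
    then have "x \<notin> K" using R(2)[of x] norm_ge_zero[of e] by linarith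
    moreover have "x + t n *\<^sub>R e \<notin> K"
    proof
      assume "x + t n *\<^sub>R e \<in> K"
      moreover have "norm x \<le> norm (x + t n *\<^sub>R e) + norm (t n *\<^sub>R e)"
        using norm_triangle_ineq4[of "x + t n *\<^sub>R e" "t n *\<^sub>R e"] by simp
      moreover have "norm (t n *\<^sub>R e) \<le> norm e" using t[of n] by (simp add: mult_left_le_one_le)
      ultimately show False using R(2)[of "x + t n *\<^sub>R e"] False by linarith
    qed
    ultimately show ?thesis using False K(2) by (simp add: qt)
  qed
  then show "\<exists>B R. \<forall>n x. \<bar>q n x\<bar> \<le> B * indicator (cball 0 R) x" by blast
  have "((\<lambda>s. (h (x + (0 + s) *\<^sub>R e) - h (x + 0 *\<^sub>R e)) / s) \<longlongrightarrow> D (x + 0 *\<^sub>R e) e) (at 0)"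
    using line[of x 0] unfolding DERIV_def .
  moreover have "filterlim t (at 0) sequentially"
    using t0 t(1) by (simp add: filterlim_at less_imp_neq[symmetric] eventually_sequentiallyI)
  ultimately have "(\<lambda>n. (h (x + (0 + t n) *\<^sub>R e) - h (x + 0 *\<^sub>R e)) / t n) \<longlonglongrightarrow> D (x + 0 *\<^sub>R e) e"
    by (rule filterlim_compose)
  then show "(\<lambda>n. q n x) \<longlonglongrightarrow> D x e" by (simp add: qt)
qed

lemma indicator_cball_integrable_lborel: "integrable lborel (\<lambda>x. B * indicator (cball a r) x :: real)"
  by (intro integrable_mult_right integrable_real_indicator) (auto simp: emeasure_compact_finite[simplified])

text \<open>Translation invariance of the integral makes every difference quotient integrate to 0,
  and dominated convergence carries this over to the derivative. Iterated integration along
  coordinate lines is avoided.\<close>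

lemma integral_derivative_compact_support:
  fixes h :: "'a::euclidean_space \<Rightarrow> real" and e :: 'a
  assumes der: "\<And>x. (h has_derivative D x) (at x)"
    and cont: "continuous_on UNIV (\<lambda>x. D x e)"
    and K: "compact K" "\<And>x. x \<notin> K \<Longrightarrow> h x = 0" "\<And>x. x \<notin> K \<Longrightarrow> D x e = 0"
  shows "(LINT x|lborel. D x e) = 0"
proof -
  have ch: "continuous_on UNIV h"
    using der by (auto intro!: continuous_at_imp_continuous_on has_derivative_continuous)
  then have mh[measurable]: "h \<in> borel_measurable borel" by (intro borel_measurable_continuous_onI)
  obtain C where C: "\<And>x. \<bar>h x\<bar> \<le> C"
    using continuous_compact_support_bounded[OF ch K(1,2)] by blast
  have inth: "integrable lborel h" by (rule integrable_compact_support[OF mh K(1,2) C])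
  define q where "q = (\<lambda>n x. real (Suc n) * (h (x + (1 / real (Suc n)) *\<^sub>R e) - h x))"
  have Q: "\<exists>B R. \<forall>n x. \<bar>q n x\<bar> \<le> B * indicator (cball 0 R) x" "(\<lambda>n. q n x) \<longlonglongrightarrow> D x e" for x
    unfolding q_def by (rule difference_quotients[OF der cont K]; assumption)+
  obtain B R where BR: "\<And>n x. \<bar>q n x\<bar> \<le> B * indicator (cball 0 R) x" using Q(1) by blast
  have int0: "(LINT x|lborel. q n x) = 0" for n
  proof -
    define s where "s = 1 / real (Suc n)"
    have i2: "integrable lborel (\<lambda>x. h (x + s *\<^sub>R e))"
    proof (rule integrable_compact_support[where B = C])
      show "compact ((\<lambda>x. x - s *\<^sub>R e) ` K)"
        using K(1) compact_translation_subtract by blast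
      fix x assume "x \<notin> (\<lambda>x. x - s *\<^sub>R e) ` K"
      then have "x + s *\<^sub>R e \<notin> K" by (metis add_diff_cancel_right' imageI)
      then show "h (x + s *\<^sub>R e) = 0" by (rule K(2))
    qed (use C in auto)
    then have "(LINT x|lborel. q n x) = real (Suc n) * ((LINT x|lborel. h (x + s *\<^sub>R e)) - (LINT x|lborel. h x))"
      unfolding q_def s_def[symmetric] using inth by simp
    then show ?thesis by (simp add: integral_translate_lborel)
  qed
  have "(\<lambda>n. LINT x|lborel. q n x) \<longlonglongrightarrow> (LINT x|lborel. D x e)"
  proof (rule integral_dominated_convergence[OF _ _ indicator_cball_integrable_lborel[of B 0 R]])
    show "(\<lambda>x. D x e) \<in> borel_measurable lborel"
      using borel_measurable_continuous_onI[OF cont] by simp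
    show "(\<lambda>x. q n x) \<in> borel_measurable lborel" for n
      unfolding q_def by measurable
  qed (use Q(2) BR in auto)
  then have "(\<lambda>n::nat. 0) \<longlonglongrightarrow> (LINT x|lborel. D x e)" by (simp only: int0)
  from LIMSEQ_unique[OF this tendsto_const] show ?thesis .
qed

lemma integral_lebesgue_on_eq_lborel:
  fixes f :: "'a::euclidean_space \<Rightarrow> real"
  assumes "open \<Omega>" "f \<in> borel_measurable borel" "\<And>x. x \<notin> \<Omega> \<Longrightarrow> f x = 0"
  shows "(LINT x|lebesgue_on \<Omega>. f x) = (LINT x|lborel. f x)"
proof -
  have "(LINT x|lebesgue_on \<Omega>. f x) = (LINT x|lebesgue. indicator \<Omega> x *\<^sub>R f x)"
    using open_in_sets_lebesgue[OF assms(1)] by (intro integral_restrict_space) simp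
  also have "(\<lambda>x. indicator \<Omega> x *\<^sub>R f x) = f"
    using assms(3) by (auto simp: indicator_def fun_eq_iff)
  also have "(LINT x|lebesgue. f x) = (LINT x|lborel. f x)"
    using assms(2) by (intro integral_completion) simp
  finally show ?thesis .
qed

text \<open>The product rule, integrated: the partial derivative of the compactly supported product
  has integral 0.\<close>

lemma test_functions_parts:
  assumes "open \<Omega>" "\<phi> \<in> test_functions \<Omega>" "\<psi> \<in> test_functions \<Omega>" "i \<in> Basis"
  shows "L2_inner \<Omega> \<phi> (pderiv_at \<psi> i) = - L2_inner \<Omega> (pderiv_at \<phi> i) \<psi>"
proof -
  note p = test_function_partial[OF assms(2,4)] test_function_partial[OF assms(3,4)]
  obtain K where K: "compact K" "K \<subseteq> \<Omega>" "\<And>x. x \<notin> K \<Longrightarrow> \<phi> x = 0" using test_function_support[OF assms(2)] by metis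
  define D where "D x v = \<phi> x * frechet_derivative \<psi> (at x) v + frechet_derivative \<phi> (at x) v * \<psi> x" for x v
  obtain L where L: "compact L" "\<And>x. x \<notin> L \<Longrightarrow> pderiv_at \<phi> i x = 0" using test_function_support[OF p(1)] by metis
  have "(LINT x|lborel. D x i) = 0"
  proof (rule integral_derivative_compact_support[where h = "\<lambda>x. \<phi> x * \<psi> x" and K = "K \<union> L"])
    show "((\<lambda>x. \<phi> x * \<psi> x) has_derivative D x) (at x)" for x
      using has_derivative_mult[OF test_function_has_derivative[OF assms(2)] test_function_has_derivative[OF assms(3)]]
      by (simp add: D_def[abs_def])
    show "continuous_on UNIV (\<lambda>x. D x i)"
      unfolding D_def by (intro continuous_intros test_function_continuous[OF assms(2)] test_function_continuous[OF assms(3)]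
          test_function_continuous[OF p(1)] test_function_continuous[OF p(2)])
  qed (use K L in \<open>auto simp: D_def\<close>)
  moreover have "(LINT x|lborel. D x i) = (LINT x|lebesgue_on \<Omega>. D x i)"
  proof (rule integral_lebesgue_on_eq_lborel[symmetric, OF assms(1)])
    show "(\<lambda>x. D x i) \<in> borel_measurable borel"
      unfolding D_def using test_function_borel[OF assms(2)] test_function_borel[OF assms(3)]
        test_function_borel[OF p(1)] test_function_borel[OF p(2)] by simp
    show "D x i = 0" if "x \<notin> \<Omega>" for x
    proof -
      obtain M where "M \<subseteq> \<Omega>" "\<And>x. x \<notin> M \<Longrightarrow> \<psi> x = 0" using test_function_support[OF assms(3)] by metis
      moreover have "\<phi> x = 0" using K(2,3) that by blast
      ultimately show ?thesis using that by (auto simp: D_def)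
    qed
  qed
  moreover have "(LINT x|lebesgue_on \<Omega>. D x i) = L2_inner \<Omega> \<phi> (pderiv_at \<psi> i) + L2_inner \<Omega> (pderiv_at \<phi> i) \<psi>"
    unfolding D_def L2_inner_def using assms p by (simp add: L2_mult_integrable test_function_L2)
  ultimately show ?thesis by simp
qed

lemma test_function_H1:
  assumes "open \<Omega>" "\<phi> \<in> test_functions \<Omega>"
  shows "\<phi> \<in> H1 \<Omega>" "i \<in> Basis \<Longrightarrow> AE x in lebesgue_on \<Omega>. weak_partial \<Omega> i \<phi> x = pderiv_at \<phi> i x"
proof -
  have a: "pderiv_at \<phi> i \<in> L2 \<Omega>" if "i \<in> Basis" for i
    using test_function_L2[OF assms(1) test_function_partial[OF assms(2) that]] .
  have b: "L2_inner \<Omega> \<phi> (pderiv_at \<psi> i) = - L2_inner \<Omega> (pderiv_at \<phi> i) \<psi>" if "i \<in> Basis" "\<psi> \<in> test_functions \<Omega>" for i \<psi>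
    using test_functions_parts[OF assms that(2,1)] .
  show "\<phi> \<in> H1 \<Omega>" "i \<in> Basis \<Longrightarrow> AE x in lebesgue_on \<Omega>. weak_partial \<Omega> i \<phi> x = pderiv_at \<phi> i x"
    using H1_I[OF assms(1) test_function_L2[OF assms] a b] by simp_all
qed

section \<open>Linear combinations of test functions and approximation in \<open>H10\<close>\<close>

lemma Ck_on_lincomb:
  assumes "Ck_on k UNIV f" "Ck_on k UNIV g"
  shows "Ck_on k UNIV (\<lambda>x. c * f x + d * g x)"
  using assms
proof (induction k arbitrary: f g)
  case 0
  then show ?case by (auto intro!: continuous_intros)
next
  case (Suc k)
  have fr: "(f has_derivative frechet_derivative f (at x)) (at x)" "(g has_derivative frechet_derivative g (at x)) (at x)" for x
    using Suc.prems by (auto simp: differentiable_on_def frechet_derivative_works)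
  then have d: "((\<lambda>x. c * f x + d * g x) has_derivative
      (\<lambda>v. c * frechet_derivative f (at x) v + d * frechet_derivative g (at x) v)) (at x)" for x
    by (intro has_derivative_add has_derivative_mult_right)
  have "frechet_derivative (\<lambda>x. c * f x + d * g x) (at x) = (\<lambda>v. c * frechet_derivative f (at x) v + d * frechet_derivative g (at x) v)" for x
    using frechet_derivative_at[OF d] by metis
  moreover have "(\<lambda>x. c * f x + d * g x) differentiable_on UNIV"
    using d by (auto simp: differentiable_on_def differentiable_def)
  ultimately show ?case using Suc by simp
qed

lemma test_function_lincomb:
  assumes "\<phi> \<in> test_functions \<Omega>" "\<psi> \<in> test_functions \<Omega>"
  shows "(\<lambda>x. c * \<phi> x + d * \<psi> x) \<in> test_functions \<Omega>"
proof -
  let ?A = "closure {x. \<phi> x \<noteq> 0}" and ?B = "closure {x. \<psi> x \<noteq> 0}" and ?C = "closure {x. c * \<phi> x + d * \<psi> x \<noteq> 0}"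
  have "{x. c * \<phi> x + d * \<psi> x \<noteq> 0} \<subseteq> ?A \<union> ?B"
  proof
    fix x assume "x \<in> {x. c * \<phi> x + d * \<psi> x \<noteq> 0}"
    then have "x \<in> {x. \<phi> x \<noteq> 0} \<or> x \<in> {x. \<psi> x \<noteq> 0}" by auto
    then show "x \<in> ?A \<union> ?B" by (meson UnCI closure_subset subsetD)
  qed
  then have sub: "?C \<subseteq> ?A \<union> ?B" by (rule closure_minimal) auto
  have AB: "compact (?A \<union> ?B)" "?A \<union> ?B \<subseteq> \<Omega>" using assms by (auto simp: test_functions_def)
  have "compact ?C" using compact_Int_closed[OF AB(1), of ?C] sub by (simp add: Int_absorb1)
  then show ?thesis using sub AB(2) assms by (auto simp: test_functions_def smooth_on_def intro!: Ck_on_lincomb)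
qed

lemma pderiv_lincomb:
  assumes "\<phi> \<in> test_functions \<Omega>" "\<psi> \<in> test_functions \<Omega>"
  shows "frechet_derivative (\<lambda>x. c * \<phi> x + d * \<psi> x) (at x) i =
    c * frechet_derivative \<phi> (at x) i + d * frechet_derivative \<psi> (at x) i"
proof -
  have "((\<lambda>x. c * \<phi> x + d * \<psi> x) has_derivative
      (\<lambda>v. c * frechet_derivative \<phi> (at x) v + d * frechet_derivative \<psi> (at x) v)) (at x)"
    using test_function_has_derivative assms by (intro has_derivative_add has_derivative_mult_right) blast+
  from frechet_derivative_at[OF this] show ?thesis by metis
qed

lemma H10_subset_H1: "f \<in> H10 \<Omega> \<Longrightarrow> f \<in> H1 \<Omega>"
  by (simp add: H10_def)

lemma H10_approx:
  assumes "open \<Omega>" "f \<in> H10 \<Omega>"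
  shows "\<exists>\<phi>. (\<forall>n::nat. \<phi> n \<in> test_functions \<Omega>) \<and> (\<lambda>n. Lq_norm \<Omega> 2 (\<lambda>x. \<phi> n x - f x)) \<longlonglongrightarrow> 0 \<and>
    (\<forall>i\<in>Basis. (\<lambda>n. Lq_norm \<Omega> 2 (\<lambda>x. pderiv_at (\<phi> n) i x - weak_partial \<Omega> i f x)) \<longlonglongrightarrow> 0)"
proof -
  obtain \<phi> where \<phi>: "\<And>n::nat. \<phi> n \<in> test_functions \<Omega>" "(\<lambda>n. H1_norm \<Omega> (\<lambda>x. \<phi> n x - f x)) \<longlonglongrightarrow> 0"
    using assms(2) by (auto simp: H10_def)
  have f: "f \<in> H1 \<Omega>" by (rule H10_subset_H1[OF assms(2)])
  have ev: "\<forall>\<^sub>F n in sequentially. \<phi> n \<in> H1 \<Omega>"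
    by (simp add: test_function_H1(1)[OF assms(1) \<phi>(1)])
  have eq: "Lq_norm \<Omega> 2 (\<lambda>x. weak_partial \<Omega> i (\<phi> n) x - weak_partial \<Omega> i f x) =
      Lq_norm \<Omega> 2 (\<lambda>x. pderiv_at (\<phi> n) i x - weak_partial \<Omega> i f x)" if i: "i \<in> Basis" for n i
    using test_function_H1[OF assms(1) \<phi>(1)[of n]] i f
      test_function_L2[OF assms(1) test_function_partial[OF \<phi>(1)[of n] i]]
    by (intro Lq_norm_cong_AE L2_measurable L2_diff H1_weak_partial(2)[OF assms(1)]) auto
  show ?thesis
    using H1_norm_diff_tendsto_iff[OF assms(1) ev f] \<phi> eq by (intro exI[of _ \<phi>]) auto
qed

text \<open>Closedness of the weak derivative: integration by parts for the smooth approximants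
  passes to the limit on both sides, so the limit of their partials is the weak partial of the
  limit. This is how the minimiser of the Rayleigh quotient is placed in \<open>H10\<close>.\<close>

lemma H10_I:
  assumes "open \<Omega>" "f \<in> L2 \<Omega>" "\<And>i. i \<in> Basis \<Longrightarrow> g i \<in> L2 \<Omega>" "\<And>n::nat. \<phi> n \<in> test_functions \<Omega>"
    and f: "(\<lambda>n. Lq_norm \<Omega> 2 (\<lambda>x. \<phi> n x - f x)) \<longlonglongrightarrow> 0"
    and g: "\<And>i. i \<in> Basis \<Longrightarrow> (\<lambda>n. Lq_norm \<Omega> 2 (\<lambda>x. pderiv_at (\<phi> n) i x - g i x)) \<longlonglongrightarrow> 0"
  shows "f \<in> H10 \<Omega>" "i \<in> Basis \<Longrightarrow> AE x in lebesgue_on \<Omega>. weak_partial \<Omega> i f x = g i x"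
proof -
  have *: "L2_inner \<Omega> f (pderiv_at \<psi> i) = - L2_inner \<Omega> (g i) \<psi>" if i: "i \<in> Basis" and \<psi>: "\<psi> \<in> test_functions \<Omega>" for i \<psi>
  proof (rule LIMSEQ_unique)
    note L = test_function_L2[OF assms(1)]
    have z: "(\<lambda>n. Lq_norm \<Omega> 2 (\<lambda>x. h x - h x)) \<longlonglongrightarrow> 0" for h :: "'a \<Rightarrow> real"
      by (simp add: Lq_norm_def)
    show "(\<lambda>n. L2_inner \<Omega> (\<phi> n) (pderiv_at \<psi> i)) \<longlonglongrightarrow> L2_inner \<Omega> f (pderiv_at \<psi> i)"
      by (rule L2_tendsto_inner[OF f z]) (use assms L test_function_partial[OF \<psi> i] in auto)
    have "(\<lambda>n. - L2_inner \<Omega> (pderiv_at (\<phi> n) i) \<psi>) \<longlonglongrightarrow> - L2_inner \<Omega> (g i) \<psi>"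
      by (intro tendsto_minus L2_tendsto_inner[OF g[OF i] z]) (use assms i L L[OF test_function_partial[OF assms(4) i]] \<psi> in auto)
    then show "(\<lambda>n. L2_inner \<Omega> (\<phi> n) (pderiv_at \<psi> i)) \<longlonglongrightarrow> - L2_inner \<Omega> (g i) \<psi>"
      using test_functions_parts[OF assms(1) assms(4) \<psi> i] by simp
  qed
  note H = H1_I[OF assms(1-3) *]
  show "AE x in lebesgue_on \<Omega>. weak_partial \<Omega> i f x = g i x" if "i \<in> Basis"
    using H(2)[OF _ _ _ that] by simp
  have fH: "f \<in> H1 \<Omega>" using H(1) by simp
  have ev: "\<forall>\<^sub>F n in sequentially. \<phi> n \<in> H1 \<Omega>"
    by (simp add: test_function_H1(1)[OF assms(1) assms(4)])
  have eq: "Lq_norm \<Omega> 2 (\<lambda>x. weak_partial \<Omega> i (\<phi> n) x - weak_partial \<Omega> i f x) =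
      Lq_norm \<Omega> 2 (\<lambda>x. pderiv_at (\<phi> n) i x - g i x)" if i: "i \<in> Basis" for n i
  proof (rule Lq_norm_cong_AE)
    show "AE x in lebesgue_on \<Omega>. weak_partial \<Omega> i (\<phi> n) x - weak_partial \<Omega> i f x = pderiv_at (\<phi> n) i x - g i x"
      using test_function_H1(2)[OF assms(1,4) i, of n] H(2)[OF _ _ _ i] by (auto elim: eventually_elim2)
  qed (use test_function_H1(1)[OF assms(1,4)] i fH assms(1,3) H1_weak_partial(2)[OF assms(1)]
      test_function_L2[OF assms(1) test_function_partial[OF assms(4) i]] in \<open>auto intro!: L2_measurable L2_diff\<close>)
  show "f \<in> H10 \<Omega>"
    using H1_norm_diff_tendsto_iff[OF assms(1) ev fH] eq f g fH assms(4)
    by (auto simp: H10_def intro!: exI[of _ \<phi>])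
qed

lemma L2_norm_lincomb_le:
  assumes "f \<in> L2 \<Omega>" "g \<in> L2 \<Omega>"
  shows "Lq_norm \<Omega> 2 (\<lambda>x. c * f x + d * g x) \<le> \<bar>c\<bar> * Lq_norm \<Omega> 2 f + \<bar>d\<bar> * Lq_norm \<Omega> 2 g"
  using L2_norm_triangle[OF L2_cmult[OF assms(1), of c] L2_cmult[OF assms(2), of d]]
  by (simp add: L2_norm_cmult)

lemma L2_tendsto_lincomb:
  assumes f: "((\<lambda>s. Lq_norm \<Omega> 2 (\<lambda>x. f s x - f' x)) \<longlongrightarrow> 0) F"
    and g: "((\<lambda>s. Lq_norm \<Omega> 2 (\<lambda>x. g s x - g' x)) \<longlongrightarrow> 0) F"
    and fL: "\<forall>\<^sub>F s in F. f s \<in> L2 \<Omega>" "f' \<in> L2 \<Omega>"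
    and gL: "\<forall>\<^sub>F s in F. g s \<in> L2 \<Omega>" "g' \<in> L2 \<Omega>"
  shows "((\<lambda>s. Lq_norm \<Omega> 2 (\<lambda>x. (c * f s x + d * g s x) - (c * f' x + d * g' x))) \<longlongrightarrow> 0) F"
proof (rule Lim_null_comparison)
  show "\<forall>\<^sub>F s in F. norm (Lq_norm \<Omega> 2 (\<lambda>x. (c * f s x + d * g s x) - (c * f' x + d * g' x))) \<le>
      \<bar>c\<bar> * Lq_norm \<Omega> 2 (\<lambda>x. f s x - f' x) + \<bar>d\<bar> * Lq_norm \<Omega> 2 (\<lambda>x. g s x - g' x)"
    using fL(1) gL(1)
  proof eventually_elim
    case (elim s)
    have "(\<lambda>x. (c * f s x + d * g s x) - (c * f' x + d * g' x)) = (\<lambda>x. c * (f s x - f' x) + d * (g s x - g' x))"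
      by (simp add: algebra_simps)
    then show ?case
      using L2_norm_lincomb_le[OF L2_diff[OF elim(1) fL(2)] L2_diff[OF elim(2) gL(2)], of c d]
      by (simp add: L2_norm_nonneg)
  qed
  show "((\<lambda>s. \<bar>c\<bar> * Lq_norm \<Omega> 2 (\<lambda>x. f s x - f' x) + \<bar>d\<bar> * Lq_norm \<Omega> 2 (\<lambda>x. g s x - g' x)) \<longlongrightarrow> 0) F"
    using tendsto_add[OF tendsto_mult[OF tendsto_const[of "\<bar>c\<bar>"] f] tendsto_mult[OF tendsto_const[of "\<bar>d\<bar>"] g]] by simp
qed

lemma H10_lincomb:
  assumes "open \<Omega>" "f \<in> H10 \<Omega>" "g \<in> H10 \<Omega>"
  shows "(\<lambda>x. c * f x + d * g x) \<in> H10 \<Omega>"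
proof -
  obtain \<phi> where \<phi>: "\<And>n::nat. \<phi> n \<in> test_functions \<Omega>" "(\<lambda>n. Lq_norm \<Omega> 2 (\<lambda>x. \<phi> n x - f x)) \<longlonglongrightarrow> 0"
    "\<And>i. i \<in> Basis \<Longrightarrow> (\<lambda>n. Lq_norm \<Omega> 2 (\<lambda>x. pderiv_at (\<phi> n) i x - weak_partial \<Omega> i f x)) \<longlonglongrightarrow> 0"
    using H10_approx[OF assms(1,2)] by blast
  obtain \<psi> where \<psi>: "\<And>n::nat. \<psi> n \<in> test_functions \<Omega>" "(\<lambda>n. Lq_norm \<Omega> 2 (\<lambda>x. \<psi> n x - g x)) \<longlonglongrightarrow> 0"
    "\<And>i. i \<in> Basis \<Longrightarrow> (\<lambda>n. Lq_norm \<Omega> 2 (\<lambda>x. pderiv_at (\<psi> n) i x - weak_partial \<Omega> i g x)) \<longlonglongrightarrow> 0"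
    using H10_approx[OF assms(1,3)] by blast
  note fH = H10_subset_H1[OF assms(2)] H10_subset_H1[OF assms(3)]
  note wL = H1_weak_partial(2)[OF assms(1) fH(1)] H1_weak_partial(2)[OF assms(1) fH(2)]
  note tL = test_function_L2[OF assms(1)]
  show ?thesis
  proof (rule H10_I(1)[OF assms(1), where \<phi> = "\<lambda>n x. c * \<phi> n x + d * \<psi> n x"
        and g = "\<lambda>i x. c * weak_partial \<Omega> i f x + d * weak_partial \<Omega> i g x"])
    show "(\<lambda>x. c * f x + d * g x) \<in> L2 \<Omega>" using fH by (intro L2_add L2_cmult H1_subset_L2)
    show "(\<lambda>x. c * weak_partial \<Omega> i f x + d * weak_partial \<Omega> i g x) \<in> L2 \<Omega>" if "i \<in> Basis" for i
      using wL that by (intro L2_add L2_cmult)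
    show "(\<lambda>x. c * \<phi> n x + d * \<psi> n x) \<in> test_functions \<Omega>" for n using \<phi>(1) \<psi>(1) by (rule test_function_lincomb)
    show "(\<lambda>n. Lq_norm \<Omega> 2 (\<lambda>x. c * \<phi> n x + d * \<psi> n x - (c * f x + d * g x))) \<longlonglongrightarrow> 0"
      using fH tL \<phi>(1) \<psi>(1) by (intro L2_tendsto_lincomb \<phi>(2) \<psi>(2)) (auto intro: H1_subset_L2)
    show "(\<lambda>n. Lq_norm \<Omega> 2 (\<lambda>x. pderiv_at (\<lambda>x. c * \<phi> n x + d * \<psi> n x) i x -
        (c * weak_partial \<Omega> i f x + d * weak_partial \<Omega> i g x))) \<longlonglongrightarrow> 0" if i: "i \<in> Basis" for i
      unfolding pderiv_lincomb[OF \<phi>(1) \<psi>(1)]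
      using i wL tL[OF test_function_partial[OF \<phi>(1) i]] tL[OF test_function_partial[OF \<psi>(1) i]]
      by (intro L2_tendsto_lincomb \<phi>(3) \<psi>(3)) auto
  qed
qed

lemma H10_cmult: "open \<Omega> \<Longrightarrow> f \<in> H10 \<Omega> \<Longrightarrow> (\<lambda>x. c * f x) \<in> H10 \<Omega>"
  using H10_lincomb[of \<Omega> f f c 0] by simp

text \<open>For a test function in place of \<open>v\<close> this is the definition of the weak
  partial of \<open>p\<close>; both sides are continuous in \<open>v\<close> along the approximating
  sequence. The vanishing boundary values are used only through this approximation.\<close>

lemma H10_parts:
  assumes "open \<Omega>" "p \<in> H1 \<Omega>" "v \<in> H10 \<Omega>" "i \<in> Basis"
  shows "L2_inner \<Omega> p (weak_partial \<Omega> i v) = - L2_inner \<Omega> (weak_partial \<Omega> i p) v"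
proof -
  obtain \<phi> where \<phi>: "\<And>n::nat. \<phi> n \<in> test_functions \<Omega>" "(\<lambda>n. Lq_norm \<Omega> 2 (\<lambda>x. \<phi> n x - v x)) \<longlonglongrightarrow> 0"
    "\<And>i. i \<in> Basis \<Longrightarrow> (\<lambda>n. Lq_norm \<Omega> 2 (\<lambda>x. pderiv_at (\<phi> n) i x - weak_partial \<Omega> i v x)) \<longlonglongrightarrow> 0"
    using H10_approx[OF assms(1,3)] by blast
  note L = H1_subset_L2[OF assms(2)] H1_weak_partial(2)[OF assms(1,2,4)]
    H1_subset_L2[OF H10_subset_H1[OF assms(3)]] H1_weak_partial(2)[OF assms(1) H10_subset_H1[OF assms(3)] assms(4)]
  note tL = test_function_L2[OF assms(1)]
  have z: "(\<lambda>n. Lq_norm \<Omega> 2 (\<lambda>x. h x - h x)) \<longlonglongrightarrow> 0" for h :: "'a \<Rightarrow> real"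
    by (simp add: Lq_norm_def)
  show ?thesis
  proof (rule LIMSEQ_unique)
    show "(\<lambda>n. L2_inner \<Omega> p (pderiv_at (\<phi> n) i)) \<longlonglongrightarrow> L2_inner \<Omega> p (weak_partial \<Omega> i v)"
      by (rule L2_tendsto_inner[OF z \<phi>(3)[OF assms(4)]]) (use L tL test_function_partial[OF \<phi>(1) assms(4)] in auto)
    have "(\<lambda>n. - L2_inner \<Omega> (weak_partial \<Omega> i p) (\<phi> n)) \<longlonglongrightarrow> - L2_inner \<Omega> (weak_partial \<Omega> i p) v"
      by (intro tendsto_minus L2_tendsto_inner[OF z \<phi>(2)]) (use L tL \<phi>(1) in auto)
    then show "(\<lambda>n. L2_inner \<Omega> p (pderiv_at (\<phi> n) i)) \<longlonglongrightarrow> - L2_inner \<Omega> (weak_partial \<Omega> i p) v"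
      using H1_inner_test[OF assms(1,2,4) \<phi>(1)] by simp
  qed
qed

lemma weak_laplacian_L2:
  assumes "open \<Omega>" "f \<in> H2 \<Omega>"
  shows "weak_laplacian \<Omega> f \<in> L2 \<Omega>"
  using assms unfolding weak_laplacian_def H2_def by (auto intro!: L2_sum H1_weak_partial(2))

text \<open>Green's formula, obtained by applying \<open>H10_parts\<close> to each first partial of
  \<open>f\<close>.\<close>

lemma grad_inner_laplacian:
  assumes "open \<Omega>" "f \<in> H2 \<Omega>" "v \<in> H10 \<Omega>"
  shows "grad_inner \<Omega> f v = - L2_inner \<Omega> (weak_laplacian \<Omega> f) v"
proof -
  have p: "weak_partial \<Omega> i f \<in> H1 \<Omega>" if "i \<in> Basis" for i using assms(2) that by (simp add: H2_def)
  have "L2_inner \<Omega> (weak_laplacian \<Omega> f) v = (\<Sum>i\<in>Basis. L2_inner \<Omega> (weak_partial \<Omega> i (weak_partial \<Omega> i f)) v)"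
    unfolding weak_laplacian_def
    using H1_weak_partial(2)[OF assms(1) p] H1_subset_L2[OF H10_subset_H1[OF assms(3)]] by (intro L2_inner_sum_left) auto
  also have "\<dots> = - grad_inner \<Omega> f v"
    using H10_parts[OF assms(1) p assms(3)] by (simp add: grad_inner_def sum_negf)
  finally show ?thesis by simp
qed

section \<open>Completeness of L2\<close>

lemma const_L2:
  assumes "open \<Omega>" "bounded \<Omega>"
  shows "(\<lambda>x. c) \<in> L2 \<Omega>"
proof (rule L2_dominated)
  show "(\<lambda>x. c * indicator (closure \<Omega>) x) \<in> L2 \<Omega>"
    using assms by (intro L2_cmult indicator_compact_L2) (auto simp: compact_closure)
  show "\<bar>c\<bar> \<le> \<bar>c * indicator (closure \<Omega>) x\<bar>" if "x \<in> \<Omega>" for x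
    using that closure_subset[of \<Omega>] by (auto simp: indicator_def)
qed simp

lemma L2_abs: "f \<in> L2 \<Omega> \<Longrightarrow> (\<lambda>x. \<bar>f x\<bar>) \<in> L2 \<Omega>"
  by (rule L2_dominated) (auto dest: L2_measurable intro!: borel_measurable_abs)

lemma L1_norm_le_L2_norm:
  assumes "open \<Omega>" "bounded \<Omega>" "f \<in> L2 \<Omega>"
  shows "(LINT x|lebesgue_on \<Omega>. \<bar>f x\<bar>) \<le> Lq_norm \<Omega> 2 (\<lambda>x. 1::real) * Lq_norm \<Omega> 2 f"
proof -
  have "Lq_norm \<Omega> 2 (\<lambda>x. \<bar>f x\<bar>) = Lq_norm \<Omega> 2 f" by (simp add: Lq_norm_def)
  then show ?thesis
    using L2_Cauchy_Schwarz[OF const_L2[OF assms(1,2), of 1] L2_abs[OF assms(3)]] by (simp add: L2_inner_def)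
qed

lemma L2_integrable: 
  assumes "open \<Omega>" "bounded \<Omega>" "f \<in> L2 \<Omega>"
  shows "integrable (lebesgue_on \<Omega>) f"
  using L2_mult_integrable[OF const_L2[OF assms(1,2), of 1] assms(3)] by simp

lemma nn_integral_L2: "f \<in> L2 \<Omega> \<Longrightarrow> (\<integral>\<^sup>+ x. ennreal ((f x)\<^sup>2) \<partial>lebesgue_on \<Omega>) = ennreal ((Lq_norm \<Omega> 2 f)\<^sup>2)"
  unfolding L2_norm_sq L2_inner_def
  by (subst nn_integral_eq_integral) (auto dest: L2_square_integrable simp: power2_eq_square)

lemma L2_nn_integralI:
  assumes "f \<in> borel_measurable (lebesgue_on \<Omega>)" "(\<integral>\<^sup>+ x. ennreal ((f x)\<^sup>2) \<partial>lebesgue_on \<Omega>) \<le> ennreal (B\<^sup>2)" "0 \<le> B"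
  shows "f \<in> L2 \<Omega>" "Lq_norm \<Omega> 2 f \<le> B"
proof -
  have "integrable (lebesgue_on \<Omega>) (\<lambda>x. (f x)\<^sup>2)"
    using assms(1,2) by (intro integrableI_bounded) (auto intro: le_less_trans)
  then show f: "f \<in> L2 \<Omega>" using assms(1) by (simp add: L2_def)
  have "(Lq_norm \<Omega> 2 f)\<^sup>2 \<le> B\<^sup>2" using assms(2) nn_integral_L2[OF f] by simp
  then show "Lq_norm \<Omega> 2 f \<le> B" using assms(3) by (rule power2_le_imp_le)
qed

text \<open>Riesz--Fischer. On a domain of finite measure, geometrically small increments in
  \<open>L2\<close> are summable in the mean, so a subsequence converges almost everywhere; Fatou's
  lemma turns this limit into a limit in \<open>L2\<close>.\<close>

lemma L2_complete:
  assumes \<Omega>: "open \<Omega>" "bounded \<Omega>" and f: "\<And>n::nat. f n \<in> L2 \<Omega>"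
    and cauchy: "\<And>e. e > 0 \<Longrightarrow> \<exists>N. \<forall>m\<ge>N. \<forall>n\<ge>N. Lq_norm \<Omega> 2 (\<lambda>x. f m x - f n x) < e"
  shows "\<exists>g\<in>L2 \<Omega>. (\<lambda>n. Lq_norm \<Omega> 2 (\<lambda>x. f n x - g x)) \<longlonglongrightarrow> 0"
proof -
  let ?M = "lebesgue_on \<Omega>"
  let ?C = "Lq_norm \<Omega> 2 (\<lambda>x. 1::real)"
  have fm[measurable]: "f n \<in> borel_measurable ?M" for n by (rule L2_measurable[OF f])
  \<comment> \<open>A subsequence so rapidly Cauchy that its increments are dominated by a geometric
    series.\<close>
  have "\<exists>r. \<forall>k. (\<forall>m\<ge>r k. \<forall>n\<ge>r k. Lq_norm \<Omega> 2 (\<lambda>x. f m x - f n x) < (1/2)^k) \<and> r k < r (Suc k)"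
  proof (rule dependent_nat_choice)
    show "\<exists>x. \<forall>m\<ge>x. \<forall>n\<ge>x. Lq_norm \<Omega> 2 (\<lambda>xa. f m xa - f n xa) < (1/2)^0"
      using cauchy[of 1] by simp
    fix x k
    obtain N where "\<forall>m\<ge>N. \<forall>n\<ge>N. Lq_norm \<Omega> 2 (\<lambda>x. f m x - f n x) < (1/2)^Suc k"
      using cauchy[of "(1/2)^Suc k"] by auto
    then show "\<exists>y. (\<forall>m\<ge>y. \<forall>n\<ge>y. Lq_norm \<Omega> 2 (\<lambda>x. f m x - f n x) < (1/2)^Suc k) \<and> x < y"
      by (intro exI[of _ "max N (Suc x)"]) auto
  qed
  then obtain r where r: "\<And>k m n. m \<ge> r k \<Longrightarrow> n \<ge> r k \<Longrightarrow> Lq_norm \<Omega> 2 (\<lambda>x. f m x - f n x) < (1/2)^k"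
    and "\<And>k. r k < r (Suc k)" by blast
  then have sm: "strict_mono r" by (simp add: strict_mono_Suc_iff)
  define d where "d k x = \<bar>f (r (Suc k)) x - f (r k) x\<bar>" for k x
  have dL: "(\<lambda>x. f (r (Suc k)) x - f (r k) x) \<in> L2 \<Omega>" for k by (intro L2_diff f)
  have dm[measurable]: "d k \<in> borel_measurable ?M" for k unfolding d_def by measurable
  have C0: "0 \<le> ?C" by (rule L2_norm_nonneg)
  have dk: "(\<integral>\<^sup>+ x. ennreal (d k x) \<partial>?M) \<le> ennreal (?C * (1/2)^k)" for k
  proof -
    have "(\<integral>\<^sup>+ x. ennreal (d k x) \<partial>?M) = ennreal (LINT x|?M. d k x)"
      unfolding d_def using L2_integrable[OF \<Omega> L2_abs[OF dL]] by (intro nn_integral_eq_integral) auto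
    also have "\<dots> \<le> ennreal (?C * Lq_norm \<Omega> 2 (\<lambda>x. f (r (Suc k)) x - f (r k) x))"
      unfolding d_def by (intro ennreal_leI L1_norm_le_L2_norm \<Omega> dL)
    also have "\<dots> \<le> ennreal (?C * (1/2)^k)"
      using r[of k "r (Suc k)" "r k"] strict_mono_less[OF sm, of k "Suc k"] C0 by (intro ennreal_leI mult_left_mono) auto
    finally show ?thesis .
  qed
  have "(\<integral>\<^sup>+ x. (\<Sum>k. ennreal (d k x)) \<partial>?M) = (\<Sum>k. \<integral>\<^sup>+ x. ennreal (d k x) \<partial>?M)"
    by (intro nn_integral_suminf) measurable
  also have "\<dots> \<le> (\<Sum>k. ennreal (?C * (1/2)^k))"
    by (intro suminf_le dk) auto
  also have "\<dots> = ennreal (\<Sum>k. ?C * (1/2)^k)"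
    using C0 by (intro suminf_ennreal2) (auto intro!: summable_mult summable_geometric)
  also have "\<dots> < \<infinity>" by simp
  finally have "AE x in ?M. (\<Sum>k. ennreal (d k x)) \<noteq> \<infinity>"
    by (intro nn_integral_noteq_infinite) (auto simp: less_top)
  then have conv: "AE x in ?M. convergent (\<lambda>k. f (r k) x)"
  proof eventually_elim
    case (elim x)
    then have "summable (\<lambda>k. d k x)" by (intro summable_suminf_not_top) (auto simp: d_def)
    then have "summable (\<lambda>k. f (r (Suc k)) x - f (r k) x)"
      using summable_norm_cancel[of "\<lambda>k. f (r (Suc k)) x - f (r k) x"] by (simp add: d_def)
    then have "convergent (\<lambda>n. \<Sum>k<n. f (r (Suc k)) x - f (r k) x)" by (simp add: summable_iff_convergent)
    then have "convergent (\<lambda>n. f (r n) x - f (r 0) x)" using sum_lessThan_telescope[of "\<lambda>k. f (r k) x"] by simp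
    then have "convergent (\<lambda>n. (f (r n) x - f (r 0) x) + f (r 0) x)" by (intro convergent_add convergent_const)
    then show ?case by simp
  qed
  define g where "g x = lim (\<lambda>k. f (r k) x)" for x
  have gm[measurable]: "g \<in> borel_measurable ?M"
    unfolding g_def by (intro borel_measurable_lim_metric fm)
  have lim: "AE x in ?M. (\<lambda>k. f (r k) x) \<longlonglongrightarrow> g x"
    using conv by eventually_elim (simp add: g_def convergent_LIMSEQ_iff)
  have bound: "(\<lambda>x. f n x - g x) \<in> L2 \<Omega> \<and> Lq_norm \<Omega> 2 (\<lambda>x. f n x - g x) \<le> (1/2)^k" if n: "n \<ge> r k" for n k
  proof -
    \<comment> \<open>Fatou's lemma with \<open>n\<close> fixed and \<open>j\<close> tending to
      infinity; the limit inferior is an honest limit almost everywhere.\<close>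
    have "(\<integral>\<^sup>+ x. ennreal ((f n x - g x)\<^sup>2) \<partial>?M) = (\<integral>\<^sup>+ x. liminf (\<lambda>j. ennreal ((f n x - f (r j) x)\<^sup>2)) \<partial>?M)"
    proof (rule nn_integral_cong_AE, use lim in eventually_elim)
      case (elim x)
      have "(\<lambda>j. ennreal ((f n x - f (r j) x)\<^sup>2)) \<longlonglongrightarrow> ennreal ((f n x - g x)\<^sup>2)"
        using elim by (intro tendsto_ennrealI tendsto_intros)
      from lim_imp_Liminf[OF sequentially_bot this] show ?case by simp
    qed
    also have "\<dots> \<le> liminf (\<lambda>j. \<integral>\<^sup>+ x. ennreal ((f n x - f (r j) x)\<^sup>2) \<partial>?M)"
      by (rule nn_integral_liminf) measurable
    also have "\<dots> = liminf (\<lambda>j. ennreal ((Lq_norm \<Omega> 2 (\<lambda>x. f n x - f (r j) x))\<^sup>2))"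
      using nn_integral_L2[OF L2_diff[OF f f]] by simp
    also have "\<dots> \<le> liminf (\<lambda>j. ennreal (((1/2)^k)\<^sup>2))"
    proof (rule Liminf_mono)
      show "\<forall>\<^sub>F j in sequentially. ennreal ((Lq_norm \<Omega> 2 (\<lambda>x. f n x - f (r j) x))\<^sup>2) \<le> ennreal (((1/2)^k)\<^sup>2)"
        using eventually_ge_at_top[of k]
      proof eventually_elim
        case (elim j)
        then have "r k \<le> r j" using sm by (simp add: strict_mono_less_eq)
        then have "Lq_norm \<Omega> 2 (\<lambda>x. f n x - f (r j) x) < (1/2)^k" using n by (intro r)
        then show ?case using L2_norm_nonneg by (intro ennreal_leI power_mono) auto
      qed
    qed
    also have "\<dots> = ennreal (((1/2)^k)\<^sup>2)" by (simp add: Liminf_const)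
    finally show ?thesis using L2_nn_integralI[of "\<lambda>x. f n x - g x" \<Omega> "(1/2)^k"] by simp
  qed
  \<comment> \<open>Here \<open>g\<close> is written as \<open>f (r 0) - (f (r 0) - g)\<close>, the
    inner difference being square integrable by \<open>bound\<close>.\<close>
  have "g \<in> L2 \<Omega>"
    using L2_diff[OF f[of "r 0"] conjunct1[OF bound[of 0 "r 0"]]] by simp
  moreover have "(\<lambda>n. Lq_norm \<Omega> 2 (\<lambda>x. f n x - g x)) \<longlonglongrightarrow> 0"
  proof (rule LIMSEQ_I)
    fix e :: real assume "e > 0"
    then obtain k where "(1/2::real)^k < e" using real_arch_pow_inv[of e "1/2"] by auto
    then show "\<exists>no. \<forall>n\<ge>no. norm (Lq_norm \<Omega> 2 (\<lambda>x. f n x - g x) - 0) < e"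
      using bound[of k] by (intro exI[of _ "r k"]) (auto intro: le_less_trans simp: abs_of_nonneg[OF L2_norm_nonneg])
  qed
  ultimately show ?thesis by blast
qed

section \<open>Translations of test functions\<close>

lemma test_function_mono: "\<phi> \<in> test_functions \<Omega> \<Longrightarrow> \<Omega> \<subseteq> \<Omega>' \<Longrightarrow> \<phi> \<in> test_functions \<Omega>'"
  by (auto simp: test_functions_def)

lemma L2_UNIV_borel_iff:
  fixes f :: "'a::euclidean_space \<Rightarrow> real"
  assumes "f \<in> borel_measurable borel"
  shows "f \<in> L2 UNIV \<longleftrightarrow> integrable lborel (\<lambda>x. (f x)\<^sup>2)"
proof -
  have m: "(\<lambda>x. (f x)\<^sup>2) \<in> lborel \<rightarrow>\<^sub>M borel" using assms by simp
  have "f \<in> borel_measurable lebesgue" using assms by (simp add: measurable_completion)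
  then show ?thesis
    using integrable_completion[OF m] by (simp add: L2_def lebesgue_on_UNIV_eq)
qed

lemma integral_UNIV_lborel:
  fixes f :: "'a::euclidean_space \<Rightarrow> real"
  assumes "f \<in> borel_measurable borel"
  shows "(LINT x|lebesgue_on UNIV. f x) = (LINT x|lborel. f x)"
  using integral_completion[of f lborel] assms by (simp add: lebesgue_on_UNIV_eq)

lemma L2_norm_UNIV_sq:
  fixes f :: "'a::euclidean_space \<Rightarrow> real"
  assumes "f \<in> borel_measurable borel"
  shows "(Lq_norm UNIV 2 f)\<^sup>2 = (LINT x|lborel. (f x)\<^sup>2)"
  unfolding L2_norm_sq L2_inner_def using assms integral_UNIV_lborel[of "\<lambda>x. f x * f x"] by (simp add: power2_eq_square)

lemma L2_translate:
  fixes f :: "'a::euclidean_space \<Rightarrow> real"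
  assumes "f \<in> borel_measurable borel" "f \<in> L2 UNIV"
  shows "(\<lambda>x. f (x + z)) \<in> L2 UNIV" "Lq_norm UNIV 2 (\<lambda>x. f (x + z)) = Lq_norm UNIV 2 f"
proof -
  have i: "integrable (distr lborel borel ((+) z)) (\<lambda>x. (f x)\<^sup>2)"
    using assms(2) L2_UNIV_borel_iff[OF assms(1)] by (simp add: lborel_distr_plus)
  have "integrable lborel (\<lambda>x. (f (z + x))\<^sup>2)"
    by (rule integrable_distr[OF _ i]) simp
  moreover have m: "(\<lambda>x. f (x + z)) \<in> borel_measurable borel" using assms(1) by measurable
  ultimately show "(\<lambda>x. f (x + z)) \<in> L2 UNIV"
    by (simp add: L2_UNIV_borel_iff add.commute)
  have "(LINT x|lborel. (f (x + z))\<^sup>2) = (LINT x|lborel. (f x)\<^sup>2)"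
    using integral_translate_lborel[of "\<lambda>x. (f x)\<^sup>2" z] assms(1) by simp
  then have "(Lq_norm UNIV 2 (\<lambda>x. f (x + z)))\<^sup>2 = (Lq_norm UNIV 2 f)\<^sup>2"
    using assms(1) m by (simp add: L2_norm_UNIV_sq)
  then show "Lq_norm UNIV 2 (\<lambda>x. f (x + z)) = Lq_norm UNIV 2 f"
    by (simp add: L2_norm_nonneg)
qed

text \<open>Telescoping over \<open>n\<close> equal steps, whose increments all have the same norm
  by translation invariance. It allows a finite shift to be controlled by arbitrarily short
  ones.\<close>

lemma translation_norm_multiple:
  fixes f :: "'a::euclidean_space \<Rightarrow> real"
  assumes "f \<in> borel_measurable borel" "f \<in> L2 UNIV"
  shows "Lq_norm UNIV 2 (\<lambda>x. f (x + real n *\<^sub>R z) - f x) \<le> real n * Lq_norm UNIV 2 (\<lambda>x. f (x + z) - f x)"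
proof (induction n)
  case 0
  then show ?case by (simp add: Lq_norm_def)
next
  case (Suc n)
  note T = L2_translate(1)[OF assms]
  let ?g = "\<lambda>x. f (x + z) - f x"
  have g: "?g \<in> borel_measurable borel" "?g \<in> L2 UNIV" using assms(1) by (measurable, intro L2_diff T assms)
  have "Lq_norm UNIV 2 (\<lambda>x. f (x + real (Suc n) *\<^sub>R z) - f x) \<le>
      Lq_norm UNIV 2 (\<lambda>x. f (x + real (Suc n) *\<^sub>R z) - f (x + real n *\<^sub>R z)) + Lq_norm UNIV 2 (\<lambda>x. f (x + real n *\<^sub>R z) - f x)"
    by (intro L2_norm_triangle_diff T assms)
  also have "(\<lambda>x. f (x + real (Suc n) *\<^sub>R z) - f (x + real n *\<^sub>R z)) = (\<lambda>x. ?g (x + real n *\<^sub>R z))"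
    by (simp add: scaleR_add_left algebra_simps)
  also have "Lq_norm UNIV 2 (\<lambda>x. ?g (x + real n *\<^sub>R z)) = Lq_norm UNIV 2 ?g"
    by (rule L2_translate(2)[OF g])
  finally show ?case using Suc by (simp add: algebra_simps)
qed

definition pgrad_sq :: "('a::euclidean_space \<Rightarrow> real) \<Rightarrow> 'a \<Rightarrow> real" where
  "pgrad_sq \<phi> x = (\<Sum>i\<in>Basis. (pderiv_at \<phi> i x)\<^sup>2)"

lemma frechet_derivative_expansion:
  assumes "\<phi> \<in> test_functions \<Omega>"
  shows "frechet_derivative \<phi> (at x) z = (\<Sum>i\<in>Basis. (z \<bullet> i) * pderiv_at \<phi> i x)"
proof -
  have lin: "linear (frechet_derivative \<phi> (at x))"
    using has_derivative_linear[OF test_function_has_derivative[OF assms]] .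
  have "frechet_derivative \<phi> (at x) z = frechet_derivative \<phi> (at x) (\<Sum>i\<in>Basis. (z \<bullet> i) *\<^sub>R i)"
    by (simp add: euclidean_representation)
  also have "\<dots> = (\<Sum>i\<in>Basis. (z \<bullet> i) * pderiv_at \<phi> i x)"
    using lin by (simp add: linear_sum linear_cmul)
  finally show ?thesis .
qed

text \<open>Cauchy--Schwarz for \<open>z\<close> and the gradient vector \<open>G\<close> that
  represents the derivative.\<close>

lemma frechet_derivative_sq_le:
  assumes "\<phi> \<in> test_functions \<Omega>"
  shows "(frechet_derivative \<phi> (at x) z)\<^sup>2 \<le> (norm z)\<^sup>2 * pgrad_sq \<phi> x"
proof -
  define G where "G = (\<Sum>i\<in>Basis. pderiv_at \<phi> i x *\<^sub>R i)"
  have 1: "frechet_derivative \<phi> (at x) z = z \<bullet> G"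
    using frechet_derivative_expansion[OF assms, of x z] by (simp add: G_def inner_sum_right mult.commute)
  have "G \<bullet> i = pderiv_at \<phi> i x" if "i \<in> Basis" for i
    using that by (simp add: G_def inner_sum_left inner_Basis if_distrib sum.delta cong: if_cong)
  then have "G \<bullet> G = pgrad_sq \<phi> x"
    unfolding pgrad_sq_def by (subst euclidean_inner) (simp add: power2_eq_square)
  then show ?thesis using Cauchy_Schwarz_ineq[of z G] by (simp add: 1 power2_norm_eq_inner)
qed

lemma test_function_L2_norm_UNIV:
  assumes "open \<Omega>" "\<phi> \<in> test_functions \<Omega>"
  shows "Lq_norm UNIV 2 \<phi> = Lq_norm \<Omega> 2 \<phi>"
proof -
  have [simp]: "\<phi> \<in> borel_measurable borel" by (rule test_function_borel[OF assms(2)])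
  obtain K where K: "K \<subseteq> \<Omega>" "\<And>x. x \<notin> K \<Longrightarrow> \<phi> x = 0" using test_function_support[OF assms(2)] by metis
  have "(LINT x|lebesgue_on \<Omega>. (\<phi> x)\<^sup>2) = (LINT x|lborel. (\<phi> x)\<^sup>2)"
    using K by (intro integral_lebesgue_on_eq_lborel assms borel_measurable_power) auto
  then show ?thesis
    by (simp add: Lq_norm_def integral_UNIV_lborel borel_measurable_power)
qed

lemma test_function_grad_inner:
  assumes "open \<Omega>" "\<phi> \<in> test_functions \<Omega>"
  shows "grad_inner \<Omega> \<phi> \<phi> = (\<Sum>i\<in>Basis. (Lq_norm \<Omega> 2 (pderiv_at \<phi> i))\<^sup>2)"
    "grad_inner \<Omega> \<phi> \<phi> = (LINT x|lborel. pgrad_sq \<phi> x)" "integrable lborel (pgrad_sq \<phi>)"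
proof -
  note p = test_function_partial[OF assms(2)]
  have "Lq_norm \<Omega> 2 (weak_partial \<Omega> i \<phi>) = Lq_norm \<Omega> 2 (pderiv_at \<phi> i)" if "i \<in> Basis" for i
    using test_function_H1[OF assms] that test_function_L2[OF assms(1) p[OF that]] H1_weak_partial(2)[OF assms(1)]
    by (intro Lq_norm_cong_AE L2_measurable) auto
  then show 1: "grad_inner \<Omega> \<phi> \<phi> = (\<Sum>i\<in>Basis. (Lq_norm \<Omega> 2 (pderiv_at \<phi> i))\<^sup>2)"
    by (simp add: grad_inner_self)
  have b: "pderiv_at \<phi> i \<in> borel_measurable borel" if "i \<in> Basis" for i by (rule test_function_borel[OF p[OF that]])
  have i: "integrable lborel (\<lambda>x. (pderiv_at \<phi> i x)\<^sup>2)" if "i \<in> Basis" for i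
    using L2_UNIV_borel_iff[OF b[OF that]] test_function_L2[OF open_UNIV test_function_mono[OF p[OF that] subset_UNIV]] by simp
  then show "integrable lborel (pgrad_sq \<phi>)" unfolding pgrad_sq_def[abs_def] by (rule Bochner_Integration.integrable_sum)
  have "(LINT x|lborel. pgrad_sq \<phi> x) = (\<Sum>i\<in>Basis. LINT x|lborel. (pderiv_at \<phi> i x)\<^sup>2)"
    unfolding pgrad_sq_def by (rule Bochner_Integration.integral_sum) (rule i)
  also have "\<dots> = (\<Sum>i\<in>Basis. (Lq_norm \<Omega> 2 (pderiv_at \<phi> i))\<^sup>2)"
    by (intro sum.cong refl) (metis L2_norm_UNIV_sq b p test_function_L2_norm_UNIV[OF assms(1)])
  finally show "grad_inner \<Omega> \<phi> \<phi> = (LINT x|lborel. pgrad_sq \<phi> x)" using 1 by simp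
qed

text \<open>Cutting the shift by \<open>z\<close> into equal pieces bounds its increment by the norm
  of the difference quotient with step \<open>z / (n + 1)\<close>; as \<open>n\<close> grows this
  becomes the norm of the derivative in direction \<open>z\<close>, which the gradient
  controls.\<close>

lemma translation_inequality:
  assumes "open \<Omega>" "\<phi> \<in> test_functions \<Omega>"
  shows "(Lq_norm UNIV 2 (\<lambda>x. \<phi> (x + z) - \<phi> x))\<^sup>2 \<le> (norm z)\<^sup>2 * grad_inner \<Omega> \<phi> \<phi>"
proof -
  have b[measurable]: "\<phi> \<in> borel_measurable borel" by (rule test_function_borel[OF assms(2)])
  have L: "\<phi> \<in> L2 UNIV" by (rule test_function_L2[OF open_UNIV test_function_mono[OF assms(2) subset_UNIV]])
  let ?K = "closure {x. \<phi> x \<noteq> 0}"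
  have K: "compact ?K" using assms(2) by (simp add: test_functions_def)
  have K': "\<phi> x = 0" if "x \<notin> ?K" for x using that closure_subset[of "{x. \<phi> x \<noteq> 0}"] by auto
  define D where "D = (\<lambda>x. frechet_derivative \<phi> (at x))"
  have Dz: "D x z = (\<Sum>i\<in>Basis. (z \<bullet> i) * pderiv_at \<phi> i x)" for x
    unfolding D_def by (rule frechet_derivative_expansion[OF assms(2)])
  have cD: "continuous_on UNIV (\<lambda>x. D x z)"
    unfolding Dz
    by (intro continuous_intros test_function_continuous[OF test_function_partial[OF assms(2)]])
  have D0: "D x z = 0" if "x \<notin> ?K" for x
    unfolding D_def frechet_derivative_zero_outside_support[OF that] ..
  have der: "(\<phi> has_derivative D x) (at x)" for x
    unfolding D_def by (rule test_function_has_derivative[OF assms(2)])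
  define q where "q = (\<lambda>n x. real (Suc n) * (\<phi> (x + (1 / real (Suc n)) *\<^sub>R z) - \<phi> x))"
  have Q: "\<exists>B R. \<forall>n x. \<bar>q n x\<bar> \<le> B * indicator (cball 0 R) x" "(\<lambda>n. q n x) \<longlonglongrightarrow> D x z" for x
    unfolding q_def by (rule difference_quotients[OF der cD K K' D0]; assumption)+
  obtain B R where BR: "\<And>n x. \<bar>q n x\<bar> \<le> B * indicator (cball 0 R) x" using Q(1) by blast
  have qm[measurable]: "q n \<in> borel_measurable borel" for n unfolding q_def by measurable
  have Dm[measurable]: "(\<lambda>x. D x z) \<in> borel_measurable borel" by (rule borel_measurable_continuous_onI[OF cD])
  have qB: "(q n x)\<^sup>2 \<le> B\<^sup>2 * indicator (cball 0 R) x" for n x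
    using BR[of n x] power_mono[OF BR[of n x], of 2] by (auto simp: indicator_def split: if_splits)
  have le: "(Lq_norm UNIV 2 (\<lambda>x. \<phi> (x + z) - \<phi> x))\<^sup>2 \<le> (LINT x|lborel. (q n x)\<^sup>2)" for n
  proof -
    let ?N = "Lq_norm UNIV 2 (\<lambda>x. \<phi> (x + (1 / real (Suc n)) *\<^sub>R z) - \<phi> x)"
    have "Lq_norm UNIV 2 (\<lambda>x. \<phi> (x + z) - \<phi> x) \<le> real (Suc n) * ?N"
      using translation_norm_multiple[OF b L, of "Suc n" "(1 / real (Suc n)) *\<^sub>R z"] by simp
    then have "(Lq_norm UNIV 2 (\<lambda>x. \<phi> (x + z) - \<phi> x))\<^sup>2 \<le> (real (Suc n) * ?N)\<^sup>2"
      by (rule power_mono) (rule L2_norm_nonneg)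
    also have "real (Suc n) * ?N = Lq_norm UNIV 2 (q n)"
      unfolding q_def by (simp add: L2_norm_cmult)
    also have "(Lq_norm UNIV 2 (q n))\<^sup>2 = (LINT x|lborel. (q n x)\<^sup>2)"
      by (rule L2_norm_UNIV_sq[OF qm])
    finally show ?thesis .
  qed
  have "(\<lambda>n. LINT x|lborel. (q n x)\<^sup>2) \<longlonglongrightarrow> (LINT x|lborel. (D x z)\<^sup>2)"
    by (rule integral_dominated_convergence[OF _ _ indicator_cball_integrable_lborel[of "B\<^sup>2" 0 R]])
      (use Q(2) qB in \<open>auto intro!: tendsto_power\<close>)
  then have "(Lq_norm UNIV 2 (\<lambda>x. \<phi> (x + z) - \<phi> x))\<^sup>2 \<le> (LINT x|lborel. (D x z)\<^sup>2)"
    by (rule LIMSEQ_le_const) (use le in auto)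
  also have "\<dots> \<le> (LINT x|lborel. (norm z)\<^sup>2 * pgrad_sq \<phi> x)"
  proof (rule integral_mono')
    show "integrable lborel (\<lambda>x. (norm z)\<^sup>2 * pgrad_sq \<phi> x)" using test_function_grad_inner(3)[OF assms] by simp
    show "(D x z)\<^sup>2 \<le> (norm z)\<^sup>2 * pgrad_sq \<phi> x" for x
      unfolding D_def by (rule frechet_derivative_sq_le[OF assms(2)])
  qed (simp add: pgrad_sq_def sum_nonneg)
  also have "\<dots> = (norm z)\<^sup>2 * grad_inner \<Omega> \<phi> \<phi>" using test_function_grad_inner(2)[OF assms] by simp
  finally show ?thesis .
qed

text \<open>A shift longer than the diameter of the domain moves the support off itself. Function
  and translate are then orthogonal, so their difference has squared norm
  \<open>2 |\<phi>|^2\<close>, and the translation inequality bounds it by the gradient.\<close>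

lemma test_function_Poincare:
  fixes \<Omega> :: "'a::euclidean_space set"
  assumes "open \<Omega>" "bounded \<Omega>"
  shows "\<exists>c>0. \<forall>\<phi>\<in>test_functions \<Omega>. c * (Lq_norm \<Omega> 2 \<phi>)\<^sup>2 \<le> grad_inner \<Omega> \<phi> \<phi>"
proof -
  obtain r where r: "r > 0" "\<And>x. x \<in> \<Omega> \<Longrightarrow> norm x \<le> r" using assms(2) bounded_pos by metis
  obtain e :: 'a where e: "e \<in> Basis" using nonempty_Basis by blast
  \<comment> \<open>Two points of the ball of radius \<open>r\<close> are at most \<open>2 r\<close>
    apart, so the length \<open>3 r\<close> is enough for disjointness.\<close>
  define z where "z = (3 * r) *\<^sub>R e"
  have nz: "norm z = 3 * r" using r(1) e by (simp add: z_def)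
  have "2 / (3 * r)\<^sup>2 * (Lq_norm \<Omega> 2 \<phi>)\<^sup>2 \<le> grad_inner \<Omega> \<phi> \<phi>" if \<phi>: "\<phi> \<in> test_functions \<Omega>" for \<phi>
  proof -
    have b[measurable]: "\<phi> \<in> borel_measurable borel" by (rule test_function_borel[OF \<phi>])
    have L: "\<phi> \<in> L2 UNIV" by (rule test_function_L2[OF open_UNIV test_function_mono[OF \<phi> subset_UNIV]])
    have out: "\<phi> x = 0" if "norm x > r" for x
    proof -
      obtain K where "K \<subseteq> \<Omega>" "\<And>x. x \<notin> K \<Longrightarrow> \<phi> x = 0" using test_function_support[OF \<phi>] by metis
      then show ?thesis using r(2)[of x] that by (meson not_less subsetD)
    qed
    have "\<phi> (x + z) * \<phi> x = 0" for x
    proof (cases "norm x \<le> r")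
      case True
      have "norm z \<le> norm (x + z) + norm x" using norm_triangle_ineq4[of "x + z" x] by simp
      then show ?thesis using True r(1) nz out[of "x + z"] by simp
    qed (use out[of x] in simp)
    then have "L2_inner UNIV (\<lambda>x. \<phi> (x + z)) \<phi> = 0" by (simp only: L2_inner_def) simp
    then have "(Lq_norm UNIV 2 (\<lambda>x. \<phi> (x + z) - \<phi> x))\<^sup>2 = 2 * (Lq_norm UNIV 2 \<phi>)\<^sup>2"
      by (simp add: L2_norm_diff_sq[OF L2_translate(1)[OF b L] L] L2_translate(2)[OF b L])
    then have "2 * (Lq_norm \<Omega> 2 \<phi>)\<^sup>2 \<le> (3 * r)\<^sup>2 * grad_inner \<Omega> \<phi> \<phi>"
      using translation_inequality[OF assms(1) \<phi>, of z] test_function_L2_norm_UNIV[OF assms(1) \<phi>] nz by simp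
    then show ?thesis using r(1) by (simp add: field_simps)
  qed
  then show ?thesis using r(1) by (intro exI[of _ "2 / (3 * r)\<^sup>2"]) auto
qed

section \<open>Compactness\<close>

text \<open>The average over the ball of radius \<open>h\<close> around \<open>x\<close>, as an
  integral over the centred ball, so that \<open>x\<close> enters only as a translation of
  \<open>f\<close>.\<close>

definition ball_average :: "real \<Rightarrow> ('a::euclidean_space \<Rightarrow> real) \<Rightarrow> 'a \<Rightarrow> real" where
  "ball_average h f x = (LINT z|restrict_space lborel (cball 0 h). f (x + z)) / measure lborel (cball (0::'a) h)"

lemma finite_measure_cball: "finite_measure (restrict_space lborel (cball (0::'a::euclidean_space) h))"
  by (rule finite_measureI) (use emeasure_bounded_finite[of "cball (0::'a) h"] in \<open>simp add: emeasure_restrict_space\<close>)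

lemma measure_cball_space: "measure (restrict_space lborel (cball (0::'a::euclidean_space) h)) (space (restrict_space lborel (cball 0 h))) = measure lborel (cball (0::'a) h)"
  by (simp add: measure_restrict_space space_restrict_space)

lemma integrable_bounded_cball:
  fixes f :: "'a::euclidean_space \<Rightarrow> real"
  assumes "f \<in> borel_measurable borel" "\<And>x. \<bar>f x\<bar> \<le> B"
  shows "integrable (restrict_space lborel (cball 0 h)) f"
proof -
  interpret finite_measure "restrict_space lborel (cball (0::'a) h)" by (rule finite_measure_cball)
  show ?thesis
    by (rule integrable_const_bound[where B = B]) (use assms in \<open>auto intro: measurable_restrict_space1\<close>)
qed

text \<open>Cauchy--Schwarz against the constant 1, from the nonnegative integral of
  \<open>(f + t)^2\<close>.\<close>

lemma (in finite_measure) integral_sq_le: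
  fixes f :: "'a \<Rightarrow> real"
  assumes "integrable M f" "integrable M (\<lambda>x. (f x)\<^sup>2)"
  shows "(LINT x|M. f x)\<^sup>2 \<le> (LINT x|M. (f x)\<^sup>2) * measure M (space M)"
proof (rule quadratic_nonneg_discriminant)
  fix t
  have "0 \<le> (LINT x|M. (f x + t)\<^sup>2)" by simp
  also have "\<dots> = (LINT x|M. (f x)\<^sup>2 + 2 * t * f x + t\<^sup>2)" by (simp add: power2_sum algebra_simps)
  also have "\<dots> = (LINT x|M. (f x)\<^sup>2) + 2 * t * (LINT x|M. f x) + t\<^sup>2 * measure M (space M)"
    using assms by simp
  finally show "0 \<le> (LINT x|M. (f x)\<^sup>2) + 2 * t * (LINT x|M. f x) + t\<^sup>2 * measure M (space M)" .
qed


lemma measure_cball_pos: "h > 0 \<Longrightarrow> measure lborel (cball (0::'a::euclidean_space) h) > 0"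
  using content_cball_pos[of h "0::'a"] by simp

lemma integral_cball_le_lborel:
  fixes f :: "'a::euclidean_space \<Rightarrow> real"
  assumes "integrable lborel f" "\<And>x. 0 \<le> f x"
  shows "(LINT z|restrict_space lborel (cball 0 h). f z) \<le> (LINT z|lborel. f z)"
proof -
  have "(LINT z|restrict_space lborel (cball 0 h). f z) = (LINT z|lborel. indicator (cball 0 h) z *\<^sub>R f z)"
    by (intro integral_restrict_space) simp
  also have "\<dots> \<le> (LINT z|lborel. f z)"
    using assms by (intro integral_mono') (auto simp: indicator_def)
  finally show ?thesis .
qed

text \<open>All three follow from Cauchy--Schwarz on the ball: a Lipschitz bound through the
  gradient, a uniform bound through the norm of \<phi>, and a pointwise bound for the error of
  averaging. The first two supply equicontinuity and boundedness in the compactness proof.\<close>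

lemma ball_average_bounds:
  fixes \<Omega> :: "'a::euclidean_space set"
  assumes "open \<Omega>" "\<phi> \<in> test_functions \<Omega>" "h > 0"
  defines "m \<equiv> measure lborel (cball (0::'a) h)"
  shows "m * (ball_average h \<phi> x - ball_average h \<phi> y)\<^sup>2 \<le> (norm (x - y))\<^sup>2 * grad_inner \<Omega> \<phi> \<phi>" (is ?A)
    and "m * (ball_average h \<phi> x)\<^sup>2 \<le> (Lq_norm \<Omega> 2 \<phi>)\<^sup>2" (is ?B)
    and "m * (\<phi> x - ball_average h \<phi> x)\<^sup>2 \<le> (LINT z|restrict_space lborel (cball 0 h). (\<phi> (x + z) - \<phi> x)\<^sup>2)" (is ?C)
proof -
  let ?M = "restrict_space lborel (cball (0::'a) h)"
  interpret finite_measure ?M by (rule finite_measure_cball)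
  have m: "m > 0" unfolding m_def by (rule measure_cball_pos[OF assms(3)])
  have mM: "measure ?M (space ?M) = m" unfolding m_def by (rule measure_cball_space)
  have b[measurable]: "\<phi> \<in> borel_measurable borel" by (rule test_function_borel[OF assms(2)])
  have L: "\<phi> \<in> L2 UNIV" by (rule test_function_L2[OF open_UNIV test_function_mono[OF assms(2) subset_UNIV]])
  obtain B where B: "B > 0" "\<And>x. \<bar>\<phi> x\<bar> \<le> B" using test_function_bounded[OF assms(2)] by metis
  have T: "(\<lambda>z. \<phi> (x + z)) \<in> L2 UNIV" "(\<lambda>z. \<phi> (x + z)) \<in> borel_measurable borel"
    "Lq_norm UNIV 2 (\<lambda>z. \<phi> (x + z)) = Lq_norm UNIV 2 \<phi>" for x
    using L2_translate[OF b L, of x] by (simp_all add: add.commute)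
  have int: "integrable ?M (\<lambda>z. \<phi> (x + z))" for x
    by (rule integrable_bounded_cball[where B = B]) (use B in auto)
  have sq: "m * (d / m)\<^sup>2 \<le> S" if "d\<^sup>2 \<le> S * m" for d S :: real
    using that m by (simp add: power2_eq_square field_simps)
  have intsq: "integrable ?M (\<lambda>z. (g z)\<^sup>2)" if "g \<in> borel_measurable borel" "\<And>z. \<bar>g z\<bar> \<le> C" for g and C :: real
  proof (rule integrable_bounded_cball[where B = "C\<^sup>2"])
    show "\<bar>(g x)\<^sup>2\<bar> \<le> C\<^sup>2" for x using power_mono[OF that(2)[of x], of 2] by simp
  qed (use that in measurable)
  have "m * (ball_average h \<phi> x - ball_average h \<phi> y)\<^sup>2 = m * ((LINT z|?M. \<phi> (x + z) - \<phi> (y + z)) / m)\<^sup>2"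
    using int by (simp add: ball_average_def m_def diff_divide_distrib)
  also have "\<dots> \<le> (LINT z|?M. (\<phi> (x + z) - \<phi> (y + z))\<^sup>2)"
  proof (rule sq)
    have bb: "\<bar>\<phi> (x + z) - \<phi> (y + z)\<bar> \<le> 2 * B" for z using B(2)[of "x + z"] B(2)[of "y + z"] by linarith
    show "(LINT z|?M. \<phi> (x + z) - \<phi> (y + z))\<^sup>2 \<le> (LINT z|?M. (\<phi> (x + z) - \<phi> (y + z))\<^sup>2) * m"
      unfolding mM[symmetric]
      by (rule integral_sq_le) (use int T(2) bb in \<open>auto intro!: intsq[where C = "2 * B"] borel_measurable_diff\<close>)
  qed
  also have "\<dots> \<le> (LINT z|lborel. (\<phi> (x + z) - \<phi> (y + z))\<^sup>2)"
    using L2_UNIV_borel_iff[of "\<lambda>z. \<phi> (x + z) - \<phi> (y + z)"] T by (intro integral_cball_le_lborel) (auto intro: L2_diff)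
  \<comment> \<open>Substituting \<open>z - y\<close> for \<open>z\<close> turns the integrand into
    the increment of \<phi> under a shift by \<open>x - y\<close>.\<close>
  also have "\<dots> = (LINT z|lborel. (\<phi> (x + (z - y)) - \<phi> (y + (z - y)))\<^sup>2)"
    using integral_translate_lborel[of "\<lambda>z. (\<phi> (x + z) - \<phi> (y + z))\<^sup>2" "- y"] by simp
  also have "\<dots> = (Lq_norm UNIV 2 (\<lambda>z. \<phi> (z + (x - y)) - \<phi> z))\<^sup>2"
    by (subst L2_norm_UNIV_sq) (simp_all add: algebra_simps)
  also have "\<dots> \<le> (norm (x - y))\<^sup>2 * grad_inner \<Omega> \<phi> \<phi>"
    by (rule translation_inequality[OF assms(1,2)])
  finally show ?A .
  have "m * (ball_average h \<phi> x)\<^sup>2 = m * ((LINT z|?M. \<phi> (x + z)) / m)\<^sup>2"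
    by (simp add: ball_average_def m_def)
  also have "\<dots> \<le> (LINT z|?M. (\<phi> (x + z))\<^sup>2)"
    by (rule sq, unfold mM[symmetric], rule integral_sq_le) (use int T(2) B(2) in \<open>auto intro!: intsq[where C = B]\<close>)
  also have "\<dots> \<le> (LINT z|lborel. (\<phi> (x + z))\<^sup>2)"
    using L2_UNIV_borel_iff[OF T(2)[of x]] T(1) by (intro integral_cball_le_lborel) auto
  also have "\<dots> = (Lq_norm \<Omega> 2 \<phi>)\<^sup>2"
    using L2_norm_UNIV_sq[OF T(2)[of x]] T(3) test_function_L2_norm_UNIV[OF assms(1,2)] by simp
  finally show ?B .
  \<comment> \<open>The constant \<open>\<phi> x\<close> is its own average, so the error is the
    average of increments, up to sign.\<close>
  have "m * (\<phi> x - ball_average h \<phi> x)\<^sup>2 = m * ((LINT z|?M. \<phi> (x + z) - \<phi> x) / m)\<^sup>2"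
    using int m mM by (simp add: ball_average_def m_def[symmetric] diff_divide_distrib power2_commute)
  also have "\<dots> \<le> (LINT z|?M. (\<phi> (x + z) - \<phi> x)\<^sup>2)"
  proof (rule sq)
    have bb: "\<bar>\<phi> (x + z) - \<phi> x\<bar> \<le> 2 * B" for z using B(2)[of "x + z"] B(2)[of "x"] by linarith
    show "(LINT z|?M. \<phi> (x + z) - \<phi> x)\<^sup>2 \<le> (LINT z|?M. (\<phi> (x + z) - \<phi> x)\<^sup>2) * m"
      unfolding mM[symmetric]
      by (rule integral_sq_le) (use int T(2) bb in \<open>auto intro!: intsq[where C = "2 * B"] borel_measurable_diff\<close>)
  qed
  finally show ?C .
qed

lemma ball_average_continuous:
  assumes "open \<Omega>" "\<phi> \<in> test_functions \<Omega>" "h > 0"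
  shows "continuous_on UNIV (ball_average h \<phi>)"
proof -
  define m where "m = measure lborel (cball (0::'a) h)"
  have m: "m > 0" unfolding m_def by (rule measure_cball_pos[OF assms(3)])
  define C where "C = sqrt (grad_inner \<Omega> \<phi> \<phi> / m)"
  have G: "0 \<le> grad_inner \<Omega> \<phi> \<phi>" by (simp add: grad_inner_self sum_nonneg)
  have "dist (ball_average h \<phi> x) (ball_average h \<phi> y) \<le> C * dist x y" for x y
  proof (rule power2_le_imp_le)
    show "(dist (ball_average h \<phi> x) (ball_average h \<phi> y))\<^sup>2 \<le> (C * dist x y)\<^sup>2"
      using ball_average_bounds(1)[OF assms, of x y] m G
      by (simp add: m_def[symmetric] C_def dist_norm power_mult_distrib field_simps)
  qed (use m G in \<open>simp add: C_def\<close>)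
  then have "C-lipschitz_on UNIV (ball_average h \<phi>)" using m G by (intro lipschitz_onI) (auto simp: C_def)
  then show ?thesis by (rule lipschitz_on_continuous_on)
qed

text \<open>The squared error is at most the average over \<open>z\<close> of squared increments.
  Exchanging the integrals leaves, for each \<open>z\<close> of the ball, the squared norm of a
  translation increment, at most \<open>h^2\<close> times the Dirichlet form; the division by the
  volume \<open>m\<close> cancels on integration over the ball.\<close>

lemma ball_average_error:
  fixes \<Omega> :: "'a::euclidean_space set"
  assumes "open \<Omega>" "\<phi> \<in> test_functions \<Omega>" "h > 0"
  shows "(\<lambda>x. \<phi> x - ball_average h \<phi> x) \<in> L2 \<Omega>"
    "(Lq_norm \<Omega> 2 (\<lambda>x. \<phi> x - ball_average h \<phi> x)) \<le> h * sqrt (grad_inner \<Omega> \<phi> \<phi>)"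
proof -
  let ?M = "restrict_space lborel (cball (0::'a) h)"
  define m where "m = measure lborel (cball (0::'a) h)"
  have m: "m > 0" unfolding m_def by (rule measure_cball_pos[OF assms(3)])
  define G where "G = grad_inner \<Omega> \<phi> \<phi>"
  have G: "0 \<le> G" by (simp add: G_def grad_inner_self sum_nonneg)
  interpret M: finite_measure ?M by (rule finite_measure_cball)
  interpret pair_sigma_finite lborel ?M ..
  have b[measurable]: "\<phi> \<in> borel_measurable borel" by (rule test_function_borel[OF assms(2)])
  have L: "\<phi> \<in> L2 UNIV" by (rule test_function_L2[OF open_UNIV test_function_mono[OF assms(2) subset_UNIV]])
  obtain B where B: "B > 0" "\<And>x. \<bar>\<phi> x\<bar> \<le> B" using test_function_bounded[OF assms(2)] by metis
  have A[measurable]: "ball_average h \<phi> \<in> borel_measurable borel"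
    by (rule borel_measurable_continuous_onI[OF ball_average_continuous[OF assms]])
  have id[measurable]: "(\<lambda>z. z) \<in> ?M \<rightarrow>\<^sub>M borel" by (intro measurable_restrict_space1) simp
  have "(\<integral>\<^sup>+ x. ennreal ((\<phi> x - ball_average h \<phi> x)\<^sup>2) \<partial>lborel) \<le>
      (\<integral>\<^sup>+ x. \<integral>\<^sup>+ z. ennreal ((\<phi> (x + z) - \<phi> x)\<^sup>2 / m) \<partial>?M \<partial>lborel)"
  proof (rule nn_integral_mono)
    fix x
    have "(\<phi> x - ball_average h \<phi> x)\<^sup>2 \<le> (LINT z|?M. (\<phi> (x + z) - \<phi> x)\<^sup>2) / m"
      using ball_average_bounds(3)[OF assms, of x] m by (simp add: m_def[symmetric] field_simps)
    also have "\<dots> = (LINT z|?M. (\<phi> (x + z) - \<phi> x)\<^sup>2 / m)" by simp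
    finally have "ennreal ((\<phi> x - ball_average h \<phi> x)\<^sup>2) \<le> ennreal (LINT z|?M. (\<phi> (x + z) - \<phi> x)\<^sup>2 / m)"
      by (rule ennreal_leI)
    also have "\<dots> = (\<integral>\<^sup>+ z. ennreal ((\<phi> (x + z) - \<phi> x)\<^sup>2 / m) \<partial>?M)"
    proof (rule nn_integral_eq_integral[symmetric])
      show "integrable ?M (\<lambda>z. (\<phi> (x + z) - \<phi> x)\<^sup>2 / m)"
      proof (rule integrable_bounded_cball[where B = "(2 * B)\<^sup>2 / m"])
        fix z
        have "\<bar>\<phi> (x + z) - \<phi> x\<bar> \<le> 2 * B" using B(2)[of "x + z"] B(2)[of "x"] by linarith
        from power_mono[OF this, of 2] show "\<bar>(\<phi> (x + z) - \<phi> x)\<^sup>2 / m\<bar> \<le> (2 * B)\<^sup>2 / m"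
          using m by (simp add: divide_right_mono)
      qed measurable
    qed (use m in simp)
    finally show "ennreal ((\<phi> x - ball_average h \<phi> x)\<^sup>2) \<le> (\<integral>\<^sup>+ z. ennreal ((\<phi> (x + z) - \<phi> x)\<^sup>2 / m) \<partial>?M)" .
  qed
  also have "\<dots> = (\<integral>\<^sup>+ z. \<integral>\<^sup>+ x. ennreal ((\<phi> (x + z) - \<phi> x)\<^sup>2 / m) \<partial>lborel \<partial>?M)"
    by (rule Fubini'[symmetric]) measurable
  also have "\<dots> \<le> (\<integral>\<^sup>+ z. ennreal (h\<^sup>2 * G / m) \<partial>?M)"
  proof (rule nn_integral_mono)
    fix z assume "z \<in> space ?M"
    then have z: "norm z \<le> h" by (simp add: space_restrict_space)
    have L': "(\<lambda>x. \<phi> (x + z) - \<phi> x) \<in> L2 UNIV" by (intro L2_diff L2_translate(1) b L)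
    have m': "(\<lambda>x. \<phi> (x + z) - \<phi> x) \<in> borel_measurable borel" by measurable
    have "(\<integral>\<^sup>+ x. ennreal ((\<phi> (x + z) - \<phi> x)\<^sup>2 / m) \<partial>lborel) = ennreal (LINT x|lborel. (\<phi> (x + z) - \<phi> x)\<^sup>2 / m)"
      using L2_UNIV_borel_iff[OF m'] L' m by (intro nn_integral_eq_integral) auto
    also have "(LINT x|lborel. (\<phi> (x + z) - \<phi> x)\<^sup>2 / m) = (Lq_norm UNIV 2 (\<lambda>x. \<phi> (x + z) - \<phi> x))\<^sup>2 / m"
      using L2_norm_UNIV_sq[OF m'] by simp
    also have "ennreal \<dots> \<le> ennreal (h\<^sup>2 * G / m)"
    proof (intro ennreal_leI divide_right_mono)
      have "(Lq_norm UNIV 2 (\<lambda>x. \<phi> (x + z) - \<phi> x))\<^sup>2 \<le> (norm z)\<^sup>2 * G"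
        unfolding G_def by (rule translation_inequality[OF assms(1,2)])
      also have "\<dots> \<le> h\<^sup>2 * G" using z G by (intro mult_right_mono power_mono) auto
      finally show "(Lq_norm UNIV 2 (\<lambda>x. \<phi> (x + z) - \<phi> x))\<^sup>2 \<le> h\<^sup>2 * G" .
    qed (use m in simp)
    finally show "(\<integral>\<^sup>+ x. ennreal ((\<phi> (x + z) - \<phi> x)\<^sup>2 / m) \<partial>lborel) \<le> ennreal (h\<^sup>2 * G / m)" .
  qed
  also have "\<dots> = ennreal (h\<^sup>2 * G / m) * emeasure ?M (space ?M)" by simp
  also have "emeasure ?M (space ?M) = ennreal m"
    by (simp only: M.emeasure_eq_measure measure_cball_space m_def)
  also have "ennreal (h\<^sup>2 * G / m) * ennreal m = ennreal ((h * sqrt G)\<^sup>2)"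
    using m G by (simp add: ennreal_mult[symmetric] power_mult_distrib)
  finally have le: "(\<integral>\<^sup>+ x. ennreal ((\<phi> x - ball_average h \<phi> x)\<^sup>2) \<partial>lborel) \<le> ennreal ((h * sqrt G)\<^sup>2)" .
  have "(\<integral>\<^sup>+ x. ennreal ((\<phi> x - ball_average h \<phi> x)\<^sup>2) \<partial>lebesgue_on \<Omega>) =
      (\<integral>\<^sup>+ x. ennreal ((\<phi> x - ball_average h \<phi> x)\<^sup>2) * indicator \<Omega> x \<partial>lborel)"
    using open_in_sets_lebesgue[OF assms(1)] by (subst nn_integral_restrict_space) (auto simp: nn_integral_completion)
  also have "\<dots> \<le> (\<integral>\<^sup>+ x. ennreal ((\<phi> x - ball_average h \<phi> x)\<^sup>2) \<partial>lborel)"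
    by (intro nn_integral_mono) (auto simp: indicator_def)
  also note le
  finally have le': "(\<integral>\<^sup>+ x. ennreal ((\<phi> x - ball_average h \<phi> x)\<^sup>2) \<partial>lebesgue_on \<Omega>) \<le> ennreal ((h * sqrt G)\<^sup>2)" .
  have "(\<lambda>x. \<phi> x - ball_average h \<phi> x) \<in> borel_measurable borel" by measurable
  then have "(\<lambda>x. \<phi> x - ball_average h \<phi> x) \<in> borel_measurable (lebesgue_on \<Omega>)"
    by (intro measurable_restrict_space1 measurable_completion) simp
  from L2_nn_integralI[OF this le'] show "(\<lambda>x. \<phi> x - ball_average h \<phi> x) \<in> L2 \<Omega>"
    "(Lq_norm \<Omega> 2 (\<lambda>x. \<phi> x - ball_average h \<phi> x)) \<le> h * sqrt (grad_inner \<Omega> \<phi> \<phi>)"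
    using G assms(3) by (simp_all add: G_def)
qed


text \<open>For a fixed radius the averages are bounded and uniformly Lipschitz, so a subsequence
  converges everywhere and, by domination, in \<open>L2 \<Omega>\<close>. The error of averaging is
  at most the radius times \<open>sqrt G\<close>, uniformly in the sequence, so the functions
  themselves are Cauchy along it.\<close>

lemma test_functions_relatively_compact:
  fixes \<Omega> :: "'a::euclidean_space set" and \<phi> :: "nat \<Rightarrow> 'a \<Rightarrow> real"
  assumes \<Omega>: "open \<Omega>" "bounded \<Omega>" and \<phi>: "\<And>n. \<phi> n \<in> test_functions \<Omega>"
    and A: "\<And>n. Lq_norm \<Omega> 2 (\<phi> n) \<le> A" and G: "\<And>n. grad_inner \<Omega> (\<phi> n) (\<phi> n) \<le> G"
  shows "\<exists>r::nat \<Rightarrow> nat. strict_mono r \<and> (\<forall>e>0. \<exists>N. \<forall>m\<ge>N. \<forall>n\<ge>N. Lq_norm \<Omega> 2 (\<lambda>x. \<phi> (r m) x - \<phi> (r n) x) < e)"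
proof -
  have G0: "0 \<le> G" using G[of 0] by (rule order_trans[rotated]) (simp add: grad_inner_self sum_nonneg)
  have A0: "0 \<le> A" using A[of 0] L2_norm_nonneg order_trans by blast
  define h where "h k = 1 / real (Suc k)" for k
  have h: "h k > 0" for k by (simp add: h_def)
  define \<mu> where "\<mu> k = measure lborel (cball (0::'a) (h k))" for k
  have \<mu>: "\<mu> k > 0" for k unfolding \<mu>_def by (rule measure_cball_pos[OF h])
  obtain D :: "'a set" where D: "countable D" "\<And>X. open X \<Longrightarrow> X \<noteq> {} \<Longrightarrow> \<exists>d\<in>D. d \<in> X"
    by (rule countable_dense_setE) blast
  \<comment> \<open>The factor \<open>sqrt (\<mu> k)\<close> makes one bound \<open>A\<close> valid
    for all radii. Pairing the radius index with a dense set of points then needs a single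
    extraction, and the subsequence works for every radius at once.\<close>
  define f where "f n p = sqrt (\<mu> (fst p)) * ball_average (h (fst p)) (\<phi> n) (snd p)" for n p
  have bound: "\<bar>sqrt (\<mu> k) * ball_average (h k) (\<phi> n) x\<bar> \<le> A" for n k x
  proof (rule power2_le_imp_le)
    have "\<bar>sqrt (\<mu> k) * ball_average (h k) (\<phi> n) x\<bar>\<^sup>2 = \<mu> k * (ball_average (h k) (\<phi> n) x)\<^sup>2"
      using \<mu>[of k] by (simp add: power_mult_distrib)
    also have "\<dots> \<le> (Lq_norm \<Omega> 2 (\<phi> n))\<^sup>2"
      unfolding \<mu>_def by (rule ball_average_bounds(2)[OF \<Omega>(1) \<phi> h])
    also have "\<dots> \<le> A\<^sup>2" using A L2_norm_nonneg by (intro power_mono)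
    finally show "\<bar>sqrt (\<mu> k) * ball_average (h k) (\<phi> n) x\<bar>\<^sup>2 \<le> A\<^sup>2" .
  qed (rule A0)
  have "countable ((UNIV :: nat set) \<times> D)" using D(1) by simp
  then obtain r where r: "strict_mono (r::nat\<Rightarrow>nat)"
    and rl: "\<And>p. p \<in> UNIV \<times> D \<Longrightarrow> \<exists>l. (\<lambda>n. f (r n) p) \<longlonglongrightarrow> l"
    by (rule function_convergent_subsequence[of "UNIV \<times> D" f A]) (use bound in \<open>auto simp: f_def\<close>)
  have conv: "convergent (\<lambda>n. ball_average (h k) (\<phi> (r n)) x)" for k x
  proof -
    define C where "C = sqrt (G / \<mu> k)"
    have C0: "0 \<le> C" using G0 \<mu>[of k] by (simp add: C_def)
    have lip: "\<bar>ball_average (h k) (\<phi> n) x - ball_average (h k) (\<phi> n) y\<bar> \<le> C * norm (x - y)" for n y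
    proof (rule power2_le_imp_le)
      have "\<mu> k * (ball_average (h k) (\<phi> n) x - ball_average (h k) (\<phi> n) y)\<^sup>2 \<le> (norm (x - y))\<^sup>2 * grad_inner \<Omega> (\<phi> n) (\<phi> n)"
        unfolding \<mu>_def by (rule ball_average_bounds(1)[OF \<Omega>(1) \<phi> h])
      also have "\<dots> \<le> (norm (x - y))\<^sup>2 * G" by (intro mult_left_mono G) simp
      finally show "\<bar>ball_average (h k) (\<phi> n) x - ball_average (h k) (\<phi> n) y\<bar>\<^sup>2 \<le> (C * norm (x - y))\<^sup>2"
        using \<mu>[of k] G0 by (simp add: C_def power_mult_distrib field_simps)
    qed (use C0 in simp)
    have "Cauchy (\<lambda>n. ball_average (h k) (\<phi> (r n)) x)"
    proof (rule metric_CauchyI)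
      fix e :: real assume e: "e > 0"
      \<comment> \<open>Dividing by \<open>C + 1\<close> rather than \<open>C\<close> keeps this
        meaningful when the Lipschitz constant is 0.\<close>
      define \<delta> where "\<delta> = e / 3 / (C + 1)"
      have C1: "C + 1 \<noteq> 0" using C0 by linarith
      have \<delta>: "\<delta> > 0" using e C0 by (simp add: \<delta>_def)
      obtain y where y: "y \<in> D" "y \<in> ball x \<delta>" using D(2)[of "ball x \<delta>"] \<delta> by auto
      have Cd: "C * norm (x - y) < e / 3"
      proof -
        have "C * norm (x - y) \<le> C * \<delta>" using y(2) C0 by (intro mult_left_mono) (auto simp: dist_norm)
        also have "\<dots> < (C + 1) * \<delta>" using \<delta> by simp
        also have "\<dots> = e / 3" unfolding \<delta>_def using C1 by (simp del: divide_divide_eq_left)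
        finally show ?thesis .
      qed
      obtain l where "(\<lambda>n. f (r n) (k, y)) \<longlonglongrightarrow> l" using rl[of "(k, y)"] y(1) by auto
      then have "(\<lambda>n. inverse (sqrt (\<mu> k)) * f (r n) (k, y)) \<longlonglongrightarrow> inverse (sqrt (\<mu> k)) * l" by (intro tendsto_intros)
      moreover have "inverse (sqrt (\<mu> k)) * f n (k, y) = ball_average (h k) (\<phi> n) y" for n
        using \<mu>[of k] by (simp add: f_def)
      ultimately have "Cauchy (\<lambda>n. ball_average (h k) (\<phi> (r n)) y)"
        using LIMSEQ_imp_Cauchy by simp
      from metric_CauchyD[OF this, of "e / 3"] e
      obtain N where N: "\<And>m n. m \<ge> N \<Longrightarrow> n \<ge> N \<Longrightarrow> \<bar>ball_average (h k) (\<phi> (r m)) y - ball_average (h k) (\<phi> (r n)) y\<bar> < e / 3"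
        by (auto simp: dist_real_def)
      show "\<exists>N. \<forall>m\<ge>N. \<forall>n\<ge>N. dist (ball_average (h k) (\<phi> (r m)) x) (ball_average (h k) (\<phi> (r n)) x) < e"
      proof (intro exI[of _ N] allI impI)
        fix m n assume mn: "m \<ge> N" "n \<ge> N"
        show "dist (ball_average (h k) (\<phi> (r m)) x) (ball_average (h k) (\<phi> (r n)) x) < e"
          using N[OF mn] lip[of "r m" y] lip[of "r n" y] Cd unfolding dist_real_def by linarith
      qed
    qed
    then show ?thesis by (rule Cauchy_convergent)
  qed
  have "\<exists>N. \<forall>m\<ge>N. \<forall>n\<ge>N. Lq_norm \<Omega> 2 (\<lambda>x. \<phi> (r m) x - \<phi> (r n) x) < e" if e: "e > 0" for e
  proof -
    \<comment> \<open>The radius is fixed by \<open>e\<close> alone, before any index of the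
      sequence is chosen.\<close>
    obtain k where k: "h k * sqrt G < e / 4"
    proof -
      have "(\<lambda>k. h k * sqrt G) \<longlonglongrightarrow> 0 * sqrt G"
        unfolding h_def by (intro tendsto_mult tendsto_const LIMSEQ_Suc[OF lim_1_over_n])
      then have "\<forall>\<^sub>F k in sequentially. h k * sqrt G < e / 4" using e by (intro order_tendstoD) auto
      then show thesis using that by (auto simp: eventually_sequentially)
    qed
    let ?A = "\<lambda>n. ball_average (h k) (\<phi> (r n))"
    define g where "g x = lim (\<lambda>n. ?A n x)" for x
    have lim: "(\<lambda>n. ?A n x) \<longlonglongrightarrow> g x" for x
      using conv[of k x] by (simp add: g_def convergent_LIMSEQ_iff)
    define C where "C = A / sqrt (\<mu> k)"
    have AC: "\<bar>?A n x\<bar> \<le> C" for n x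
      using bound[of k "r n" x] \<mu>[of k] by (simp add: C_def abs_mult field_simps)
    have gC: "\<bar>g x\<bar> \<le> C" for x
      by (rule LIMSEQ_le_const2[OF tendsto_rabs[OF lim[of x]]]) (use AC in auto)
    have C0: "0 \<le> C" using AC[of 0 undefined] by linarith
    have Am: "?A n \<in> borel_measurable (lebesgue_on \<Omega>)" for n
      using borel_measurable_continuous_onI[OF ball_average_continuous[OF \<Omega>(1) \<phi> h]]
      by (intro measurable_restrict_space1 measurable_completion) simp
    have gm: "g \<in> borel_measurable (lebesgue_on \<Omega>)"
      by (rule borel_measurable_LIMSEQ_metric[OF Am lim])
    have AL: "?A n \<in> L2 \<Omega>" for n
      by (rule L2_dominated[OF const_L2[OF \<Omega>, of C] Am]) (use AC C0 in simp)
    have gL: "g \<in> L2 \<Omega>"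
      by (rule L2_dominated[OF const_L2[OF \<Omega>, of C] gm]) (use gC C0 in simp)
    have "(\<lambda>n. LINT x|lebesgue_on \<Omega>. (?A n x - g x)\<^sup>2) \<longlonglongrightarrow> (LINT x|lebesgue_on \<Omega>. 0)"
    proof (rule integral_dominated_convergence[where w = "\<lambda>x. (2 * C)\<^sup>2"])
      show "integrable (lebesgue_on \<Omega>) (\<lambda>x. (2 * C)\<^sup>2)"
        using L2_square_integrable[OF const_L2[OF \<Omega>, of "2 * C"]] .
      show "AE x in lebesgue_on \<Omega>. norm ((?A n x - g x)\<^sup>2) \<le> (2 * C)\<^sup>2" for n
      proof (rule AE_I2)
        fix x
        have "\<bar>?A n x - g x\<bar> \<le> 2 * C" using AC[of n x] gC[of x] by linarith
        from power_mono[OF this, of 2] show "norm ((?A n x - g x)\<^sup>2) \<le> (2 * C)\<^sup>2" by simp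
      qed
      show "AE x in lebesgue_on \<Omega>. (\<lambda>n. (?A n x - g x)\<^sup>2) \<longlonglongrightarrow> 0"
      proof (rule AE_I2)
        fix x
        have "(\<lambda>n. (?A n x - g x)\<^sup>2) \<longlonglongrightarrow> (g x - g x)\<^sup>2" by (intro tendsto_intros lim)
        then show "(\<lambda>n. (?A n x - g x)\<^sup>2) \<longlonglongrightarrow> 0" by simp
      qed
    qed (use Am gm in \<open>auto intro!: borel_measurable_power borel_measurable_diff\<close>)
    then have "(\<lambda>n. sqrt (LINT x|lebesgue_on \<Omega>. (?A n x - g x)\<^sup>2)) \<longlonglongrightarrow> sqrt 0"
      by (intro tendsto_real_sqrt) simp
    then have "(\<lambda>n. Lq_norm \<Omega> 2 (\<lambda>x. ?A n x - g x)) \<longlonglongrightarrow> 0"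
      by (simp add: Lq_norm_def sqrt_def)
    then have "\<forall>\<^sub>F n in sequentially. Lq_norm \<Omega> 2 (\<lambda>x. ?A n x - g x) < e / 4"
      using e by (intro order_tendstoD) auto
    then obtain N where N: "\<And>n. n \<ge> N \<Longrightarrow> Lq_norm \<Omega> 2 (\<lambda>x. ?A n x - g x) < e / 4"
      by (auto simp: eventually_sequentially)
    have err: "Lq_norm \<Omega> 2 (\<lambda>x. \<phi> n x - ball_average (h k) (\<phi> n) x) < e / 4" for n
    proof -
      have "Lq_norm \<Omega> 2 (\<lambda>x. \<phi> n x - ball_average (h k) (\<phi> n) x) \<le> h k * sqrt (grad_inner \<Omega> (\<phi> n) (\<phi> n))"
        by (rule ball_average_error(2)[OF \<Omega>(1) \<phi> h])
      also have "\<dots> \<le> h k * sqrt G" using h[of k] G by (intro mult_left_mono) auto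
      finally show ?thesis using k by linarith
    qed
    have half: "Lq_norm \<Omega> 2 (\<lambda>x. \<phi> (r n) x - g x) < e / 2" if "n \<ge> N" for n
      using L2_norm_triangle_diff[OF test_function_L2[OF \<Omega>(1) \<phi>[of "r n"]] AL[of n] gL] N[OF that] err[of "r n"] by linarith
    show ?thesis
    proof (intro exI[of _ N] allI impI)
      fix m n assume mn: "m \<ge> N" "n \<ge> N"
      show "Lq_norm \<Omega> 2 (\<lambda>x. \<phi> (r m) x - \<phi> (r n) x) < e"
        using L2_norm_triangle_diff[OF test_function_L2[OF \<Omega>(1) \<phi>[of "r m"]] gL test_function_L2[OF \<Omega>(1) \<phi>[of "r n"]]]
          half[OF mn(1)] half[OF mn(2)] L2_norm_minus_commute[of \<Omega> g "\<phi> (r n)"] by linarith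
    qed
  qed
  with r show ?thesis by (intro exI[of _ r]) simp
qed

section \<open>The principal eigenvalue\<close>

lemma L2_norm_cmult_sq:
  fixes f :: "'a::euclidean_space \<Rightarrow> real"
  shows "(Lq_norm \<Omega> 2 (\<lambda>x. c * f x))\<^sup>2 = c\<^sup>2 * (Lq_norm \<Omega> 2 f)\<^sup>2"
  by (simp add: L2_norm_cmult power_mult_distrib)

lemma grad_inner_nonneg: "0 \<le> grad_inner \<Omega> f f"
  by (simp add: grad_inner_self sum_nonneg)

lemma grad_inner_lincomb_sq:
  assumes "open \<Omega>" "f \<in> H1 \<Omega>" "g \<in> H1 \<Omega>"
  shows "grad_inner \<Omega> (\<lambda>x. c * f x + d * g x) (\<lambda>x. c * f x + d * g x) =
    c\<^sup>2 * grad_inner \<Omega> f f + 2 * c * d * grad_inner \<Omega> f g + d\<^sup>2 * grad_inner \<Omega> g g"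
proof -
  have *: "grad_inner \<Omega> h (\<lambda>x. c * f x + d * g x) = c * grad_inner \<Omega> h f + d * grad_inner \<Omega> h g" if "h \<in> H1 \<Omega>" for h
    using grad_inner_lincomb_left[OF assms that, of c d] by (simp add: grad_inner_commute)
  show ?thesis
    using H1_lincomb(1)[OF assms] assms
    by (simp add: grad_inner_lincomb_left * grad_inner_commute[of \<Omega> g f] power2_eq_square algebra_simps)
qed

lemma L2_norm_lincomb_sq:
  assumes "f \<in> L2 \<Omega>" "g \<in> L2 \<Omega>"
  shows "(Lq_norm \<Omega> 2 (\<lambda>x. c * f x + d * g x))\<^sup>2 =
    c\<^sup>2 * (Lq_norm \<Omega> 2 f)\<^sup>2 + 2 * c * d * L2_inner \<Omega> f g + d\<^sup>2 * (Lq_norm \<Omega> 2 g)\<^sup>2"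
  using L2_norm_add_sq[OF L2_cmult[OF assms(1), of c] L2_cmult[OF assms(2), of d]]
  by (simp add: L2_norm_cmult_sq L2_inner_cmult_left L2_inner_cmult_right)

lemma H10_grad_inner_tendsto:
  assumes "open \<Omega>" "f \<in> H1 \<Omega>" "\<And>n::nat. \<phi> n \<in> test_functions \<Omega>"
    "\<And>i. i \<in> Basis \<Longrightarrow> (\<lambda>n. Lq_norm \<Omega> 2 (\<lambda>x. pderiv_at (\<phi> n) i x - g i x)) \<longlonglongrightarrow> 0"
    "\<And>i. i \<in> Basis \<Longrightarrow> g i \<in> L2 \<Omega>"
    "\<And>i. i \<in> Basis \<Longrightarrow> AE x in lebesgue_on \<Omega>. weak_partial \<Omega> i f x = g i x"
  shows "(\<lambda>n. grad_inner \<Omega> (\<phi> n) (\<phi> n)) \<longlonglongrightarrow> grad_inner \<Omega> f f"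
proof -
  have "Lq_norm \<Omega> 2 (weak_partial \<Omega> i f) = Lq_norm \<Omega> 2 (g i)" if "i \<in> Basis" for i
    using assms that H1_weak_partial(2)[OF assms(1,2)] by (intro Lq_norm_cong_AE L2_measurable) auto
  then have eq: "grad_inner \<Omega> f f = (\<Sum>i\<in>Basis. (Lq_norm \<Omega> 2 (g i))\<^sup>2)" by (simp add: grad_inner_self)
  show ?thesis
    unfolding eq test_function_grad_inner(1)[OF assms(1,3)]
    using assms test_function_L2[OF assms(1) test_function_partial[OF assms(3)]]
    by (intro tendsto_sum tendsto_power L2_tendsto_norm) auto
qed

text \<open>The direct method: the infimum \<mu> of the Rayleigh quotient is attained, a minimiser
  is an eigenfunction for \<mu>, and no eigenvalue lies below \<mu>. Hence the \<open>LEAST\<close>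
  in the definition is attained and equals \<mu>, whose inequality is Poincare's. The function
  \<open>w\<close> rules out the trivial space.\<close>

lemma principal_eigenvalue_Poincare:
  fixes \<Omega> :: "'a::euclidean_space set"
  assumes \<Omega>: "open \<Omega>" "bounded \<Omega>" and w: "w \<in> H10 \<Omega>" "\<not> zero_on \<Omega> w"
  shows "0 < principal_eigenvalue \<Omega>"
    and "v \<in> H10 \<Omega> \<Longrightarrow> principal_eigenvalue \<Omega> * (Lq_norm \<Omega> 2 v)\<^sup>2 \<le> grad_inner \<Omega> v v"
proof -
  note tL = test_function_L2[OF \<Omega>(1)] and tH = test_function_H1(1)[OF \<Omega>(1)]
  define S where "S = {grad_inner \<Omega> \<phi> \<phi> | \<phi>. \<phi> \<in> test_functions \<Omega> \<and> Lq_norm \<Omega> 2 \<phi> = 1}"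
  define \<mu> where "\<mu> = Inf S"
  have bdd: "bdd_below S" by (rule bdd_belowI[of _ 0]) (auto simp: S_def grad_inner_nonneg)
  have normalise: "grad_inner \<Omega> \<phi> \<phi> / (Lq_norm \<Omega> 2 \<phi>)\<^sup>2 \<in> S"
    if \<phi>: "\<phi> \<in> test_functions \<Omega>" "Lq_norm \<Omega> 2 \<phi> \<noteq> 0" for \<phi>
  proof -
    let ?c = "1 / Lq_norm \<Omega> 2 \<phi>"
    have t: "(\<lambda>x. ?c * \<phi> x + 0 * \<phi> x) \<in> test_functions \<Omega>" by (rule test_function_lincomb[OF \<phi>(1) \<phi>(1)])
    have "grad_inner \<Omega> (\<lambda>x. ?c * \<phi> x + 0 * \<phi> x) (\<lambda>x. ?c * \<phi> x + 0 * \<phi> x) = grad_inner \<Omega> \<phi> \<phi> / (Lq_norm \<Omega> 2 \<phi>)\<^sup>2"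
      using grad_inner_lincomb_sq[OF \<Omega>(1) tH[OF \<phi>(1)] tH[OF \<phi>(1)], of ?c 0] by (simp add: power_divide)
    moreover have "Lq_norm \<Omega> 2 (\<lambda>x. ?c * \<phi> x + 0 * \<phi> x) = 1"
      using L2_norm_cmult[of \<Omega> ?c \<phi>] \<phi>(2) L2_norm_nonneg[of \<Omega> \<phi>] by simp
    ultimately show ?thesis using t unfolding S_def by (metis (mono_tags, lifting) mem_Collect_eq)
  qed
  have poinc_test: "\<mu> * (Lq_norm \<Omega> 2 \<phi>)\<^sup>2 \<le> grad_inner \<Omega> \<phi> \<phi>" if \<phi>: "\<phi> \<in> test_functions \<Omega>" for \<phi>
  proof (cases "Lq_norm \<Omega> 2 \<phi> = 0")
    case True
    then show ?thesis by (simp add: grad_inner_nonneg)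
  next
    case False
    then have "\<mu> \<le> grad_inner \<Omega> \<phi> \<phi> / (Lq_norm \<Omega> 2 \<phi>)\<^sup>2"
      unfolding \<mu>_def by (intro cInf_lower bdd normalise \<phi>)
    with False show ?thesis by (simp add: pos_le_divide_eq)
  qed
  have poinc: "\<mu> * (Lq_norm \<Omega> 2 v)\<^sup>2 \<le> grad_inner \<Omega> v v" if v: "v \<in> H10 \<Omega>" for v
  proof -
    obtain \<phi> where \<phi>: "\<And>n::nat. \<phi> n \<in> test_functions \<Omega>" "(\<lambda>n. Lq_norm \<Omega> 2 (\<lambda>x. \<phi> n x - v x)) \<longlonglongrightarrow> 0"
      "\<And>i. i \<in> Basis \<Longrightarrow> (\<lambda>n. Lq_norm \<Omega> 2 (\<lambda>x. pderiv_at (\<phi> n) i x - weak_partial \<Omega> i v x)) \<longlonglongrightarrow> 0"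
      using H10_approx[OF \<Omega>(1) v] by blast
    note vH = H10_subset_H1[OF v]
    show ?thesis
    proof (rule LIMSEQ_le)
      show "(\<lambda>n. \<mu> * (Lq_norm \<Omega> 2 (\<phi> n))\<^sup>2) \<longlonglongrightarrow> \<mu> * (Lq_norm \<Omega> 2 v)\<^sup>2"
        using tL[OF \<phi>(1)] H1_subset_L2[OF vH] by (intro tendsto_intros L2_tendsto_norm[OF \<phi>(2)]) auto
      show "(\<lambda>n. grad_inner \<Omega> (\<phi> n) (\<phi> n)) \<longlonglongrightarrow> grad_inner \<Omega> v v"
        by (rule H10_grad_inner_tendsto[OF \<Omega>(1) vH \<phi>(1,3) H1_weak_partial(2)[OF \<Omega>(1) vH]]) auto
      show "\<exists>N. \<forall>n\<ge>N. \<mu> * (Lq_norm \<Omega> 2 (\<phi> n))\<^sup>2 \<le> grad_inner \<Omega> (\<phi> n) (\<phi> n)"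
        using poinc_test[OF \<phi>(1)] by blast
    qed
  qed
  \<comment> \<open>Approximants of the nonzero \<open>w\<close> eventually have positive norm and
    can be normalised; without this the infimum would be meaningless.\<close>
  have "S \<noteq> {}"
  proof -
    obtain \<phi> where \<phi>: "\<And>n::nat. \<phi> n \<in> test_functions \<Omega>" "(\<lambda>n. Lq_norm \<Omega> 2 (\<lambda>x. \<phi> n x - w x)) \<longlonglongrightarrow> 0"
      using H10_approx[OF \<Omega>(1) w(1)] by blast
    have wL: "w \<in> L2 \<Omega>" using w(1) H10_subset_H1 H1_subset_L2 by blast
    have "(\<lambda>n. Lq_norm \<Omega> 2 (\<phi> n)) \<longlonglongrightarrow> Lq_norm \<Omega> 2 w"
      using tL[OF \<phi>(1)] wL by (intro L2_tendsto_norm[OF \<phi>(2)]) auto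
    moreover have "Lq_norm \<Omega> 2 w > 0"
      using L2_norm_zero_iff[OF wL] w(2) L2_norm_nonneg[of \<Omega> w] by linarith
    ultimately have "\<forall>\<^sub>F n in sequentially. Lq_norm \<Omega> 2 (\<phi> n) > 0" by (rule order_tendstoD(1))
    then obtain n where "Lq_norm \<Omega> 2 (\<phi> n) > 0" by (auto simp: eventually_sequentially)
    then show ?thesis using normalise[OF \<phi>(1)[of n]] by auto
  qed
  note Sne = this
  have "\<exists>\<phi>. \<phi> \<in> test_functions \<Omega> \<and> Lq_norm \<Omega> 2 \<phi> = 1 \<and> grad_inner \<Omega> \<phi> \<phi> < \<mu> + 1 / real (Suc n)" for n
  proof -
    have "Inf S < \<mu> + 1 / real (Suc n)" by (simp add: \<mu>_def)
    then obtain s where "s \<in> S" "s < \<mu> + 1 / real (Suc n)" using cInf_lessD[OF Sne] by blast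
    then show ?thesis unfolding S_def by blast
  qed
  then obtain \<phi> where \<phi>: "\<And>n. \<phi> n \<in> test_functions \<Omega>" "\<And>n. Lq_norm \<Omega> 2 (\<phi> n) = 1"
    "\<And>n. grad_inner \<Omega> (\<phi> n) (\<phi> n) < \<mu> + 1 / real (Suc n)" by metis
  have g1: "grad_inner \<Omega> (\<phi> n) (\<phi> n) \<le> \<mu> + 1" for n
    using \<phi>(3)[of n] by (rule order_trans[OF less_imp_le]) simp
  from test_functions_relatively_compact[where \<phi> = \<phi>, OF \<Omega> \<phi>(1) eq_refl[OF \<phi>(2)] g1]
  obtain r :: "nat \<Rightarrow> nat" where r: "strict_mono r"
    and rc': "\<forall>e>0. \<exists>N. \<forall>m\<ge>N. \<forall>n\<ge>N. Lq_norm \<Omega> 2 (\<lambda>x. \<phi> (r m) x - \<phi> (r n) x) < e"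
    by (elim exE conjE)
  have rc: "\<exists>N. \<forall>m\<ge>N. \<forall>n\<ge>N. Lq_norm \<Omega> 2 (\<lambda>x. \<phi> (r m) x - \<phi> (r n) x) < e" if "e > 0" for e
    using rc' that by simp
  define \<psi> where "\<psi> n = \<phi> (r n)" for n
  have \<psi>: "\<And>n. \<psi> n \<in> test_functions \<Omega>" "\<And>n. Lq_norm \<Omega> 2 (\<psi> n) = 1" using \<phi> by (simp_all add: \<psi>_def)
  have \<psi>g: "grad_inner \<Omega> (\<psi> n) (\<psi> n) < \<mu> + 1 / real (Suc n)" for n
  proof -
    have "1 / real (Suc (r n)) \<le> 1 / real (Suc n)"
      using seq_suble[OF r, of n] by (intro divide_left_mono) auto
    then show ?thesis using \<phi>(3)[of "r n"] by (simp add: \<psi>_def)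
  qed
  have \<psi>g0: "\<mu> \<le> grad_inner \<Omega> (\<psi> n) (\<psi> n)" for n using poinc_test[OF \<psi>(1)[of n]] \<psi>(2) by simp
  have \<mu>0: "0 \<le> \<mu>" unfolding \<mu>_def by (rule cInf_greatest[OF Sne]) (auto simp: S_def grad_inner_nonneg)
  note tp = test_function_partial[OF \<psi>(1)]
  \<comment> \<open>parallelogram law: a minimising sequence that is Cauchy in \<open>L\<^sup>2\<close> is Cauchy in \<open>H\<^sup>1\<close>\<close>
  have gradC: "(Lq_norm \<Omega> 2 (\<lambda>x. pderiv_at (\<psi> m) i x - pderiv_at (\<psi> n) i x))\<^sup>2 \<le>
      2 * (1 / real (Suc m)) + 2 * (1 / real (Suc n)) + \<mu> * (Lq_norm \<Omega> 2 (\<lambda>x. \<psi> m x - \<psi> n x))\<^sup>2" if i: "i \<in> Basis" for i m n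
  proof -
    let ?d = "\<lambda>x. 1 * \<psi> m x + (-1) * \<psi> n x" and ?s = "\<lambda>x. 1 * \<psi> m x + 1 * \<psi> n x"
    have td: "?d \<in> test_functions \<Omega>" "?s \<in> test_functions \<Omega>" by (rule test_function_lincomb[OF \<psi>(1) \<psi>(1)])+
    have "(Lq_norm \<Omega> 2 (\<lambda>x. pderiv_at (\<psi> m) i x - pderiv_at (\<psi> n) i x))\<^sup>2 = (Lq_norm \<Omega> 2 (pderiv_at ?d i))\<^sup>2"
      unfolding pderiv_lincomb[OF \<psi>(1) \<psi>(1)] by simp
    also have "\<dots> \<le> grad_inner \<Omega> ?d ?d"
      unfolding test_function_grad_inner(1)[OF \<Omega>(1) td(1)] using i by (intro member_le_sum) auto
    also have "\<dots> = 2 * grad_inner \<Omega> (\<psi> m) (\<psi> m) + 2 * grad_inner \<Omega> (\<psi> n) (\<psi> n) - grad_inner \<Omega> ?s ?s"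
      by (simp only: grad_inner_lincomb_sq[OF \<Omega>(1) tH[OF \<psi>(1)] tH[OF \<psi>(1)]]) simp
    also have "\<dots> \<le> 2 * (\<mu> + 1 / real (Suc m)) + 2 * (\<mu> + 1 / real (Suc n)) - \<mu> * (Lq_norm \<Omega> 2 ?s)\<^sup>2"
      by (intro diff_mono add_mono mult_left_mono less_imp_le[OF \<psi>g] poinc_test[OF td(2)]) auto
    \<comment> \<open>With unit norms the sum and the difference have squared norms adding up to 4,
      so the terms \<open>4 \<mu>\<close> cancel and only small quantities remain.\<close>
    also have "(Lq_norm \<Omega> 2 ?s)\<^sup>2 = 4 - (Lq_norm \<Omega> 2 ?d)\<^sup>2"
      by (simp only: L2_norm_lincomb_sq[OF tL[OF \<psi>(1)] tL[OF \<psi>(1)]]) (simp add: \<psi>(2))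
    finally show ?thesis by (simp add: algebra_simps)
  qed
  have "\<exists>g\<in>L2 \<Omega>. (\<lambda>n. Lq_norm \<Omega> 2 (\<lambda>x. pderiv_at (\<psi> n) i x - g x)) \<longlonglongrightarrow> 0" if i: "i \<in> Basis" for i
  proof (rule L2_complete[OF \<Omega> tL[OF tp[OF i]]])
    fix e :: real assume e: "e > 0"
    \<comment> \<open>Makes \<open>\<mu> d^2\<close> at most \<open>e^2 / 4\<close>, using
      \<open>\<mu> + 1\<close> because positivity of \<mu> is not known yet. Each of the three terms
      in \<open>gradC\<close> then stays within \<open>e^2 / 4\<close>.\<close>
    define d where "d = e / 2 / sqrt (\<mu> + 1)"
    have d: "d > 0" using e \<mu>0 by (simp add: d_def)
    have md: "\<mu> * d\<^sup>2 \<le> e\<^sup>2 / 4"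
    proof -
      have "\<mu> * d\<^sup>2 \<le> (\<mu> + 1) * d\<^sup>2" by (intro mult_right_mono) auto
      also have "\<dots> = (\<mu> + 1) * (e\<^sup>2 / 4 / (\<mu> + 1))" using \<mu>0 by (simp add: d_def power_divide)
      also have "\<dots> = e\<^sup>2 / 4"
        using \<mu>0 by (simp del: divide_divide_eq_left)
      finally show ?thesis .
    qed
    obtain N1 where N1: "\<And>m n. m \<ge> N1 \<Longrightarrow> n \<ge> N1 \<Longrightarrow> Lq_norm \<Omega> 2 (\<lambda>x. \<psi> m x - \<psi> n x) < d"
      using rc[OF d] unfolding \<psi>_def by blast
    obtain N2 where N2: "1 / real (Suc N2) < e\<^sup>2 / 8"
      using nat_approx_posE[of "e\<^sup>2 / 8"] e by (metis zero_less_divide_iff zero_less_numeral zero_less_power)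
    show "\<exists>N. \<forall>m\<ge>N. \<forall>n\<ge>N. Lq_norm \<Omega> 2 (\<lambda>x. pderiv_at (\<psi> m) i x - pderiv_at (\<psi> n) i x) < e"
    proof (intro exI[of _ "max N1 N2"] allI impI)
      fix m n assume mn: "m \<ge> max N1 N2" "n \<ge> max N1 N2"
      have "1 / real (Suc m) \<le> 1 / real (Suc N2)" "1 / real (Suc n) \<le> 1 / real (Suc N2)"
        using mn by (auto intro!: divide_left_mono)
      then have small: "1 / real (Suc m) < e\<^sup>2 / 8" "1 / real (Suc n) < e\<^sup>2 / 8" using N2 by linarith+
      have "(Lq_norm \<Omega> 2 (\<lambda>x. \<psi> m x - \<psi> n x))\<^sup>2 \<le> d\<^sup>2"
        using N1[of m n] mn L2_norm_nonneg by (intro power_mono) (auto intro: less_imp_le)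
      then have "\<mu> * (Lq_norm \<Omega> 2 (\<lambda>x. \<psi> m x - \<psi> n x))\<^sup>2 \<le> e\<^sup>2 / 4"
        using md mult_left_mono[OF _ \<mu>0] by (meson order_trans)
      then have "(Lq_norm \<Omega> 2 (\<lambda>x. pderiv_at (\<psi> m) i x - pderiv_at (\<psi> n) i x))\<^sup>2 < e\<^sup>2"
        using gradC[OF i, of m n] small zero_less_power[OF e, of 2] by linarith
      then show "Lq_norm \<Omega> 2 (\<lambda>x. pderiv_at (\<psi> m) i x - pderiv_at (\<psi> n) i x) < e"
        by (rule power2_less_imp_less) (use e in simp)
    qed
  qed
  then have "\<forall>i\<in>Basis. \<exists>g. g \<in> L2 \<Omega> \<and> (\<lambda>n. Lq_norm \<Omega> 2 (\<lambda>x. pderiv_at (\<psi> n) i x - g x)) \<longlonglongrightarrow> 0"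
    by (auto simp: Bex_def)
  from bchoice[OF this] obtain g where g':
    "\<forall>i\<in>Basis. g i \<in> L2 \<Omega> \<and> (\<lambda>n. Lq_norm \<Omega> 2 (\<lambda>x. pderiv_at (\<psi> n) i x - g i x)) \<longlonglongrightarrow> 0"
    by (elim exE)
  have g: "\<And>i. i \<in> Basis \<Longrightarrow> g i \<in> L2 \<Omega>"
    "\<And>i. i \<in> Basis \<Longrightarrow> (\<lambda>n. Lq_norm \<Omega> 2 (\<lambda>x. pderiv_at (\<psi> n) i x - g i x)) \<longlonglongrightarrow> 0"
    using g' by auto
  have "\<exists>f\<in>L2 \<Omega>. (\<lambda>n. Lq_norm \<Omega> 2 (\<lambda>x. \<psi> n x - f x)) \<longlonglongrightarrow> 0"
    by (rule L2_complete[OF \<Omega> tL[OF \<psi>(1)]]) (use rc in \<open>simp add: \<psi>_def\<close>)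
  then obtain f where f: "f \<in> L2 \<Omega>" "(\<lambda>n. Lq_norm \<Omega> 2 (\<lambda>x. \<psi> n x - f x)) \<longlonglongrightarrow> 0"
    by (elim bexE)
  have f0: "f \<in> H10 \<Omega>" by (rule H10_I(1)[OF \<Omega>(1) f(1) g(1) \<psi>(1) f(2) g(2)])
  have fg: "AE x in lebesgue_on \<Omega>. weak_partial \<Omega> i f x = g i x" if "i \<in> Basis" for i
    by (rule H10_I(2)[OF \<Omega>(1) f(1) g(1) \<psi>(1) f(2) g(2) that])
  have fn: "Lq_norm \<Omega> 2 f = 1"
  proof (rule LIMSEQ_unique)
    show "(\<lambda>n. Lq_norm \<Omega> 2 (\<psi> n)) \<longlonglongrightarrow> Lq_norm \<Omega> 2 f"
      using tL[OF \<psi>(1)] f by (intro L2_tendsto_norm) auto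
  qed (simp add: \<psi>(2))
  have lim: "(\<lambda>n. grad_inner \<Omega> (\<psi> n) (\<psi> n)) \<longlonglongrightarrow> grad_inner \<Omega> f f"
    by (rule H10_grad_inner_tendsto[OF \<Omega>(1) H10_subset_H1[OF f0] \<psi>(1) g(2) g(1) fg])
  have fG: "grad_inner \<Omega> f f = \<mu>"
  proof (rule LIMSEQ_unique[OF lim])
    have "(\<lambda>n. \<mu> + 1 / real (Suc n)) \<longlonglongrightarrow> \<mu> + 0"
      by (intro tendsto_intros LIMSEQ_Suc[OF lim_1_over_n])
    then have up: "(\<lambda>n. \<mu> + 1 / real (Suc n)) \<longlonglongrightarrow> \<mu>" by (simp only: add_0_right)
    show "(\<lambda>n. grad_inner \<Omega> (\<psi> n) (\<psi> n)) \<longlonglongrightarrow> \<mu>"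
    proof (rule tendsto_sandwich[OF _ _ tendsto_const up])
      show "\<forall>\<^sub>F n in sequentially. \<mu> \<le> grad_inner \<Omega> (\<psi> n) (\<psi> n)"
        by (intro always_eventually allI \<psi>g0)
      show "\<forall>\<^sub>F n in sequentially. grad_inner \<Omega> (\<psi> n) (\<psi> n) \<le> \<mu> + 1 / real (Suc n)"
        by (intro always_eventually allI less_imp_le[OF \<psi>g])
    qed
  qed
  \<comment> \<open>The crude Poincare constant bounds the Rayleigh quotients of the minimising
    sequence away from 0.\<close>
  have \<mu>pos: "0 < \<mu>"
  proof -
    obtain c where c: "c > 0" "\<And>\<phi>. \<phi> \<in> test_functions \<Omega> \<Longrightarrow> c * (Lq_norm \<Omega> 2 \<phi>)\<^sup>2 \<le> grad_inner \<Omega> \<phi> \<phi>"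
      using test_function_Poincare[OF \<Omega>] by blast
    have "c \<le> grad_inner \<Omega> f f"
      by (rule LIMSEQ_le_const[OF lim]) (use c(2)[OF \<psi>(1)] \<psi>(2) in auto)
    with c(1) fG show ?thesis by simp
  qed
  have eig: "grad_inner \<Omega> f v = \<mu> * L2_inner \<Omega> f v" if v: "v \<in> H10 \<Omega>" for v
  proof -
    note H = H10_subset_H1[OF f0] H10_subset_H1[OF v]
    \<comment> \<open>First variation: along \<open>f + t v\<close> the nonnegative deficit in
      Poincare's inequality is a quadratic in \<open>t\<close> with value 0 at \<open>t = 0\<close>,
      so its linear coefficient vanishes.\<close>
    have "(grad_inner \<Omega> f v - \<mu> * L2_inner \<Omega> f v)\<^sup>2 \<le> 0 * (grad_inner \<Omega> v v - \<mu> * (Lq_norm \<Omega> 2 v)\<^sup>2)"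
    proof (rule quadratic_nonneg_discriminant)
      fix t
      have "0 \<le> grad_inner \<Omega> (\<lambda>x. 1 * f x + t * v x) (\<lambda>x. 1 * f x + t * v x) - \<mu> * (Lq_norm \<Omega> 2 (\<lambda>x. 1 * f x + t * v x))\<^sup>2"
        using poinc[OF H10_lincomb[OF \<Omega>(1) f0 v, of 1 t]] by simp
      then show "0 \<le> 0 + 2 * t * (grad_inner \<Omega> f v - \<mu> * L2_inner \<Omega> f v) + t\<^sup>2 * (grad_inner \<Omega> v v - \<mu> * (Lq_norm \<Omega> 2 v)\<^sup>2)"
        unfolding grad_inner_lincomb_sq[OF \<Omega>(1) H] L2_norm_lincomb_sq[OF H1_subset_L2[OF H(1)] H1_subset_L2[OF H(2)]]
        using fG fn by (simp add: algebra_simps)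
    qed
    then show ?thesis by simp
  qed
  have "principal_eigenvalue \<Omega> = \<mu>"
    unfolding principal_eigenvalue_def
  proof (rule Least_equality)
    have "\<not> zero_on \<Omega> f" using L2_norm_zero_iff[OF f(1)] fn by simp
    then show "dirichlet_eigenvalue \<Omega> \<mu>"
      unfolding dirichlet_eigenvalue_def
      using f0 eig grad_inner_eq[OF \<Omega>(1) H10_subset_H1[OF f0] H10_subset_H1]
      by (intro bexI[of _ f]) (auto simp: L2_inner_def)
    \<comment> \<open>Tested against itself, an eigenfunction has Rayleigh quotient \<nu>, which
      \<open>poinc\<close> bounds from below.\<close>
    fix \<nu> assume "dirichlet_eigenvalue \<Omega> \<nu>"
    then obtain p where p: "p \<in> H10 \<Omega>" "\<not> zero_on \<Omega> p"
      "grad_inner \<Omega> p p = \<nu> * (Lq_norm \<Omega> 2 p)\<^sup>2"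
      unfolding dirichlet_eigenvalue_def L2_norm_sq L2_inner_def
      using grad_inner_eq[OF \<Omega>(1) H10_subset_H1 H10_subset_H1] by metis
    have "Lq_norm \<Omega> 2 p \<noteq> 0" using L2_norm_zero_iff[OF H1_subset_L2[OF H10_subset_H1[OF p(1)]]] p(2) by simp
    with poinc[OF p(1)] p(3) show "\<mu> \<le> \<nu>" by simp
  qed
  with \<mu>pos poinc show "0 < principal_eigenvalue \<Omega>"
    "v \<in> H10 \<Omega> \<Longrightarrow> principal_eigenvalue \<Omega> * (Lq_norm \<Omega> 2 v)\<^sup>2 \<le> grad_inner \<Omega> v v" by simp_all
qed

section \<open>Curves in L2\<close>

abbreviation L2_deriv :: "'a::euclidean_space set \<Rightarrow> ereal \<Rightarrow> (real \<Rightarrow> 'a \<Rightarrow> real) \<Rightarrow> (real \<Rightarrow> 'a \<Rightarrow> real) \<Rightarrow> bool" where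
  "L2_deriv \<Omega> \<equiv> has_time_deriv (L2 \<Omega>) (Lq_norm \<Omega> 2)"

lemma time_intervalD: "t \<in> time_interval T \<Longrightarrow> 0 \<le> t" "t \<in> time_interval T \<Longrightarrow> ereal t < T"
  by (auto simp: time_interval_def)

lemma time_interval_convex: "convex (time_interval T)"
  unfolding is_interval_convex_1[symmetric] is_interval_1
  by (auto simp: time_interval_def intro: le_less_trans[of "ereal _" "ereal _" T])

lemma time_interval_nontrivial:
  assumes "t \<in> time_interval T"
  shows "at t within time_interval T \<noteq> bot"
proof -
  obtain t' where t': "ereal t < ereal t'" "ereal t' < T"
    using time_intervalD(2)[OF assms] ereal_dense2 by blast
  have "t islimpt {t<..<t'}" using t'(1) by (simp add: islimpt_greaterThanLessThan1)
  moreover have "{t<..<t'} \<subseteq> time_interval T"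
    using t'(2) time_intervalD(1)[OF assms] by (auto simp: time_interval_def intro: less_trans[of "ereal _" "ereal t'" T])
  ultimately show ?thesis using islimpt_subset by (auto simp: trivial_limit_within)
qed

lemma eventually_time_interval: "\<forall>\<^sub>F s in at t within time_interval T. s \<in> time_interval T \<and> s \<noteq> t"
  by (simp add: eventually_at_filter)

lemma difference_quotient_L2:
  assumes "f s \<in> L2 \<Omega>" "f t \<in> L2 \<Omega>"
  shows "(\<lambda>x. (f s x - f t x) / (s - t)) \<in> L2 \<Omega>"
  using L2_cmult[OF L2_diff[OF assms], of "1 / (s - t)"] by simp

text \<open>Solutions come with several time derivatives, each asserted to exist in its own space;
  this identifies them. Limits at \<open>t\<close> are unique because the time interval accumulates
  at each of its points.\<close>

lemma L2_deriv_unique: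
  assumes "L2_deriv \<Omega> T f f'" "L2_deriv \<Omega> T g g'"
    and eq: "\<And>s. s \<in> time_interval T \<Longrightarrow> AE x in lebesgue_on \<Omega>. f s x = g s x" and t: "t \<in> time_interval T"
  shows "AE x in lebesgue_on \<Omega>. f' t x = g' t x"
proof -
  have L: "f s \<in> L2 \<Omega>" "f' s \<in> L2 \<Omega>" "g s \<in> L2 \<Omega>" "g' s \<in> L2 \<Omega>" if "s \<in> time_interval T" for s
    using assms(1,2) that by (auto simp: has_time_deriv_def)
  let ?N = "Lq_norm \<Omega> 2" and ?df = "\<lambda>s x. (f s x - f t x) / (s - t)" and ?dg = "\<lambda>s x. (g s x - g t x) / (s - t)"
  have "((\<lambda>s. ?N (\<lambda>x. ?df s x - f' t x) + ?N (\<lambda>x. ?dg s x - g' t x)) \<longlongrightarrow> 0 + 0) (at t within time_interval T)"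
    using assms(1,2) t by (intro tendsto_add) (auto simp: has_time_deriv_def)
  then have "?N (\<lambda>x. f' t x - g' t x) \<le> 0 + 0"
  proof (rule tendsto_lowerbound[OF _ _ time_interval_nontrivial[OF t]])
    show "\<forall>\<^sub>F s in at t within time_interval T. ?N (\<lambda>x. f' t x - g' t x) \<le> ?N (\<lambda>x. ?df s x - f' t x) + ?N (\<lambda>x. ?dg s x - g' t x)"
      using eventually_time_interval
    proof eventually_elim
      case (elim s)
      then have s: "s \<in> time_interval T" by simp
      note D = difference_quotient_L2[OF L(1)[OF s] L(1)[OF t]] difference_quotient_L2[OF L(3)[OF s] L(3)[OF t]]
      have "?N (\<lambda>x. f' t x - g' t x) \<le> ?N (\<lambda>x. f' t x - ?df s x) + ?N (\<lambda>x. ?df s x - g' t x)"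
        by (rule L2_norm_triangle_diff[OF L(2)[OF t] D(1) L(4)[OF t]])
      also have "?N (\<lambda>x. ?df s x - g' t x) = ?N (\<lambda>x. ?dg s x - g' t x)"
      proof (rule Lq_norm_cong_AE)
        show "AE x in lebesgue_on \<Omega>. ?df s x - g' t x = ?dg s x - g' t x"
          using eq[OF s] eq[OF t] by eventually_elim simp
      qed (use D L(4)[OF t] in \<open>intro L2_measurable L2_diff; simp\<close>)+
      finally show ?case by (simp add: L2_norm_minus_commute[of \<Omega> "f' t"])
    qed
  qed
  then have "?N (\<lambda>x. f' t x - g' t x) = 0" using L2_norm_nonneg[of \<Omega> "\<lambda>x. f' t x - g' t x"] by linarith
  then show ?thesis by (rule L2_zero_diff_imp_AE_eq[OF L(2)[OF t] L(4)[OF t]])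
qed

lemma L2_deriv_continuous:
  assumes "L2_deriv \<Omega> T f f'" "t \<in> time_interval T"
  shows "((\<lambda>s. Lq_norm \<Omega> 2 (\<lambda>x. f s x - f t x)) \<longlongrightarrow> 0) (at t within time_interval T)"
proof -
  have L: "f s \<in> L2 \<Omega>" "f' s \<in> L2 \<Omega>" if "s \<in> time_interval T" for s
    using assms(1) that by (auto simp: has_time_deriv_def)
  have lim: "((\<lambda>s. Lq_norm \<Omega> 2 (\<lambda>x. (f s x - f t x) / (s - t) - f' t x)) \<longlongrightarrow> 0) (at t within time_interval T)"
    using assms by (simp add: has_time_deriv_def)
  have "((\<lambda>s. Lq_norm \<Omega> 2 (\<lambda>x. (f s x - f t x) / (s - t))) \<longlongrightarrow> Lq_norm \<Omega> 2 (f' t)) (at t within time_interval T)"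
  proof (rule L2_tendsto_norm[OF lim])
    show "\<forall>\<^sub>F s in at t within time_interval T. (\<lambda>x. (f s x - f t x) / (s - t)) \<in> L2 \<Omega>"
      using eventually_time_interval by eventually_elim (intro difference_quotient_L2 L assms(2); simp)
  qed (rule L(2)[OF assms(2)])
  moreover have "((\<lambda>s. \<bar>s - t\<bar>) \<longlongrightarrow> \<bar>t - t\<bar>) (at t within time_interval T)" by (intro tendsto_intros)
  ultimately have "((\<lambda>s. \<bar>s - t\<bar> * Lq_norm \<Omega> 2 (\<lambda>x. (f s x - f t x) / (s - t))) \<longlongrightarrow> \<bar>t - t\<bar> * Lq_norm \<Omega> 2 (f' t)) (at t within time_interval T)"
    by (intro tendsto_mult)
  moreover have "\<forall>\<^sub>F s in at t within time_interval T. \<bar>s - t\<bar> * Lq_norm \<Omega> 2 (\<lambda>x. (f s x - f t x) / (s - t)) = Lq_norm \<Omega> 2 (\<lambda>x. f s x - f t x)"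
    using eventually_time_interval
    by eventually_elim (simp add: L2_norm_cmult[symmetric])
  ultimately show ?thesis by (simp add: Lim_transform_eventually)
qed

text \<open>The product rule: the quotient is split with \<open>g\<close> at the moving time and
  \<open>f\<close> at the fixed one, so continuity of \<open>g\<close> is needed too.\<close>

lemma L2_inner_deriv:
  assumes f: "L2_deriv \<Omega> T f f'" and g: "L2_deriv \<Omega> T g g'" and t: "t \<in> time_interval T"
  shows "((\<lambda>t. L2_inner \<Omega> (f t) (g t)) has_real_derivative L2_inner \<Omega> (f' t) (g t) + L2_inner \<Omega> (f t) (g' t))
    (at t within time_interval T)"
  unfolding has_field_derivative_iff
proof (rule Lim_transform_eventually)
  have L: "f s \<in> L2 \<Omega>" "f' s \<in> L2 \<Omega>" "g s \<in> L2 \<Omega>" "g' s \<in> L2 \<Omega>" if "s \<in> time_interval T" for s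
    using assms(1,2) that by (auto simp: has_time_deriv_def)
  let ?df = "\<lambda>s x. (f s x - f t x) / (s - t)" and ?dg = "\<lambda>s x. (g s x - g t x) / (s - t)"
  have lim: "((\<lambda>s. Lq_norm \<Omega> 2 (\<lambda>x. ?df s x - f' t x)) \<longlongrightarrow> 0) (at t within time_interval T)"
    "((\<lambda>s. Lq_norm \<Omega> 2 (\<lambda>x. ?dg s x - g' t x)) \<longlongrightarrow> 0) (at t within time_interval T)"
    using f g t by (auto simp: has_time_deriv_def)
  have ev: "\<forall>\<^sub>F s in at t within time_interval T. ?df s \<in> L2 \<Omega>" "\<forall>\<^sub>F s in at t within time_interval T. ?dg s \<in> L2 \<Omega>"
    "\<forall>\<^sub>F s in at t within time_interval T. g s \<in> L2 \<Omega>"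
    by (rule eventually_mono[OF eventually_time_interval], (rule difference_quotient_L2)?; use L t in simp)+
  have z: "((\<lambda>s. Lq_norm \<Omega> 2 (\<lambda>x. f t x - f t x)) \<longlongrightarrow> 0) (at t within time_interval T)" by (simp add: Lq_norm_def)
  show "((\<lambda>s. L2_inner \<Omega> (?df s) (g s) + L2_inner \<Omega> (f t) (?dg s)) \<longlongrightarrow> L2_inner \<Omega> (f' t) (g t) + L2_inner \<Omega> (f t) (g' t))
      (at t within time_interval T)"
    by (intro tendsto_add L2_tendsto_inner[OF lim(1) L2_deriv_continuous[OF g t]] L2_tendsto_inner[OF z lim(2)])
      (use ev L[OF t] in simp_all)
  show "\<forall>\<^sub>F s in at t within time_interval T. L2_inner \<Omega> (?df s) (g s) + L2_inner \<Omega> (f t) (?dg s) =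
      (L2_inner \<Omega> (f s) (g s) - L2_inner \<Omega> (f t) (g t)) / (s - t)"
    using eventually_time_interval
  proof eventually_elim
    case (elim s)
    then have s: "s \<in> time_interval T" and "s - t \<noteq> 0" by auto
    have "L2_inner \<Omega> (?df s) (g s) = L2_inner \<Omega> (\<lambda>x. f s x - f t x) (g s) / (s - t)"
      using L2_inner_cmult_left[of \<Omega> "1 / (s - t)" "\<lambda>x. f s x - f t x" "g s"] by simp
    moreover have "L2_inner \<Omega> (f t) (?dg s) = L2_inner \<Omega> (f t) (\<lambda>x. g s x - g t x) / (s - t)"
      using L2_inner_cmult_right[of \<Omega> "f t" "1 / (s - t)" "\<lambda>x. g s x - g t x"] by simp
    ultimately show ?case
      using L[OF s] L[OF t] by (simp add: L2_inner_diff_left L2_inner_diff_right add_divide_distrib[symmetric])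
  qed
qed

lemma L2_deriv_cong_AE:
  assumes "L2_deriv \<Omega> T f f'" "\<And>s. s \<in> time_interval T \<Longrightarrow> g s \<in> L2 \<Omega>"
    and "\<And>s. s \<in> time_interval T \<Longrightarrow> AE x in lebesgue_on \<Omega>. g s x = f s x"
  shows "L2_deriv \<Omega> T g f'"
  unfolding has_time_deriv_def
proof (intro ballI conjI)
  fix t assume t: "t \<in> time_interval T"
  have L: "f s \<in> L2 \<Omega>" "f' s \<in> L2 \<Omega>" if "s \<in> time_interval T" for s
    using assms(1) that by (auto simp: has_time_deriv_def)
  show "g t \<in> L2 \<Omega>" "f' t \<in> L2 \<Omega>" using assms(2) L t by auto
  show "((\<lambda>s. Lq_norm \<Omega> 2 (\<lambda>x. (g s x - g t x) / (s - t) - f' t x)) \<longlongrightarrow> 0) (at t within time_interval T)"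
  proof (rule Lim_transform_eventually)
    show "((\<lambda>s. Lq_norm \<Omega> 2 (\<lambda>x. (f s x - f t x) / (s - t) - f' t x)) \<longlongrightarrow> 0) (at t within time_interval T)"
      using assms(1) t by (simp add: has_time_deriv_def)
    show "\<forall>\<^sub>F s in at t within time_interval T. Lq_norm \<Omega> 2 (\<lambda>x. (f s x - f t x) / (s - t) - f' t x) =
        Lq_norm \<Omega> 2 (\<lambda>x. (g s x - g t x) / (s - t) - f' t x)"
      using eventually_time_interval
    proof eventually_elim
      case (elim s)
      then have s: "s \<in> time_interval T" by simp
      have ae: "AE x in lebesgue_on \<Omega>. (f s x - f t x) / (s - t) - f' t x = (g s x - g t x) / (s - t) - f' t x"
        using assms(3)[OF s] assms(3)[OF t] by eventually_elim simp
      show ?case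
        using L s t assms(2)
        by (intro Lq_norm_cong_AE[OF ae] L2_measurable L2_diff difference_quotient_L2) auto
    qed
  qed
qed

text \<open>Differentiability in the \<open>H1\<close> norm descends to every spatial partial. Weak
  partials commute with difference quotients only almost everywhere, which is all that the norms
  require.\<close>

lemma has_time_deriv_H10_imp:
  assumes \<Omega>: "open \<Omega>" and d: "has_time_deriv (H10 \<Omega>) (H1_norm \<Omega>) T u v"
  shows "L2_deriv \<Omega> T u v" "i \<in> Basis \<Longrightarrow> L2_deriv \<Omega> T (\<lambda>t. weak_partial \<Omega> i (u t)) (\<lambda>t. weak_partial \<Omega> i (v t))"
proof -
  have H: "u s \<in> H1 \<Omega>" "v s \<in> H1 \<Omega>" if "s \<in> time_interval T" for s
    using d that by (auto simp: has_time_deriv_def H10_subset_H1)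
  note L = H1_subset_L2[OF H(1)] H1_subset_L2[OF H(2)]
  define q where "q t s = (\<lambda>x. (u s x - u t x) / (s - t) - v t x)" for t s
  have qH: "q t s \<in> H1 \<Omega>"
    and qw: "i \<in> Basis \<Longrightarrow> AE x in lebesgue_on \<Omega>. weak_partial \<Omega> i (q t s) x =
      (weak_partial \<Omega> i (u s) x - weak_partial \<Omega> i (u t) x) / (s - t) - weak_partial \<Omega> i (v t) x"
    if "t \<in> time_interval T" "s \<in> time_interval T" for t s i
  proof -
    have q1: "q t s = (\<lambda>x. (1 / (s - t)) * (u s x - u t x) + (-1) * v t x)" by (simp add: q_def)
    note D = H1_diff[OF \<Omega> H(1)[OF that(2)] H(1)[OF that(1)]]
    note E = H1_lincomb[OF \<Omega> D(1) H(2)[OF that(1)], where c = "1 / (s - t)" and d = "-1"]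
    show "q t s \<in> H1 \<Omega>" unfolding q1 by (rule E(1))
    show "AE x in lebesgue_on \<Omega>. weak_partial \<Omega> i (q t s) x =
      (weak_partial \<Omega> i (u s) x - weak_partial \<Omega> i (u t) x) / (s - t) - weak_partial \<Omega> i (v t) x" if i: "i \<in> Basis"
      using E(2)[OF i] D(2)[OF i] unfolding q1[symmetric] by eventually_elim simp
  qed
  have lim: "((\<lambda>s. Lq_norm \<Omega> 2 (q t s)) \<longlongrightarrow> 0) (at t within time_interval T) \<and>
      (\<forall>i\<in>Basis. ((\<lambda>s. Lq_norm \<Omega> 2 (weak_partial \<Omega> i (q t s))) \<longlongrightarrow> 0) (at t within time_interval T))"
    if t: "t \<in> time_interval T" for t
  proof (subst H1_norm_tendsto_iff[OF \<Omega>, symmetric])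
    show "\<forall>\<^sub>F s in at t within time_interval T. q t s \<in> H1 \<Omega>"
      by (rule eventually_mono[OF eventually_time_interval]) (use qH t in blast)
    show "((\<lambda>s. H1_norm \<Omega> (q t s)) \<longlongrightarrow> 0) (at t within time_interval T)"
      using d t by (simp add: has_time_deriv_def q_def)
  qed
  show "L2_deriv \<Omega> T u v"
    using lim L by (simp add: has_time_deriv_def q_def)
  show "L2_deriv \<Omega> T (\<lambda>t. weak_partial \<Omega> i (u t)) (\<lambda>t. weak_partial \<Omega> i (v t))" if i: "i \<in> Basis"
    unfolding has_time_deriv_def
  proof (intro ballI conjI)
    fix t assume t: "t \<in> time_interval T"
    note W = H1_weak_partial(2)[OF \<Omega> H(1) i] H1_weak_partial(2)[OF \<Omega> H(2) i]
    show "weak_partial \<Omega> i (u t) \<in> L2 \<Omega>" "weak_partial \<Omega> i (v t) \<in> L2 \<Omega>" using W t by auto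
    show "((\<lambda>s. Lq_norm \<Omega> 2 (\<lambda>x. (weak_partial \<Omega> i (u s) x - weak_partial \<Omega> i (u t) x) / (s - t) - weak_partial \<Omega> i (v t) x)) \<longlongrightarrow> 0)
        (at t within time_interval T)"
    proof (rule Lim_transform_eventually)
      show "((\<lambda>s. Lq_norm \<Omega> 2 (weak_partial \<Omega> i (q t s))) \<longlongrightarrow> 0) (at t within time_interval T)"
        using lim[OF t] i by blast
      show "\<forall>\<^sub>F s in at t within time_interval T. Lq_norm \<Omega> 2 (weak_partial \<Omega> i (q t s)) =
          Lq_norm \<Omega> 2 (\<lambda>x. (weak_partial \<Omega> i (u s) x - weak_partial \<Omega> i (u t) x) / (s - t) - weak_partial \<Omega> i (v t) x)"
        using eventually_time_interval
      proof eventually_elim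
        case (elim s)
        then have s: "s \<in> time_interval T" by simp
        show ?case
        proof (rule Lq_norm_cong_AE[OF qw[OF t s i]])
          show "weak_partial \<Omega> i (q t s) \<in> borel_measurable (lebesgue_on \<Omega>)"
            by (rule L2_measurable[OF H1_weak_partial(2)[OF \<Omega> qH[OF t s] i]])
          show "(\<lambda>x. (weak_partial \<Omega> i (u s) x - weak_partial \<Omega> i (u t) x) / (s - t) - weak_partial \<Omega> i (v t) x)
              \<in> borel_measurable (lebesgue_on \<Omega>)"
            by (intro L2_measurable L2_diff W t difference_quotient_L2[of "\<lambda>s. weak_partial \<Omega> i (u s)"] s)
        qed
      qed
    qed
  qed
qed

text \<open>Each pure second partial is one summand of the squared \<open>H2_norm\<close>, and the
  Laplacian has as many summands as there are dimensions. Linearity almost everywhere is used twice,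
  since \<open>H2_norm\<close> iterates \<open>weak_partial\<close> on the difference
  itself.\<close>

lemma weak_laplacian_diff_le_H2_norm:
  fixes \<Omega> :: "'a::euclidean_space set"
  assumes \<Omega>: "open \<Omega>" and f: "f \<in> H2 \<Omega>" and g: "g \<in> H2 \<Omega>"
  shows "Lq_norm \<Omega> 2 (\<lambda>x. weak_laplacian \<Omega> f x - weak_laplacian \<Omega> g x) \<le> real DIM('a) * H2_norm \<Omega> (\<lambda>x. f x - g x)"
proof -
  let ?p = "\<lambda>i f. weak_partial \<Omega> i f" and ?h = "\<lambda>x. f x - g x"
  have fH: "f \<in> H1 \<Omega>" "g \<in> H1 \<Omega>" "\<And>i. i \<in> Basis \<Longrightarrow> ?p i f \<in> H1 \<Omega>" "\<And>i. i \<in> Basis \<Longrightarrow> ?p i g \<in> H1 \<Omega>"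
    using f g by (auto simp: H2_def)
  have pL: "?p i (?p i f) \<in> L2 \<Omega>" "?p i (?p i g) \<in> L2 \<Omega>" if "i \<in> Basis" for i
    using H1_weak_partial(2)[OF \<Omega> fH(3)[OF that] that] H1_weak_partial(2)[OF \<Omega> fH(4)[OF that] that] by auto
  have one: "Lq_norm \<Omega> 2 (\<lambda>x. ?p i (?p i f) x - ?p i (?p i g) x) \<le> H2_norm \<Omega> ?h" if i: "i \<in> Basis" for i
  proof -
    note D = H1_diff[OF \<Omega> fH(3)[OF i] fH(4)[OF i]]
    note C = H1_cong_AE[OF \<Omega> D(1) H1_diff(2)[OF \<Omega> fH(1,2) i]]
    have "AE x in lebesgue_on \<Omega>. ?p i (?p i ?h) x = ?p i (?p i f) x - ?p i (?p i g) x"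
      using C(2)[OF i] D(2)[OF i] by eventually_elim simp
    then have "Lq_norm \<Omega> 2 (\<lambda>x. ?p i (?p i f) x - ?p i (?p i g) x) = Lq_norm \<Omega> 2 (?p i (?p i ?h))"
      using pL[OF i] H1_weak_partial(2)[OF \<Omega> C(1) i]
      by (intro Lq_norm_cong_AE L2_measurable L2_diff) (auto elim: eventually_mono)
    also have "\<dots> \<le> H2_norm \<Omega> ?h"
      unfolding H2_norm_def
    proof (rule real_le_rsqrt)
      have "(Lq_norm \<Omega> 2 (?p i (?p i ?h)))\<^sup>2 \<le> (\<Sum>j\<in>Basis. (Lq_norm \<Omega> 2 (?p j (?p i ?h)))\<^sup>2)"
        using i by (intro member_le_sum) auto
      also have "\<dots> \<le> (\<Sum>i\<in>Basis. \<Sum>j\<in>Basis. (Lq_norm \<Omega> 2 (?p j (?p i ?h)))\<^sup>2)"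
        using i by (intro member_le_sum[of i _ "\<lambda>i. \<Sum>j\<in>Basis. (Lq_norm \<Omega> 2 (?p j (?p i ?h)))\<^sup>2"]) (auto intro: sum_nonneg)
      finally show "(Lq_norm \<Omega> 2 (?p i (?p i ?h)))\<^sup>2 \<le> (H1_norm \<Omega> ?h)\<^sup>2 + (\<Sum>i\<in>Basis. \<Sum>j\<in>Basis. (Lq_norm \<Omega> 2 (?p j (?p i ?h)))\<^sup>2)"
        by (simp add: add_increasing)
    qed
    finally show ?thesis .
  qed
  have sum_le: "Lq_norm \<Omega> 2 (\<lambda>x. \<Sum>i\<in>B. d i x) \<le> (\<Sum>i\<in>B. Lq_norm \<Omega> 2 (d i))"
    if "finite B" "\<And>i. i \<in> B \<Longrightarrow> d i \<in> L2 \<Omega>" for B :: "'a set" and d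
    using that
  proof (induction B rule: finite_induct)
    case empty
    then show ?case by (simp add: Lq_norm_def)
  next
    case (insert i B)
    have "Lq_norm \<Omega> 2 (\<lambda>x. d i x + (\<Sum>i\<in>B. d i x)) \<le> Lq_norm \<Omega> 2 (d i) + Lq_norm \<Omega> 2 (\<lambda>x. \<Sum>i\<in>B. d i x)"
      using insert.prems by (intro L2_norm_triangle L2_sum) auto
    then show ?case using insert by simp
  qed
  have "Lq_norm \<Omega> 2 (\<lambda>x. weak_laplacian \<Omega> f x - weak_laplacian \<Omega> g x) = Lq_norm \<Omega> 2 (\<lambda>x. \<Sum>i\<in>Basis. ?p i (?p i f) x - ?p i (?p i g) x)"
    by (simp add: weak_laplacian_def sum_subtractf)
  also have "\<dots> \<le> (\<Sum>i\<in>Basis. Lq_norm \<Omega> 2 (\<lambda>x. ?p i (?p i f) x - ?p i (?p i g) x))"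
    using pL by (intro sum_le L2_diff) auto
  also have "\<dots> \<le> (\<Sum>i\<in>(Basis::'a set). H2_norm \<Omega> ?h)" by (intro sum_mono one)
  finally show ?thesis by simp
qed


lemma L2_tendsto_AE_subseq:
  fixes f :: "nat \<Rightarrow> 'a::euclidean_space \<Rightarrow> real"
  assumes \<Omega>: "open \<Omega>" "bounded \<Omega>"
    and f: "\<And>n. f n \<in> L2 \<Omega>" "g \<in> L2 \<Omega>" "(\<lambda>n. Lq_norm \<Omega> 2 (\<lambda>x. f n x - g x)) \<longlonglongrightarrow> 0"
  shows "\<exists>r::nat \<Rightarrow> nat. strict_mono r \<and> (AE x in lebesgue_on \<Omega>. (\<lambda>n. f (r n) x) \<longlonglongrightarrow> g x)"
proof -
  have "(\<lambda>n. LINT x|lebesgue_on \<Omega>. norm (f n x - g x)) \<longlonglongrightarrow> 0"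
  proof (rule Lim_null_comparison)
    show "(\<lambda>n. Lq_norm \<Omega> 2 (\<lambda>x. 1::real) * Lq_norm \<Omega> 2 (\<lambda>x. f n x - g x)) \<longlonglongrightarrow> 0"
      using tendsto_mult[OF tendsto_const f(3)] by simp
    show "\<forall>\<^sub>F n in sequentially. norm (LINT x|lebesgue_on \<Omega>. norm (f n x - g x)) \<le>
        Lq_norm \<Omega> 2 (\<lambda>x. 1::real) * Lq_norm \<Omega> 2 (\<lambda>x. f n x - g x)"
      using L1_norm_le_L2_norm[OF \<Omega> L2_diff[OF f(1,2)]] by (intro always_eventually allI) simp
  qed
  from tendsto_L1_AE_subseq[OF L2_integrable[OF \<Omega> L2_diff[OF f(1,2)]] this]
  obtain r :: "nat \<Rightarrow> nat" where r: "strict_mono r" "AE x in lebesgue_on \<Omega>. (\<lambda>n. f (r n) x - g x) \<longlonglongrightarrow> 0" by blast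
  from r(2) have "AE x in lebesgue_on \<Omega>. (\<lambda>n. f (r n) x) \<longlonglongrightarrow> g x"
    by eventually_elim (rule LIM_zero_cancel)
  with r(1) show ?thesis by blast
qed

section \<open>Strong solutions\<close>

text \<open>The tangent of the convex function x^4 lies below it; explicitly, the gap is
  \<open>(x - y)^2\<close> times a sum of squares.\<close>

lemma quartic_convex:
  fixes x y :: real
  shows "4 * y ^ 3 * (x - y) \<le> x ^ 4 - y ^ 4"
proof -
  have "x ^ 4 - y ^ 4 - 4 * y ^ 3 * (x - y) = (x - y)\<^sup>2 * ((x + y)\<^sup>2 + 2 * y\<^sup>2)"
    by (simp add: power2_eq_square eval_nat_numeral algebra_simps)
  then show ?thesis by (smt (verit) mult_nonneg_nonneg zero_le_power2)
qed

text \<open>Here \<open>v\<close> and \<open>w\<close> stand for u_t and u_tt. One and the same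
  \<open>v\<close> is the derivative of \<open>u\<close> in \<open>L2\<close> and of its partials,
  and takes values in \<open>H10\<close>, so that it may serve as a test function in Green's
  formula.\<close>

locale kirchhoff_flow =
  fixes \<Omega> :: "'a::euclidean_space set" and a b lam :: real and T :: ereal and u v w :: "real \<Rightarrow> 'a \<Rightarrow> real"
  assumes \<Omega>: "open \<Omega>" "bounded \<Omega>" and T: "0 < T"
    and u: "\<And>t. t \<in> time_interval T \<Longrightarrow> u t \<in> H10 \<Omega>" "\<And>t. t \<in> time_interval T \<Longrightarrow> u t \<in> H2 \<Omega>"
    and v: "\<And>t. t \<in> time_interval T \<Longrightarrow> v t \<in> H10 \<Omega>"
    and du: "L2_deriv \<Omega> T u v" and dv: "L2_deriv \<Omega> T v w"
    and dgrad: "\<And>i. i \<in> Basis \<Longrightarrow> L2_deriv \<Omega> T (\<lambda>t. weak_partial \<Omega> i (u t)) (\<lambda>t. weak_partial \<Omega> i (v t))"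
    and cw: "\<And>t. t \<in> time_interval T \<Longrightarrow> ((\<lambda>s. Lq_norm \<Omega> 2 (\<lambda>x. w s x - w t x)) \<longlongrightarrow> 0) (at t within time_interval T)"
    and cLap: "\<And>t. t \<in> time_interval T \<Longrightarrow>
      ((\<lambda>s. Lq_norm \<Omega> 2 (\<lambda>x. weak_laplacian \<Omega> (u s) x - weak_laplacian \<Omega> (u t) x)) \<longlongrightarrow> 0) (at t within time_interval T)"
    and equation: "\<And>t. 0 < t \<Longrightarrow> ereal t < T \<Longrightarrow> AE x in lebesgue_on \<Omega>.
      w t x - (a * grad_inner \<Omega> (u t) (u t) + b) * weak_laplacian \<Omega> (u t) x = lam * u t x + u t x ^ 3"
begin

abbreviation "I \<equiv> time_interval T"
abbreviation "M t \<equiv> a * grad_inner \<Omega> (u t) (u t) + b"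

text \<open>The cubic term, expressed through the equation: this is how \<open>u\<^sup>3\<close> is seen to be a continuous
  curve in \<open>L\<^sup>2\<close> without any Sobolev embedding.\<close>

definition R :: "real \<Rightarrow> 'a \<Rightarrow> real" where
  "R t x = 1 * w t x + (-1) * (M t * weak_laplacian \<Omega> (u t) x + lam * u t x)"

lemma in_L2:
  assumes "t \<in> I"
  shows "u t \<in> L2 \<Omega>" "v t \<in> L2 \<Omega>" "w t \<in> L2 \<Omega>" "weak_laplacian \<Omega> (u t) \<in> L2 \<Omega>" "u t \<in> H1 \<Omega>" "v t \<in> H1 \<Omega>" "R t \<in> L2 \<Omega>"
proof -
  show 1: "u t \<in> L2 \<Omega>" "v t \<in> L2 \<Omega>" "w t \<in> L2 \<Omega>"
    using du dv assms by (auto simp: has_time_deriv_def)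
  show 2: "weak_laplacian \<Omega> (u t) \<in> L2 \<Omega>" by (rule weak_laplacian_L2[OF \<Omega>(1) u(2)[OF assms]])
  show "u t \<in> H1 \<Omega>" "v t \<in> H1 \<Omega>" using u(1) v assms H10_subset_H1 by auto
  show "R t \<in> L2 \<Omega>" unfolding R_def[abs_def] using 1 2 by (intro L2_add L2_cmult)
qed

lemma eventually_in_L2:
  "\<forall>\<^sub>F s in at t within I. u s \<in> L2 \<Omega>" "\<forall>\<^sub>F s in at t within I. w s \<in> L2 \<Omega>"
  "\<forall>\<^sub>F s in at t within I. weak_laplacian \<Omega> (u s) \<in> L2 \<Omega>" "\<forall>\<^sub>F s in at t within I. R s \<in> L2 \<Omega>"
  by (rule eventually_mono[OF eventually_time_interval], use in_L2 in simp)+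

text \<open>Green's formula moves the spatial derivatives from \<open>v\<close> to \<open>u\<close>;
  in this form the term cancels against the equation tested with \<open>v\<close>.\<close>

lemma grad_deriv:
  assumes "t \<in> I"
  shows "((\<lambda>t. grad_inner \<Omega> (u t) (u t)) has_real_derivative - 2 * L2_inner \<Omega> (weak_laplacian \<Omega> (u t)) (v t)) (at t within I)"
proof -
  have "((\<lambda>t. grad_inner \<Omega> (u t) (u t)) has_real_derivative
    (\<Sum>i\<in>Basis. L2_inner \<Omega> (weak_partial \<Omega> i (v t)) (weak_partial \<Omega> i (u t)) + L2_inner \<Omega> (weak_partial \<Omega> i (u t)) (weak_partial \<Omega> i (v t))))
    (at t within I)"
    unfolding grad_inner_def by (intro DERIV_sum L2_inner_deriv dgrad assms)
  also have "(\<Sum>i\<in>Basis. L2_inner \<Omega> (weak_partial \<Omega> i (v t)) (weak_partial \<Omega> i (u t)) + L2_inner \<Omega> (weak_partial \<Omega> i (u t)) (weak_partial \<Omega> i (v t)))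
      = 2 * grad_inner \<Omega> (u t) (v t)"
    by (simp add: sum_distrib_left grad_inner_def L2_inner_commute[of \<Omega> "weak_partial \<Omega> _ (v t)"])
  also have "\<dots> = - 2 * L2_inner \<Omega> (weak_laplacian \<Omega> (u t)) (v t)"
    using grad_inner_laplacian[OF \<Omega>(1) u(2)[OF assms] v[OF assms]] by simp
  finally show ?thesis .
qed

lemma R_continuous:
  assumes "t \<in> I"
  shows "((\<lambda>s. Lq_norm \<Omega> 2 (\<lambda>x. R s x - R t x)) \<longlongrightarrow> 0) (at t within I)"
proof -
  let ?N = "Lq_norm \<Omega> 2" and ?L = "\<lambda>t. weak_laplacian \<Omega> (u t)"
  note L = in_L2[OF assms]
  have Mc: "(M \<longlongrightarrow> M t) (at t within I)"
    using DERIV_continuous[OF grad_deriv[OF assms]] by (intro tendsto_intros) (simp add: continuous_within)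
  have nL: "((\<lambda>s. ?N (?L s)) \<longlongrightarrow> ?N (?L t)) (at t within I)"
    by (intro L2_tendsto_norm cLap eventually_in_L2 assms L)
  have "((\<lambda>s. \<bar>M s - M t\<bar> * ?N (?L s)) \<longlongrightarrow> \<bar>M t - M t\<bar> * ?N (?L t)) (at t within I)"
    by (intro tendsto_mult tendsto_rabs tendsto_diff Mc nL tendsto_const)
  then have 0: "((\<lambda>s. \<bar>M s - M t\<bar> * ?N (?L s) + \<bar>M t\<bar> * ?N (\<lambda>x. ?L s x - ?L t x)) \<longlongrightarrow> 0) (at t within I)"
    using tendsto_add[OF _ tendsto_mult[OF tendsto_const[of "\<bar>M t\<bar>"] cLap[OF assms]]] by fastforce
  have 1: "((\<lambda>s. ?N (\<lambda>x. M s * ?L s x - M t * ?L t x)) \<longlongrightarrow> 0) (at t within I)"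
  proof (rule Lim_null_comparison[OF _ 0])
    show "\<forall>\<^sub>F s in at t within I. norm (?N (\<lambda>x. M s * ?L s x - M t * ?L t x)) \<le>
        \<bar>M s - M t\<bar> * ?N (?L s) + \<bar>M t\<bar> * ?N (\<lambda>x. ?L s x - ?L t x)"
      using eventually_in_L2(3)
    proof eventually_elim
      case (elim s)
      \<comment> \<open>The usual splitting of a product, with the change of the scalar
        \<open>M\<close> and the change of the Laplacian in separate terms.\<close>
      have "(\<lambda>x. M s * ?L s x - M t * ?L t x) = (\<lambda>x. (M s - M t) * ?L s x + M t * (?L s x - ?L t x))"
        by (simp add: algebra_simps)
      then show ?case
        using L2_norm_lincomb_le[OF elim L2_diff[OF elim L(4)], of "M s - M t" "M t"] by (simp add: L2_norm_nonneg)
    qed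
  qed
  have Mlap: "\<forall>\<^sub>F s in at t within I. (\<lambda>x. M s * ?L s x) \<in> L2 \<Omega>"
    using eventually_in_L2(3) by eventually_elim (rule L2_cmult)
  have uc: "((\<lambda>s. ?N (\<lambda>x. u s x - u t x)) \<longlongrightarrow> 0) (at t within I)" by (rule L2_deriv_continuous[OF du assms])
  have 2: "((\<lambda>s. ?N (\<lambda>x. (1 * (M s * ?L s x) + lam * u s x) - (1 * (M t * ?L t x) + lam * u t x))) \<longlongrightarrow> 0) (at t within I)"
    by (intro L2_tendsto_lincomb 1 uc Mlap eventually_in_L2 L2_cmult L)
  then have 2: "((\<lambda>s. ?N (\<lambda>x. (M s * ?L s x + lam * u s x) - (M t * ?L t x + lam * u t x))) \<longlongrightarrow> 0) (at t within I)"
    by simp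
  show ?thesis
    unfolding R_def
  proof (rule L2_tendsto_lincomb[OF cw[OF assms] 2])
    show "\<forall>\<^sub>F s in at t within I. (\<lambda>x. M s * ?L s x + lam * u s x) \<in> L2 \<Omega>"
      using Mlap eventually_in_L2(1) by eventually_elim (rule L2_add[OF _ L2_cmult])
    show "(\<lambda>x. M t * ?L t x + lam * u t x) \<in> L2 \<Omega>" using L by (intro L2_add L2_cmult)
  qed (use eventually_in_L2 L in auto)
qed

text \<open>At time \<open>0\<close>, where the equation is not assumed, it follows by passing to the limit almost everywhere.\<close>

lemma cube_eq_R:
  assumes "t \<in> I"
  shows "AE x in lebesgue_on \<Omega>. u t x ^ 3 = R t x"
proof (cases "t = 0")
  case False
  then have "0 < t" "ereal t < T" using assms by (auto simp: time_interval_def)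
  from equation[OF this] show ?thesis by eventually_elim (simp add: R_def)
next
  case True
  have pos: "AE x in lebesgue_on \<Omega>. u s x ^ 3 = R s x" if "0 < s" "ereal s < T" for s
    using equation[OF that] by eventually_elim (simp add: R_def)
  obtain t' where t': "0 < t'" "ereal t' < T" using ereal_dense2[OF T] by (auto simp: zero_ereal_def)
  \<comment> \<open>Positive times inside the interval that tend to 0, at which the equation is
    available.\<close>
  define q where "q n = t' / real (Suc n)" for n
  have q: "0 < q n" "q n \<le> t'" for n
    using t'(1) by (auto simp: q_def divide_simps mult_left_mono)
  have qT: "ereal (q n) < T" for n using q(2)[of n] t'(2) by (meson ereal_less_eq(3) le_less_trans)
  have qI: "q n \<in> I" for n using q(1)[of n] qT by (simp add: time_interval_def less_imp_le)
  have "q \<longlonglongrightarrow> 0"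
    using tendsto_mult[OF tendsto_const[of t'] LIMSEQ_Suc[OF lim_1_over_n]] by (simp add: q_def[abs_def])
  then have fl: "filterlim q (at 0 within I) sequentially"
    using qI q(1) by (simp add: filterlim_at less_imp_neq[symmetric])
  have 0: "0 \<in> I" using assms True by simp
  have c: "(\<lambda>n. Lq_norm \<Omega> 2 (\<lambda>x. u (q n) x - u 0 x)) \<longlonglongrightarrow> 0" "(\<lambda>n. Lq_norm \<Omega> 2 (\<lambda>x. R (q n) x - R 0 x)) \<longlonglongrightarrow> 0"
    using filterlim_compose[OF L2_deriv_continuous[OF du 0] fl] filterlim_compose[OF R_continuous[OF 0] fl] by simp_all
  from L2_tendsto_AE_subseq[OF \<Omega> in_L2(1)[OF qI] in_L2(1)[OF 0] c(1)]
  obtain r :: "nat \<Rightarrow> nat" where r: "strict_mono r" "AE x in lebesgue_on \<Omega>. (\<lambda>n. u (q (r n)) x) \<longlonglongrightarrow> u 0 x" by blast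
  \<comment> \<open>The second extraction is made along the first, so that \<open>u\<close> and
    \<open>R\<close> converge almost everywhere on one common subsequence.\<close>
  have c2: "(\<lambda>n. Lq_norm \<Omega> 2 (\<lambda>x. R (q (r n)) x - R 0 x)) \<longlonglongrightarrow> 0"
    using LIMSEQ_subseq_LIMSEQ[OF c(2) r(1)] by (simp add: o_def)
  from L2_tendsto_AE_subseq[OF \<Omega> in_L2(7)[OF qI] in_L2(7)[OF 0] c2]
  obtain r' :: "nat \<Rightarrow> nat" where r': "strict_mono r'" "AE x in lebesgue_on \<Omega>. (\<lambda>n. R (q (r (r' n))) x) \<longlonglongrightarrow> R 0 x" by blast
  have "AE x in lebesgue_on \<Omega>. \<forall>n. u (q n) x ^ 3 = R (q n) x"
    unfolding AE_all_countable using pos[OF q(1) qT] by blast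
  with r(2) r'(2) have "AE x in lebesgue_on \<Omega>. u 0 x ^ 3 = R 0 x"
  proof eventually_elim
    case (elim x)
    have "(\<lambda>n. u (q (r (r' n))) x ^ 3) \<longlonglongrightarrow> u 0 x ^ 3"
      using LIMSEQ_subseq_LIMSEQ[OF elim(1) r'(1)] by (intro tendsto_power) (simp add: o_def)
    moreover have "(\<lambda>n. u (q (r (r' n))) x ^ 3) = (\<lambda>n. R (q (r (r' n))) x)" using elim(3) by simp
    ultimately show ?case using LIMSEQ_unique elim(2) by simp
  qed
  with True show ?thesis by simp
qed

text \<open>This is the fourth power of the \<open>L4\<close> norm of \<open>u t\<close>. As a
  pairing of two elements of \<open>L2\<close> it is finite by construction, and \<open>Q_eq\<close>
  transfers the integrability to \<open>u t x ^ 4\<close>.\<close>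

definition Q :: "real \<Rightarrow> real" where "Q t = L2_inner \<Omega> (u t) (R t)"

lemma Q_eq:
  assumes "t \<in> I"
  shows "integrable (lebesgue_on \<Omega>) (\<lambda>x. u t x ^ 4)" "Q t = (LINT x|lebesgue_on \<Omega>. u t x ^ 4)" "Lq_norm \<Omega> 4 (u t) ^ 4 = Q t"
proof -
  note L = in_L2[OF assms]
  have ae: "AE x in lebesgue_on \<Omega>. u t x * R t x = u t x ^ 4"
    using cube_eq_R[OF assms] by eventually_elim (simp add: eval_nat_numeral)
  have m: "(\<lambda>x. u t x ^ 4) \<in> borel_measurable (lebesgue_on \<Omega>)" using L2_measurable[OF L(1)] by measurable
  show "integrable (lebesgue_on \<Omega>) (\<lambda>x. u t x ^ 4)"
    using L2_mult_integrable[OF L(1) L(7)] integrable_cong_AE[OF _ m ae] by auto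
  show 1: "Q t = (LINT x|lebesgue_on \<Omega>. u t x ^ 4)"
    unfolding Q_def L2_inner_def using L2_mult_integrable[OF L(1) L(7)] m ae by (intro integral_cong_AE) auto
  show "Lq_norm \<Omega> 4 (u t) ^ 4 = Q t"
    unfolding 1 by (subst Lq_norm_power) auto
qed

text \<open>Convexity of the fourth power squeezes the difference quotients of \<open>Q\<close>.\<close>

lemma Q_convex:
  assumes "s \<in> I" "t \<in> I"
  shows "4 * L2_inner \<Omega> (R t) (\<lambda>x. u s x - u t x) \<le> Q s - Q t"
proof -
  note Ls = in_L2[OF assms(1)] and Lt = in_L2[OF assms(2)]
  have "4 * L2_inner \<Omega> (R t) (\<lambda>x. u s x - u t x) = (LINT x|lebesgue_on \<Omega>. 4 * (R t x * (u s x - u t x)))"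
    unfolding L2_inner_def by simp
  also have "\<dots> \<le> (LINT x|lebesgue_on \<Omega>. u s x ^ 4 - u t x ^ 4)"
  proof (rule integral_mono_AE)
    show "integrable (lebesgue_on \<Omega>) (\<lambda>x. 4 * (R t x * (u s x - u t x)))"
      using Ls Lt by (intro integrable_mult_right L2_mult_integrable L2_diff)
    show "integrable (lebesgue_on \<Omega>) (\<lambda>x. u s x ^ 4 - u t x ^ 4)"
      using Q_eq(1) assms by simp
    show "AE x in lebesgue_on \<Omega>. 4 * (R t x * (u s x - u t x)) \<le> u s x ^ 4 - u t x ^ 4"
      using cube_eq_R[OF assms(2)]
    proof eventually_elim
      case (elim x)
      show ?case using quartic_convex[of "u t x" "u s x"] by (simp add: elim mult.assoc)
    qed
  qed
  also have "\<dots> = Q s - Q t" using Q_eq(1,2) assms by simp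
  finally show ?thesis .
qed

lemma Q_deriv:
  assumes t: "t \<in> I"
  shows "(Q has_real_derivative 4 * L2_inner \<Omega> (R t) (v t)) (at t within I)"
  unfolding has_field_derivative_iff
proof -
  let ?F = "at t within I" and ?d = "\<lambda>s x. (u s x - u t x) / (s - t)"
  note L = in_L2[OF t]
  have lim: "((\<lambda>s. Lq_norm \<Omega> 2 (\<lambda>x. ?d s x - v t x)) \<longlongrightarrow> 0) ?F"
    using du t by (simp add: has_time_deriv_def)
  have ev: "\<forall>\<^sub>F s in ?F. ?d s \<in> L2 \<Omega>"
    by (rule eventually_mono[OF eventually_time_interval], rule difference_quotient_L2) (use in_L2(1) t in simp_all)
  have z: "((\<lambda>s. Lq_norm \<Omega> 2 (\<lambda>x. R t x - R t x)) \<longlongrightarrow> 0) ?F" by (simp add: Lq_norm_def)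
  have l1: "((\<lambda>s. 4 * L2_inner \<Omega> (R t) (?d s)) \<longlongrightarrow> 4 * L2_inner \<Omega> (R t) (v t)) ?F"
    by (intro tendsto_mult tendsto_const L2_tendsto_inner[OF z lim]) (use ev L in simp_all)
  have l2: "((\<lambda>s. 4 * L2_inner \<Omega> (R s) (?d s)) \<longlongrightarrow> 4 * L2_inner \<Omega> (R t) (v t)) ?F"
    by (intro tendsto_mult tendsto_const L2_tendsto_inner[OF R_continuous[OF t] lim]) (use ev eventually_in_L2 L in simp_all)
  have min: "((\<lambda>s. min (4 * L2_inner \<Omega> (R t) (?d s)) (4 * L2_inner \<Omega> (R s) (?d s))) \<longlongrightarrow> 4 * L2_inner \<Omega> (R t) (v t)) ?F"
    using tendsto_min[OF l1 l2] by simp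
  have max: "((\<lambda>s. max (4 * L2_inner \<Omega> (R t) (?d s)) (4 * L2_inner \<Omega> (R s) (?d s))) \<longlongrightarrow> 4 * L2_inner \<Omega> (R t) (v t)) ?F"
    using tendsto_max[OF l1 l2] by simp
  \<comment> \<open>Applying \<open>Q_convex\<close> with \<open>s\<close> and \<open>t\<close>
    exchanged gives the opposite bound. Division by \<open>s - t\<close> reverses both inequalities
    when \<open>s < t\<close>, hence \<open>min\<close> and \<open>max\<close>.\<close>
  have both: "min (4 * L2_inner \<Omega> (R t) (?d s)) (4 * L2_inner \<Omega> (R s) (?d s)) \<le> (Q s - Q t) / (s - t) \<and>
      (Q s - Q t) / (s - t) \<le> max (4 * L2_inner \<Omega> (R t) (?d s)) (4 * L2_inner \<Omega> (R s) (?d s))"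
    if s: "s \<in> I" "s \<noteq> t" for s
  proof -
    define p where "p = 4 * L2_inner \<Omega> (R t) (\<lambda>x. u s x - u t x)"
    define r where "r = 4 * L2_inner \<Omega> (R s) (\<lambda>x. u s x - u t x)"
    have p: "4 * L2_inner \<Omega> (R t) (?d s) = p / (s - t)"
      using L2_inner_cmult_right[of \<Omega> "R t" "1 / (s - t)" "\<lambda>x. u s x - u t x"] by (simp add: p_def)
    have r: "4 * L2_inner \<Omega> (R s) (?d s) = r / (s - t)"
      using L2_inner_cmult_right[of \<Omega> "R s" "1 / (s - t)" "\<lambda>x. u s x - u t x"] by (simp add: r_def)
    have "4 * L2_inner \<Omega> (R s) (\<lambda>x. u t x - u s x) = - r"
      using L2_inner_cmult_right[of \<Omega> "R s" "-1" "\<lambda>x. u s x - u t x"] by (simp add: r_def)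
    then have "p \<le> Q s - Q t" "Q s - Q t \<le> r"
      using Q_convex[OF s(1) t] Q_convex[OF t s(1)] by (simp_all add: p_def)
    then show ?thesis
      unfolding p r using s(2)
      by (cases "s > t") (auto simp: min_le_iff_disj le_max_iff_disj divide_right_mono divide_right_mono_neg)
  qed
  show "((\<lambda>s. (Q s - Q t) / (s - t)) \<longlongrightarrow> 4 * L2_inner \<Omega> (R t) (v t)) ?F"
    by (rule tendsto_sandwich[OF _ _ min max]; rule eventually_mono[OF eventually_time_interval]) (use both in blast)+
qed

section \<open>Scalar quantities along the flow, their derivatives, and conservation of
  energy\<close>

definition A :: "real \<Rightarrow> real" where "A t = grad_inner \<Omega> (u t) (u t)"
definition th :: "real \<Rightarrow> real" where "th t = (Lq_norm \<Omega> 2 (u t))\<^sup>2"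
definition th' :: "real \<Rightarrow> real" where "th' t = 2 * L2_inner \<Omega> (u t) (v t)"
definition V :: "real \<Rightarrow> real" where "V t = (Lq_norm \<Omega> 2 (v t))\<^sup>2"

lemma th_deriv: "t \<in> I \<Longrightarrow> (th has_real_derivative th' t) (at t within I)"
  using L2_inner_deriv[OF du du, of t] L2_inner_commute[of \<Omega> "v t" "u t"]
  unfolding th_def[abs_def] th'_def L2_norm_sq by simp

text \<open>The equation tested with \<open>u t\<close>: \<theta>'' is twice the difference of the
  squared velocity norm and the Nehari functional.\<close>

lemma th'_deriv:
  assumes t: "t \<in> I"
  shows "(th' has_real_derivative 2 * (V t - (a * (A t)\<^sup>2 + b * A t - lam * th t - Q t))) (at t within I)"
proof -
  note L = in_L2[OF t]
  have "w t = (\<lambda>x. R t x + (M t * weak_laplacian \<Omega> (u t) x + lam * u t x))"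
    by (simp add: R_def[abs_def])
  then have "L2_inner \<Omega> (u t) (w t) = Q t + (M t * L2_inner \<Omega> (u t) (weak_laplacian \<Omega> (u t)) + lam * th t)"
    using L unfolding Q_def th_def
    by (simp add: L2_inner_add_right L2_add L2_cmult L2_inner_cmult_right L2_norm_sq)
  also have "L2_inner \<Omega> (u t) (weak_laplacian \<Omega> (u t)) = - A t"
    using grad_inner_laplacian[OF \<Omega>(1) u(2)[OF t] u(1)[OF t]] by (simp add: A_def L2_inner_commute)
  finally have "L2_inner \<Omega> (u t) (w t) = - (a * (A t)\<^sup>2 + b * A t - lam * th t - Q t)"
    by (simp add: A_def power2_eq_square algebra_simps)
  then have "2 * (L2_inner \<Omega> (v t) (v t) + L2_inner \<Omega> (u t) (w t)) = 2 * (V t - (a * (A t)\<^sup>2 + b * A t - lam * th t - Q t))"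
    by (simp add: V_def L2_norm_sq)
  then show ?thesis
    using DERIV_cmult[OF L2_inner_deriv[OF du dv t], of 2] unfolding th'_def[abs_def] by simp
qed

lemma A_continuous: "continuous_on I A"
  unfolding A_def[abs_def] by (rule DERIV_continuous_on[OF grad_deriv])

lemma Q_continuous: "continuous_on I Q"
  by (rule DERIV_continuous_on[OF Q_deriv])

lemma th_continuous: "continuous_on I th"
  by (rule DERIV_continuous_on[OF th_deriv])

lemma energy_conserved:
  assumes "t \<in> I"
  shows "V t / 2 + a / 4 * (A t)\<^sup>2 + b / 2 * A t - lam / 2 * th t - Q t / 4 =
    V 0 / 2 + a / 4 * (A 0)\<^sup>2 + b / 2 * A 0 - lam / 2 * th 0 - Q 0 / 4"
proof -
  define E where "E t = V t / 2 + a / 4 * (A t)\<^sup>2 + b / 2 * A t - lam / 2 * th t - Q t / 4" for t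
  have 0: "0 \<in> I" using T by (simp add: time_interval_def zero_ereal_def)
  have "(E has_real_derivative 0) (at t within I)" if t: "t \<in> I" for t
  proof -
    note L = in_L2[OF t]
    have dV: "(V has_real_derivative 2 * L2_inner \<Omega> (w t) (v t)) (at t within I)"
      using L2_inner_deriv[OF dv dv t] L2_inner_commute[of \<Omega> "w t" "v t"] unfolding V_def[abs_def] L2_norm_sq by simp
    have dA: "(A has_real_derivative - 2 * L2_inner \<Omega> (weak_laplacian \<Omega> (u t)) (v t)) (at t within I)"
      unfolding A_def[abs_def] by (rule grad_deriv[OF t])
    have "w t = (\<lambda>x. R t x + (M t * weak_laplacian \<Omega> (u t) x + lam * u t x))"
      by (simp add: R_def[abs_def])
    \<comment> \<open>These three terms of V'/2 cancel the derivatives of the quartic norm, of both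
      gradient terms together (their factor is \<open>M t\<close>), and of the \<open>lam\<close>
      term.\<close>
    then have eq: "L2_inner \<Omega> (w t) (v t) = L2_inner \<Omega> (R t) (v t) + (M t * L2_inner \<Omega> (weak_laplacian \<Omega> (u t)) (v t) + lam * L2_inner \<Omega> (u t) (v t))"
      using L by (simp add: L2_inner_add_left L2_add L2_cmult L2_inner_cmult_left)
    show ?thesis
      unfolding E_def[abs_def]
      by (rule DERIV_cong[OF DERIV_diff[OF DERIV_diff[OF DERIV_add[OF DERIV_add[OF
          DERIV_cdivide[OF dV] DERIV_cmult[OF DERIV_power[OF dA]]] DERIV_cmult[OF dA]]
          DERIV_cmult[OF th_deriv[OF t]]] DERIV_cdivide[OF Q_deriv[OF t]]]])
        (simp add: eq th'_def A_def[symmetric] field_simps)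
  qed
  then have "E t = E 0"
    using has_field_derivative_zero_constant[OF time_interval_convex, of T E] assms 0 by metis
  then show ?thesis by (simp add: E_def)
qed

lemma th'_sq_le: "t \<in> I \<Longrightarrow> (th' t)\<^sup>2 \<le> 4 * th t * V t"
  using L2_Cauchy_Schwarz_sq[OF in_L2(1,2), of t] by (simp add: th'_def th_def V_def power_mult_distrib)

end

text \<open>\<open>H_space\<close> and the equation assert three derivative curves separately.
  Uniqueness makes them agree almost everywhere, and the flow takes the derivative with values in
  \<open>H10\<close> as \<open>v\<close> and the continuous second derivative as
  \<open>w\<close>.\<close>

lemma kirchhoff_solution_flow:
  fixes \<Omega> :: "'a::euclidean_space set"
  assumes \<Omega>: "open \<Omega>" "bounded \<Omega>" and sol: "kirchhoff_solution \<Omega> a b lam u0 u1 T u"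
  shows "\<exists>v w. kirchhoff_flow \<Omega> a b lam T u v w \<and>
    (AE x in lebesgue_on \<Omega>. u 0 x = u0 x) \<and> (AE x in lebesgue_on \<Omega>. v 0 x = u1 x)"
proof -
  have T: "0 < T" and uH: "u \<in> H_space \<Omega> T" using sol by (auto simp: kirchhoff_solution_def)
  obtain ut utt where ut: "L2_deriv \<Omega> T u ut" "L2_deriv \<Omega> T ut utt"
    and eq: "\<forall>t>0. ereal t < T \<longrightarrow> (AE x in lebesgue_on \<Omega>.
           utt t x - (a * (LINT y|lebesgue_on \<Omega>. (norm (weak_grad \<Omega> (u t) y))\<^sup>2) + b) * weak_laplacian \<Omega> (u t) x
             = lam * u t x + \<bar>u t x\<bar>\<^sup>2 * u t x)"
    and init: "AE x in lebesgue_on \<Omega>. u 0 x = u0 x" "AE x in lebesgue_on \<Omega>. ut 0 x = u1 x"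
    using sol unfolding kirchhoff_solution_def by (elim conjE exE) (rule that; assumption)
  have ck0: "time_continuous (H10 \<Omega> \<inter> H2 \<Omega>) (H2_norm \<Omega>) T u"
    and ck1: "\<exists>v. has_time_deriv (H10 \<Omega>) (H1_norm \<Omega>) T u v"
    and ck2: "\<exists>u' w. L2_deriv \<Omega> T u u' \<and> L2_deriv \<Omega> T u' w \<and> time_continuous (L2 \<Omega>) (Lq_norm \<Omega> 2) T w"
    using uH by (auto simp: H_space_def numeral_2_eq_2)
  obtain v where v: "has_time_deriv (H10 \<Omega>) (H1_norm \<Omega>) T u v" using ck1 by (elim exE)
  obtain u' w where w: "L2_deriv \<Omega> T u u'" "L2_deriv \<Omega> T u' w" "time_continuous (L2 \<Omega>) (Lq_norm \<Omega> 2) T w"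
    using ck2 by (elim exE conjE)
  note V = has_time_deriv_H10_imp[OF \<Omega>(1) v]
  have vu': "AE x in lebesgue_on \<Omega>. v t x = u' t x" "AE x in lebesgue_on \<Omega>. v t x = ut t x" if "t \<in> time_interval T" for t
    using L2_deriv_unique[OF V(1) w(1) _ that] L2_deriv_unique[OF V(1) ut(1) _ that] by simp_all
  have vL: "v t \<in> L2 \<Omega>" if "t \<in> time_interval T" for t using V(1) that by (auto simp: has_time_deriv_def)
  have dv: "L2_deriv \<Omega> T v w" by (rule L2_deriv_cong_AE[OF w(2) vL vu'(1)])
  have dv': "L2_deriv \<Omega> T v utt" by (rule L2_deriv_cong_AE[OF ut(2) vL vu'(2)])
  have ww: "AE x in lebesgue_on \<Omega>. w t x = utt t x" if "t \<in> time_interval T" for t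
    using L2_deriv_unique[OF dv dv' _ that] by simp
  have uin: "u t \<in> H10 \<Omega>" "u t \<in> H2 \<Omega>" if "t \<in> time_interval T" for t
    using ck0 that by (auto simp: time_continuous_def)
  have "kirchhoff_flow \<Omega> a b lam T u v w"
  proof
    show "v t \<in> H10 \<Omega>" if "t \<in> time_interval T" for t using v that by (auto simp: has_time_deriv_def)
    show "((\<lambda>s. Lq_norm \<Omega> 2 (\<lambda>x. w s x - w t x)) \<longlongrightarrow> 0) (at t within time_interval T)" if "t \<in> time_interval T" for t
      using w(3) that by (auto simp: time_continuous_def)
    show "((\<lambda>s. Lq_norm \<Omega> 2 (\<lambda>x. weak_laplacian \<Omega> (u s) x - weak_laplacian \<Omega> (u t) x)) \<longlongrightarrow> 0) (at t within time_interval T)"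
      if t: "t \<in> time_interval T" for t
    proof (rule Lim_null_comparison)
      show "\<forall>\<^sub>F s in at t within time_interval T. norm (Lq_norm \<Omega> 2 (\<lambda>x. weak_laplacian \<Omega> (u s) x - weak_laplacian \<Omega> (u t) x)) \<le>
          real DIM('a) * H2_norm \<Omega> (\<lambda>x. u s x - u t x)"
        using eventually_time_interval
      proof eventually_elim
        case (elim s)
        then show ?case
          using weak_laplacian_diff_le_H2_norm[OF \<Omega>(1) uin(2) uin(2)[OF t], of s] by (simp add: L2_norm_nonneg)
      qed
      have "((\<lambda>s. H2_norm \<Omega> (\<lambda>x. u s x - u t x)) \<longlongrightarrow> 0) (at t within time_interval T)"
        using ck0 t by (auto simp: time_continuous_def)
      from tendsto_mult[OF tendsto_const this]
      show "((\<lambda>s. real DIM('a) * H2_norm \<Omega> (\<lambda>x. u s x - u t x)) \<longlongrightarrow> 0) (at t within time_interval T)" by simp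
    qed
    fix t assume t: "0 < t" "ereal t < T"
    then have tI: "t \<in> time_interval T" by (simp add: time_interval_def)
    have G: "(LINT y|lebesgue_on \<Omega>. (norm (weak_grad \<Omega> (u t) y))\<^sup>2) = grad_inner \<Omega> (u t) (u t)"
      using grad_inner_eq[OF \<Omega>(1) H10_subset_H1[OF uin(1)[OF tI]] H10_subset_H1[OF uin(1)[OF tI]]]
      by (simp add: power2_norm_eq_inner)
    have "AE x in lebesgue_on \<Omega>. utt t x - (a * grad_inner \<Omega> (u t) (u t) + b) * weak_laplacian \<Omega> (u t) x
             = lam * u t x + \<bar>u t x\<bar>\<^sup>2 * u t x"
      using eq[rule_format, OF t] unfolding G .
    with ww[OF tI] show "AE x in lebesgue_on \<Omega>.
      w t x - (a * grad_inner \<Omega> (u t) (u t) + b) * weak_laplacian \<Omega> (u t) x = lam * u t x + u t x ^ 3"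
      by eventually_elim (simp add: power2_eq_square power3_eq_cube)
  qed (use \<Omega> T uin V dv in auto)
  moreover have "0 \<in> time_interval T" using T by (simp add: time_interval_def zero_ereal_def)
  then have "AE x in lebesgue_on \<Omega>. v 0 x = u1 x"
    using vu'(2)[of 0] init(2) by (auto elim: eventually_elim2)
  ultimately show ?thesis using init(1) by blast
qed

section \<open>The concavity argument\<close>

lemma nondecreasing_of_deriv:
  fixes f f' :: "real \<Rightarrow> real"
  assumes d: "\<And>t. 0 < t \<Longrightarrow> (f has_real_derivative f' t) (at t)" and c: "continuous_on {0..} f"
    and "0 \<le> s" "s \<le> t" "\<And>x. s < x \<Longrightarrow> x < t \<Longrightarrow> 0 \<le> f' x"
  shows "f s \<le> f t"
proof (rule DERIV_nonneg_imp_increasing_open[OF assms(4)])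
  fix x assume "s < x" "x < t"
  then show "\<exists>y. DERIV f x :> y \<and> 0 \<le> y" using d[of x] assms(3,5) by auto
next
  show "continuous_on {s..t} f" using c assms(3) by (auto elim: continuous_on_subset)
qed

text \<open>For \<open>y = f^(-1/2)\<close> one has \<open>y' = - z / 2\<close> with
  \<open>z = f' f^(-3/2)\<close>, and the hypothesis says exactly that \<open>z\<close> is
  nondecreasing. So the positive \<open>y\<close> stays below a line of negative slope, which is
  absurd.\<close>

lemma concavity_contradiction:
  fixes f f' f'' :: "real \<Rightarrow> real"
  assumes t0: "0 < t0"
    and d1: "\<And>t. 0 < t \<Longrightarrow> (f has_real_derivative f' t) (at t)"
    and d2: "\<And>t. 0 < t \<Longrightarrow> (f' has_real_derivative f'' t) (at t)"
    and pos: "\<And>t. t0 \<le> t \<Longrightarrow> 0 < f t" "0 < f' t0"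
    and conc: "\<And>t. t0 \<le> t \<Longrightarrow> 3 / 2 * (f' t)\<^sup>2 \<le> f t * f'' t"
  shows False
proof -
  define y where "y t = f t powr (- (1/2))" for t
  define z where "z t = f' t * f t powr (- (3/2))" for t
  have dy: "(y has_real_derivative - (1/2) * z t) (at t)" if "t0 \<le> t" for t
  proof -
    have "((\<lambda>t. f t powr (- (1/2))) has_real_derivative - (1/2) * f t powr (- (1/2) - of_nat 1) * f' t) (at t)"
      using that t0 by (intro DERIV_fun_powr d1 pos(1)) auto
    then show ?thesis by (simp add: y_def[abs_def] z_def mult_ac)
  qed
  have dz: "(z has_real_derivative f t powr (- (5/2)) * (f t * f'' t - 3 / 2 * (f' t)\<^sup>2)) (at t)" if t: "t0 \<le> t" for t
  proof -
    have "((\<lambda>t. f t powr (- (3/2))) has_real_derivative - (3/2) * f t powr (- (3/2) - of_nat 1) * f' t) (at t)"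
      using t t0 by (intro DERIV_fun_powr d1 pos(1)) auto
    from DERIV_mult[OF d2 this] t t0
    have "(z has_real_derivative f'' t * f t powr (- (3/2)) + - (3/2) * f t powr (- (3/2) - of_nat 1) * f' t * f' t) (at t)"
      by (simp add: z_def[abs_def])
    moreover have "f t powr (- (3/2)) = f t * f t powr (- (5/2))"
      using pos(1)[OF t] powr_add[of "f t" 1 "- (5/2)"] by simp
    ultimately show ?thesis by (simp add: power2_eq_square algebra_simps)
  qed
  have zt: "z t0 \<le> z t" if "t0 \<le> t" for t
  proof (rule DERIV_nonneg_imp_nondecreasing[OF that])
    fix x assume x: "t0 \<le> x" "x \<le> t"
    show "\<exists>y. DERIV z x :> y \<and> 0 \<le> y"
      using dz[OF x(1)] conc[OF x(1)] by (meson diff_ge_0_iff_ge powr_ge_zero mult_nonneg_nonneg)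
  qed
  have z0: "0 < z t0" using pos(1)[of t0] pos(2) by (simp add: z_def)
  have y_le: "y t + z t0 / 2 * t \<le> y t0 + z t0 / 2 * t0" if "t0 \<le> t" for t
  proof (rule DERIV_nonpos_imp_nonincreasing[OF that, of "\<lambda>t. y t + z t0 / 2 * t"])
    fix x assume x: "t0 \<le> x" "x \<le> t"
    have "((\<lambda>t. y t + z t0 / 2 * t) has_real_derivative - (1/2) * z x + z t0 / 2) (at x)"
      using DERIV_add[OF dy[OF x(1)] DERIV_cmult_Id[of "z t0 / 2"]] by simp
    then show "\<exists>d. DERIV (\<lambda>t. y t + z t0 / 2 * t) x :> d \<and> d \<le> 0"
      using zt[OF x(1)] by (intro exI[of _ "- (1/2) * z x + z t0 / 2"] conjI) simp_all
  qed
  \<comment> \<open>The zero of that line, the tangent of \<open>y\<close> at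
    \<open>t0\<close>.\<close>
  define t where "t = t0 + 2 * y t0 / z t0"
  have y0: "0 < y t0" using pos(1)[of t0] by (simp add: y_def)
  have tt: "t0 \<le> t" using y0 z0 by (simp add: t_def)
  have "z t0 / 2 * t = z t0 / 2 * t0 + y t0" using z0 by (simp add: t_def field_simps)
  with y_le[OF tt] have "y t \<le> 0" by linarith
  moreover have "0 < y t" using pos(1)[OF tt] by (simp add: y_def)
  ultimately show False by simp
qed

text \<open>\<open>f (6 V) = 3/2 (4 f V)\<close> dominates \<open>3/2 f'^2\<close>, the premise of
  the concavity argument. Since \<open>f'' \<ge> 0\<close>, positivity of \<open>f'\<close> persists
  once reached; \<open>start\<close> guarantees that it is reached.\<close>

lemma no_global_growth:
  fixes f f' f'' V :: "real \<Rightarrow> real"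
  assumes d1: "\<And>t. 0 < t \<Longrightarrow> (f has_real_derivative f' t) (at t)"
    and d2: "\<And>t. 0 < t \<Longrightarrow> (f' has_real_derivative f'' t) (at t)"
    and c: "continuous_on {0..} f" "continuous_on {0..} f'"
    and f0: "\<And>t. 0 \<le> t \<Longrightarrow> 0 \<le> f t" and V0: "\<And>t. 0 \<le> t \<Longrightarrow> 0 \<le> V t"
    and CS: "\<And>t. 0 \<le> t \<Longrightarrow> (f' t)\<^sup>2 \<le> 4 * f t * V t"
    and f'': "\<And>t. 0 < t \<Longrightarrow> 6 * V t \<le> f'' t"
    and start: "(\<exists>\<delta>>0. \<forall>t>0. \<delta> \<le> f'' t) \<or> 0 < f' 0"
  shows False
proof -
  have mono: "f' s \<le> f' t" if "0 \<le> s" "s \<le> t" for s t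
  proof (rule nondecreasing_of_deriv[OF d2 c(2) that])
    show "0 \<le> f'' x" if "s < x" for x using f''[of x] V0[of x] that \<open>0 \<le> s\<close> by linarith
  qed
  have "\<exists>s\<ge>0. 0 < f' s"
    using start
  proof
    assume "\<exists>\<delta>>0. \<forall>t>0. \<delta> \<le> f'' t"
    then obtain \<delta> where \<delta>: "0 < \<delta>" "\<And>t. 0 < t \<Longrightarrow> \<delta> \<le> f'' t" by blast
    \<comment> \<open>Growing at rate at least \<delta>, \<open>f'\<close> has increased by at least
      \<open>|f' 0| + 1\<close> by this time and is positive.\<close>
    define t where "t = (\<bar>f' 0\<bar> + 1) / \<delta>"
    have t: "0 \<le> t" using \<delta>(1) by (simp add: t_def)
    have "f' 0 - \<delta> * 0 \<le> f' t - \<delta> * t"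
    proof (rule nondecreasing_of_deriv[where f = "\<lambda>t. f' t - \<delta> * t" and f' = "\<lambda>t. f'' t - \<delta>"])
      show "((\<lambda>t. f' t - \<delta> * t) has_real_derivative f'' x - \<delta>) (at x)" if "0 < x" for x
        using DERIV_diff[OF d2[OF that] DERIV_cmult_Id[of \<delta>]] by simp
      show "continuous_on {0..} (\<lambda>t. f' t - \<delta> * t)" by (intro continuous_intros c)
    qed (use t \<delta>(2) in auto)
    moreover have "\<delta> * t = \<bar>f' 0\<bar> + 1" using \<delta>(1) by (simp add: t_def)
    ultimately have "0 < f' t" by linarith
    with t show ?thesis by blast
  qed auto
  then obtain s where s: "0 \<le> s" "0 < f' s" by blast
  \<comment> \<open>At time \<open>s\<close> the function \<open>f\<close> may still vanish;
    strictly later it is positive, because it increases strictly from a nonnegative value.\<close>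
  define t0 where "t0 = s + 1"
  have f'pos: "0 < f' t" if "s \<le> t" for t using mono[OF s(1) that] s(2) by linarith
  have fpos: "0 < f t" if "t0 \<le> t" for t
  proof -
    have "f s < f t"
    proof (rule DERIV_pos_imp_increasing_open[where f = f])
      show "s < t" using that by (simp add: t0_def)
      show "\<exists>y. DERIV f x :> y \<and> 0 < y" if "s < x" for x
        using d1[of x] f'pos[of x] that s(1) by auto
      show "continuous_on {s..t} f" using c(1) s(1) by (auto elim: continuous_on_subset)
    qed
    then show ?thesis using f0[OF s(1)] by linarith
  qed
  show False
  proof (rule concavity_contradiction[OF _ d1 d2 fpos])
    show t0: "0 < t0" using s(1) by (simp add: t0_def)
    show "0 < f' t0" using f'pos by (simp add: t0_def)
    fix t assume t: "t0 \<le> t"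
    have "3 / 2 * (f' t)\<^sup>2 \<le> f t * (6 * V t)" using CS[of t] t t0 by (simp add: mult_ac)
    also have "\<dots> \<le> f t * f'' t" using f''[of t] fpos[OF t] t t0 by (intro mult_left_mono) auto
    finally show "3 / 2 * (f' t)\<^sup>2 \<le> f t * f'' t" .
  qed
qed

text \<open>The set of times in \<open>[0, s]\<close> where \<open>g\<close> is nonnegative is
  compact, so it has a least element; continuity from the left gives the value 0 there.\<close>

lemma first_time:
  fixes g :: "real \<Rightarrow> real"
  assumes "continuous_on {0..} g" "g 0 < 0" "0 \<le> s" "0 \<le> g s"
  obtains r where "0 < r" "g r = 0" "\<And>t. 0 \<le> t \<Longrightarrow> t < r \<Longrightarrow> g t < 0"
proof -
  let ?Z = "{t \<in> {0..s}. 0 \<le> g t}"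
  have c: "continuous_on {0..s} g" using assms(1) by (auto elim: continuous_on_subset)
  have "closed ?Z"
    using continuous_closed_preimage[OF c closed_atLeastAtMost closed_atLeast[of 0]] by (simp add: vimage_def Int_def)
  then have "compact ?Z" using compact_Int_closed[OF compact_Icc[of 0 s], of ?Z] by (simp add: Int_absorb1 Collect_conj_eq subset_iff Int_commute)
  moreover have "?Z \<noteq> {}" using assms(3,4) by auto
  ultimately obtain r where r: "r \<in> ?Z" "\<And>t. t \<in> ?Z \<Longrightarrow> r \<le> t"
    using compact_attains_inf[of ?Z] by blast
  have neg: "g t < 0" if "0 \<le> t" "t < r" for t
    using r(1) r(2)[of t] that by (auto simp: not_le[symmetric])
  have r0: "0 < r" using r(1) assms(2) by (cases "r = 0") auto
  have "g r \<le> 0"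
  proof (rule continuous_le_on_closure[where f = g and x = r and S = "{0..<r}"])
    show "continuous_on (closure {0..<r}) g" using r0 assms(1) by (auto elim: continuous_on_subset)
    show "r \<in> closure {0..<r}" using r0 by simp
    show "g x \<le> 0" if "x \<in> {0..<r}" for x using neg[of x] that by simp
  qed
  then show thesis using r(1) r0 neg by (intro that[of r]) auto
qed

text \<open>A bootstrap: as long as \<open>f' > 0\<close>, \<open>f\<close> stays above
  \<open>f 0 > m\<close>, so \<open>f'' \<ge> 0\<close> and \<open>f'\<close> has not dropped below
  \<open>f' 0\<close>. Hence there is no first time at which \<open>f'\<close> vanishes.\<close>

lemma growth_above_threshold:
  fixes f f' f'' :: "real \<Rightarrow> real"
  assumes d1: "\<And>t. 0 < t \<Longrightarrow> (f has_real_derivative f' t) (at t)"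
    and d2: "\<And>t. 0 < t \<Longrightarrow> (f' has_real_derivative f'' t) (at t)"
    and c: "continuous_on {0..} f" "continuous_on {0..} f'"
    and f'': "\<And>t. 0 < t \<Longrightarrow> k * (f t - m) \<le> f'' t" and "0 < k" "m < f 0" "0 < f' 0" "0 \<le> t"
  shows "f 0 \<le> f t"
proof -
  have "0 < f' s" if s: "0 \<le> s" for s
  proof (rule ccontr)
    assume "\<not> 0 < f' s"
    then obtain r where r: "0 < r" "- f' r = 0" "\<And>t. 0 \<le> t \<Longrightarrow> t < r \<Longrightarrow> - f' t < 0"
      using first_time[of "\<lambda>t. - f' t" s] c(2) assms(8) s by (auto intro!: continuous_on_minus)
    have "f' 0 \<le> f' r"
    proof (rule nondecreasing_of_deriv[OF d2 c(2)])
      fix x assume x: "0 < x" "x < r"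
      have "f 0 \<le> f x"
        by (rule nondecreasing_of_deriv[OF d1 c(1)]) (use x r(3) in \<open>auto intro: less_imp_le\<close>)
      then have "0 \<le> k * (f x - m)" using assms(6,7) by simp
      with f''[OF x(1)] show "0 \<le> f'' x" by linarith
    qed (use r in auto)
    with r(2) assms(8) show False by simp
  qed
  then show ?thesis
    by (intro nondecreasing_of_deriv[OF d1 c(1)]) (use assms(9) in \<open>auto intro: less_imp_le\<close>)
qed

section \<open>The potential well\<close>

lemma grad_norm_power4:
  assumes "open \<Omega>" "f \<in> H1 \<Omega>"
  shows "Lq_norm \<Omega> 2 (weak_grad \<Omega> f) ^ 4 = (grad_inner \<Omega> f f)\<^sup>2"
  using grad_norm_sq[OF assms] by (metis numeral_times_numeral power_mult semiring_norm(11) semiring_norm(13))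

lemma grad_inner_cmult:
  assumes "open \<Omega>" "f \<in> H1 \<Omega>"
  shows "grad_inner \<Omega> (\<lambda>x. c * f x) (\<lambda>x. c * f x) = c\<^sup>2 * grad_inner \<Omega> f f"
  using grad_inner_lincomb_sq[OF assms assms(2), of c 0] by simp

lemma Lq_norm4_cmult:
  fixes f :: "'a::euclidean_space \<Rightarrow> real"
  shows "Lq_norm \<Omega> 4 (\<lambda>x. c * f x) = \<bar>c\<bar> * Lq_norm \<Omega> 4 f"
  using Lq_norm_cmult[of 4 \<Omega> c f] by simp

lemma zero_on_norms:
  assumes "open \<Omega>" "f \<in> H1 \<Omega>" "zero_on \<Omega> f"
  shows "Lq_norm \<Omega> 2 f = 0" "Lq_norm \<Omega> 4 f = 0" "grad_inner \<Omega> f f = 0"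
proof -
  have ae: "AE x in lebesgue_on \<Omega>. f x = 0 * f x + 0 * f x" using assms(3) by (simp add: zero_on_def)
  have m: "f \<in> borel_measurable (lebesgue_on \<Omega>)" by (rule L2_measurable[OF H1_subset_L2[OF assms(2)]])
  have "Lq_norm \<Omega> q f = Lq_norm \<Omega> q (\<lambda>x. 0::real)" for q
    using assms(3) m by (intro Lq_norm_cong_AE) (simp_all add: zero_on_def)
  moreover have "Lq_norm \<Omega> q (\<lambda>x. 0::real) = 0" if "q > 0" for q
    using that by (simp add: Lq_norm_def)
  ultimately show "Lq_norm \<Omega> 2 f = 0" "Lq_norm \<Omega> 4 f = 0" by simp_all
  show "grad_inner \<Omega> f f = 0"
    using grad_inner_cong_AE[OF assms(1) H1_lincomb(1)[OF assms(1,2,2)] H1_lincomb(1)[OF assms(1,2,2)] ae ae]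
      grad_inner_lincomb_sq[OF assms(1,2,2), of 0 0] by simp
qed

text \<open>Homogeneity of degree 4: a function with nonzero \<open>L4\<close> norm is scaled to
  norm 1, where the infimum applies.\<close>

lemma Sobolev_Lambda_ineq:
  assumes "open \<Omega>" "v \<in> H10 \<Omega>"
  shows "Sobolev_Lambda \<Omega> * Lq_norm \<Omega> 4 v ^ 4 \<le> (grad_inner \<Omega> v v)\<^sup>2"
proof (cases "Lq_norm \<Omega> 4 v = 0")
  case True
  then show ?thesis by simp
next
  case False
  then have n: "Lq_norm \<Omega> 4 v > 0" using Lq_norm_nonneg[of 4 \<Omega> v] by simp
  let ?c = "1 / Lq_norm \<Omega> 4 v"
  note vH = H10_subset_H1[OF assms(2)]
  have c: "(\<lambda>x. ?c * v x) \<in> H10 \<Omega>" by (rule H10_cmult[OF assms])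
  have "Lq_norm \<Omega> 4 (\<lambda>x. ?c * v x) = 1" using n by (simp only: Lq_norm4_cmult) simp
  with c have "Sobolev_Lambda \<Omega> \<le> Lq_norm \<Omega> 2 (weak_grad \<Omega> (\<lambda>x. ?c * v x)) ^ 4"
    unfolding Sobolev_Lambda_def by (intro cInf_lower) (auto intro!: bdd_belowI[of _ 0])
  also have "\<dots> = (?c\<^sup>2 * grad_inner \<Omega> v v)\<^sup>2"
    by (simp only: grad_norm_power4[OF assms(1) H10_subset_H1[OF c]] grad_inner_cmult[OF assms(1) vH])
  also have "\<dots> = (grad_inner \<Omega> v v)\<^sup>2 / Lq_norm \<Omega> 4 v ^ 4"
    by (simp add: power_divide power_mult_distrib power_mult[symmetric])
  finally show ?thesis using n by (simp add: field_simps)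
qed

lemma kirchhoff_I_eq:
  assumes "open \<Omega>" "v \<in> H1 \<Omega>"
  shows "kirchhoff_I \<Omega> a b lam v =
    a * (grad_inner \<Omega> v v)\<^sup>2 + b * grad_inner \<Omega> v v - lam * (Lq_norm \<Omega> 2 v)\<^sup>2 - Lq_norm \<Omega> 4 v ^ 4"
  by (simp add: kirchhoff_I_def grad_norm_power4[OF assms] grad_norm_sq[OF assms])

lemma kirchhoff_J_eq:
  assumes "open \<Omega>" "v \<in> H1 \<Omega>"
  shows "kirchhoff_J \<Omega> a b lam v =
    a / 4 * (grad_inner \<Omega> v v)\<^sup>2 + b / 2 * grad_inner \<Omega> v v - lam / 2 * (Lq_norm \<Omega> 2 v)\<^sup>2 - Lq_norm \<Omega> 4 v ^ 4 / 4"
  by (simp add: kirchhoff_J_def grad_norm_power4[OF assms] grad_norm_sq[OF assms])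

locale potential_well =
  fixes \<Omega> :: "'a::euclidean_space set" and a b lam :: real
  assumes \<Omega>: "open \<Omega>" "bounded \<Omega>" and b: "0 < b" and a: "0 < a" "a < 1 / Sobolev_Lambda \<Omega>"
    and lam: "lam < b * principal_eigenvalue \<Omega>"
    and ne: "N3 \<Omega> a b lam \<union> N3_minus \<Omega> a b lam \<noteq> {}"
begin

abbreviation "L \<equiv> Sobolev_Lambda \<Omega>"
abbreviation "\<mu> \<equiv> principal_eigenvalue \<Omega>"
abbreviation "\<beta> \<equiv> b0 \<Omega> b lam"

lemma L_pos: "0 < L" and aL: "a * L < 1"
proof -
  have "0 < 1 / L" using a by linarith
  then show L: "0 < L" by simp
  then show "a * L < 1" using a(2) by (simp add: field_simps)
qed

text \<open>The functional I vanishes at 0, so the strict inequality in \<open>N3_minus\<close>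
  excludes the zero function, just as \<open>N3\<close> does by definition. This is the premise of
  \<open>principal_eigenvalue_Poincare\<close>.\<close>

lemma exists_nonzero: "\<exists>v\<in>H10 \<Omega>. \<not> zero_on \<Omega> v"
proof -
  obtain v where "v \<in> N3 \<Omega> a b lam \<union> N3_minus \<Omega> a b lam" using ne by blast
  moreover have "\<not> zero_on \<Omega> v" if "v \<in> N3_minus \<Omega> a b lam"
  proof
    assume z: "zero_on \<Omega> v"
    have v: "v \<in> H1 \<Omega>" using that by (simp add: N3_minus_def H10_subset_H1)
    show False using that zero_on_norms[OF \<Omega>(1) v z] by (simp add: N3_minus_def kirchhoff_I_eq[OF \<Omega>(1) v])
  qed
  ultimately show ?thesis by (auto simp: N3_def N3_minus_def)
qed

lemma \<mu>_pos: "0 < \<mu>"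
  using exists_nonzero principal_eigenvalue_Poincare(1)[OF \<Omega>] by blast

lemma Poincare: "v \<in> H10 \<Omega> \<Longrightarrow> \<mu> * (Lq_norm \<Omega> 2 v)\<^sup>2 \<le> grad_inner \<Omega> v v"
  using exists_nonzero principal_eigenvalue_Poincare(2)[OF \<Omega>] by blast

lemma \<beta>_pos: "0 < \<beta>"
  using \<mu>_pos lam b by (simp add: b0_def field_simps)

text \<open>The origin of \<open>b0\<close>: for \<open>lam \<ge> 0\<close> Poincare's inequality
  pays for the \<open>lam\<close> term with part of the gradient term; for \<open>lam < 0\<close>
  that term helps and is dropped.\<close>

lemma quadratic_lower:
  assumes "v \<in> H10 \<Omega>"
  shows "\<beta> * grad_inner \<Omega> v v \<le> b * grad_inner \<Omega> v v - lam * (Lq_norm \<Omega> 2 v)\<^sup>2"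
proof (cases "0 \<le> lam")
  case True
  have "lam / \<mu> * (\<mu> * (Lq_norm \<Omega> 2 v)\<^sup>2) \<le> lam / \<mu> * grad_inner \<Omega> v v"
    using True \<mu>_pos by (intro mult_left_mono Poincare assms) simp
  then show ?thesis using True \<mu>_pos by (simp add: b0_def left_diff_distrib)
next
  case False
  then have "0 \<le> - lam * (Lq_norm \<Omega> 2 v)\<^sup>2" by (intro mult_nonneg_nonneg) auto
  with False show ?thesis by (simp add: b0_def)
qed

text \<open>A negative I gives \<open>a A^2 + \<beta> A < |v|_4^4 \<le> A^2 / L\<close> for
  \<open>A = |grad v|^2\<close>. The second bound is uniform, so it survives limits and keeps the
  Nehari region away from 0.\<close>

lemma N3_minus_grad_lower:
  assumes "v \<in> H10 \<Omega>" "kirchhoff_I \<Omega> a b lam v < 0"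
  shows "0 < grad_inner \<Omega> v v" "\<beta> * L / (1 - a * L) \<le> grad_inner \<Omega> v v"
proof -
  let ?A = "grad_inner \<Omega> v v"
  note vH = H10_subset_H1[OF assms(1)]
  have "a * ?A\<^sup>2 + \<beta> * ?A < Lq_norm \<Omega> 4 v ^ 4"
    using assms(2) quadratic_lower[OF assms(1)] by (simp add: kirchhoff_I_eq[OF \<Omega>(1) vH])
  then have "L * (a * ?A\<^sup>2 + \<beta> * ?A) < L * Lq_norm \<Omega> 4 v ^ 4"
    using L_pos by (intro mult_strict_left_mono)
  also have "\<dots> \<le> ?A\<^sup>2" by (rule Sobolev_Lambda_ineq[OF \<Omega>(1) assms(1)])
  finally have *: "?A * (\<beta> * L) < ?A * ((1 - a * L) * ?A)" by (simp add: power2_eq_square algebra_simps)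
  show A: "0 < ?A" using * grad_inner_nonneg[of \<Omega> v] by (cases "?A = 0") auto
  with * show "\<beta> * L / (1 - a * L) \<le> ?A" using aL by (simp add: pos_divide_le_eq mult.commute)
qed

text \<open>The multiple \<open>s v\<close> with \<open>s\<^sup>2 = B / (\<parallel>v\<parallel>\<^sub>4\<^sup>4 - a A\<^sup>2) < 1\<close> lies on the Nehari manifold, where \<open>J = s\<^sup>2 B / 4\<close>.\<close>

lemma N3_minus_d3_le:
  assumes "v \<in> H10 \<Omega>" "kirchhoff_I \<Omega> a b lam v < 0"
  shows "d3 \<Omega> a b lam \<le> ereal ((b * grad_inner \<Omega> v v - lam * (Lq_norm \<Omega> 2 v)\<^sup>2) / 4)"
proof -
  define A where "A = grad_inner \<Omega> v v"
  define B where "B = b * A - lam * (Lq_norm \<Omega> 2 v)\<^sup>2"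
  define D where "D = Lq_norm \<Omega> 4 v ^ 4 - a * A\<^sup>2"
  note vH = H10_subset_H1[OF assms(1)]
  have A0: "0 < A" unfolding A_def by (rule N3_minus_grad_lower(1)[OF assms])
  have B0: "0 < B"
    using quadratic_lower[OF assms(1)] mult_pos_pos[OF \<beta>_pos A0] by (simp add: A_def B_def)
  have BD: "B < D" using assms(2) by (simp add: kirchhoff_I_eq[OF \<Omega>(1) vH] A_def B_def D_def)
  define s where "s = sqrt (B / D)"
  have s2: "s\<^sup>2 = B / D" using B0 BD by (simp add: s_def)
  have s0: "s \<noteq> 0" using B0 BD by (simp add: s_def)
  let ?w = "\<lambda>x. s * v x"
  have w: "?w \<in> H10 \<Omega>" by (rule H10_cmult[OF \<Omega>(1) assms(1)])
  note wH = H10_subset_H1[OF w]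
  have e: "grad_inner \<Omega> ?w ?w = s\<^sup>2 * A" "(Lq_norm \<Omega> 2 ?w)\<^sup>2 = s\<^sup>2 * (Lq_norm \<Omega> 2 v)\<^sup>2"
    "Lq_norm \<Omega> 4 ?w ^ 4 = (s\<^sup>2)\<^sup>2 * Lq_norm \<Omega> 4 v ^ 4"
    by (simp_all add: A_def grad_inner_cmult[OF \<Omega>(1) vH] L2_norm_cmult_sq Lq_norm4_cmult power_mult_distrib power_mult[symmetric])
  have "kirchhoff_I \<Omega> a b lam ?w = s\<^sup>2 * (B - s\<^sup>2 * D)"
    unfolding kirchhoff_I_eq[OF \<Omega>(1) wH] e B_def D_def by (simp add: power2_eq_square algebra_simps)
  also have "s\<^sup>2 * D = B" using B0 BD by (simp add: s2)
  finally have I0: "kirchhoff_I \<Omega> a b lam ?w = 0" by simp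
  have "\<not> zero_on \<Omega> ?w"
    using zero_on_norms(3)[OF \<Omega>(1) wH] A0 s0 by (auto simp: e)
  with w I0 have "?w \<in> N3 \<Omega> a b lam" by (simp add: N3_def)
  then have "d3 \<Omega> a b lam \<le> ereal (kirchhoff_J \<Omega> a b lam ?w)" unfolding d3_def by (rule INF_lower)
  also have "kirchhoff_J \<Omega> a b lam ?w = s\<^sup>2 * (B / 2 - s\<^sup>2 * D / 4)"
    unfolding kirchhoff_J_eq[OF \<Omega>(1) wH] e B_def D_def by (simp add: power2_eq_square field_simps)
  also have "\<dots> = s\<^sup>2 * (B / 4)" using B0 BD by (simp add: s2)
  also have "ereal (s\<^sup>2 * (B / 4)) \<le> ereal (1 * (B / 4))"
  proof (unfold ereal_less_eq, rule mult_right_mono)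
    show "s\<^sup>2 \<le> 1" using B0 BD by (simp add: s2)
  qed (use B0 in simp)
  finally show ?thesis by (simp add: B_def A_def)
qed

end

section \<open>The flow with its initial data in the potential well\<close>

locale kirchhoff_evolution = potential_well \<Omega> a b lam + kirchhoff_flow \<Omega> a b lam T u v w
  for \<Omega> :: "'a::euclidean_space set" and a b lam T u v w +
  fixes u0 u1 :: "'a \<Rightarrow> real"
  assumes u0: "u0 \<in> H10 \<Omega>" and u1: "u1 \<in> H10 \<Omega>"
    and init: "AE x in lebesgue_on \<Omega>. u 0 x = u0 x" "AE x in lebesgue_on \<Omega>. v 0 x = u1 x"
begin

abbreviation "E0 \<equiv> initial_energy \<Omega> a b lam u0 u1"

text \<open>\<open>N t\<close> is I(u(t)) and \<open>B t\<close> its quadratic part, the quantity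
  compared with \<open>4 E0\<close> in every case.\<close>

definition B :: "real \<Rightarrow> real" where "B t = b * A t - lam * th t"
definition N :: "real \<Rightarrow> real" where "N t = a * (A t)\<^sup>2 + B t - Q t"

lemma zero_in: "0 \<in> I"
  using T by (simp add: time_interval_def zero_ereal_def)

lemma initial_values:
  "grad_inner \<Omega> u0 u0 = A 0" "(Lq_norm \<Omega> 2 u0)\<^sup>2 = th 0" "Lq_norm \<Omega> 4 u0 ^ 4 = Q 0" "(Lq_norm \<Omega> 2 u1)\<^sup>2 = V 0"
  "(LINT x|lebesgue_on \<Omega>. u0 x * u1 x) = th' 0 / 2"
proof -
  note L = in_L2[OF zero_in] and H = H10_subset_H1[OF u0] H10_subset_H1[OF u1]
  note m = L2_measurable[OF L(1)] L2_measurable[OF L(2)] L2_measurable[OF H1_subset_L2[OF H(1)]] L2_measurable[OF H1_subset_L2[OF H(2)]]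
  show "grad_inner \<Omega> u0 u0 = A 0"
    unfolding A_def by (rule grad_inner_cong_AE[OF \<Omega>(1) H(1,1) init(1,1), symmetric])
  show "(Lq_norm \<Omega> 2 u0)\<^sup>2 = th 0"
    unfolding th_def using Lq_norm_cong_AE[OF init(1) m(1,3)] by simp
  show "(Lq_norm \<Omega> 2 u1)\<^sup>2 = V 0"
    unfolding V_def using Lq_norm_cong_AE[OF init(2) m(2,4)] by simp
  show "Lq_norm \<Omega> 4 u0 ^ 4 = Q 0"
    using Lq_norm_cong_AE[OF init(1) m(1,3)] Q_eq(3)[OF zero_in] by simp
  show "(LINT x|lebesgue_on \<Omega>. u0 x * u1 x) = th' 0 / 2"
    unfolding th'_def using L2_inner_cong_AE[OF init L(1) H1_subset_L2[OF H(1)] L(2) H1_subset_L2[OF H(2)]]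
    by (simp add: L2_inner_def)
qed

lemma energy:
  assumes "t \<in> I"
  shows "V t / 2 + a / 4 * (A t)\<^sup>2 + B t / 2 - Q t / 4 = E0"
proof -
  have "E0 = V 0 / 2 + a / 4 * (A 0)\<^sup>2 + b / 2 * A 0 - lam / 2 * th 0 - Q 0 / 4"
    by (simp add: initial_energy_def kirchhoff_J_eq[OF \<Omega>(1) H10_subset_H1[OF u0]] initial_values)
  then show ?thesis using energy_conserved[OF assms] by (simp add: B_def field_simps)
qed

text \<open>Four times the energy identity, used to eliminate the quartic terms: it turns
  \<open>2 (V - N)\<close> into \<open>6 V + 2 B - 8 E0\<close>.\<close>

lemma N_eq: "t \<in> I \<Longrightarrow> N t = 4 * E0 - 2 * V t - B t"
  using energy[of t] by (simp add: N_def field_simps)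

lemma kirchhoff_I_u:
  assumes "t \<in> I"
  shows "kirchhoff_I \<Omega> a b lam (u t) = N t"
  using Q_eq(3)[OF assms] kirchhoff_I_eq[OF \<Omega>(1) in_L2(5)[OF assms], of a b lam]
  by (simp add: N_def B_def A_def th_def)

lemma kirchhoff_J_u:
  assumes "t \<in> I"
  shows "kirchhoff_J \<Omega> a b lam (u t) = E0 - V t / 2"
  using energy[OF assms] Q_eq(3)[OF assms] kirchhoff_J_eq[OF \<Omega>(1) in_L2(5)[OF assms], of a b lam]
  by (simp add: B_def A_def th_def field_simps)

lemma V_nonneg: "0 \<le> V t" and th_nonneg: "0 \<le> th t"
  by (simp_all add: V_def th_def)

lemma N_continuous: "continuous_on I N"
  unfolding N_def[abs_def] B_def[abs_def]
  by (intro continuous_intros A_continuous th_continuous Q_continuous)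

lemma B_lower: "t \<in> I \<Longrightarrow> \<beta> * A t \<le> B t" "t \<in> I \<Longrightarrow> \<beta> * \<mu> * th t \<le> B t"
proof -
  assume t: "t \<in> I"
  show 1: "\<beta> * A t \<le> B t" using quadratic_lower[OF u(1)[OF t]] by (simp add: A_def B_def th_def)
  have "\<mu> * th t \<le> A t" using Poincare[OF u(1)[OF t]] by (simp add: A_def th_def)
  then have "\<beta> * (\<mu> * th t) \<le> \<beta> * A t" using \<beta>_pos by (intro mult_left_mono) auto
  with 1 show "\<beta> * \<mu> * th t \<le> B t" by (simp add: mult.assoc)
qed

text \<open>Nonpositive energy gives \<open>a A^2 + 2 \<beta> A \<le> Q \<le> A^2 / L\<close>, and
  dividing by a nonzero \<open>A\<close> leaves the threshold. It is twice the one for negative I,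
  because J weights the quadratic terms by 1/2 but the quartic ones by 1/4.\<close>

lemma grad_dichotomy:
  assumes t: "t \<in> I" and E: "E0 \<le> 0"
  shows "A t = 0 \<or> 2 * \<beta> * L / (1 - a * L) \<le> A t"
proof -
  have A0: "0 \<le> A t" by (simp add: A_def grad_inner_nonneg)
  have "a * (A t)\<^sup>2 + 2 * (\<beta> * A t) \<le> Q t"
    using energy[OF t] E V_nonneg[of t] B_lower(1)[OF t] by (simp add: field_simps)
  then have "L * (a * (A t)\<^sup>2 + 2 * (\<beta> * A t)) \<le> L * Q t" using L_pos by (intro mult_left_mono) auto
  also have "\<dots> \<le> (A t)\<^sup>2"
    using Sobolev_Lambda_ineq[OF \<Omega>(1) u(1)[OF t]] Q_eq(3)[OF t] by (simp add: A_def)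
  finally have "A t * (2 * \<beta> * L) \<le> A t * ((1 - a * L) * A t)" by (simp add: power2_eq_square algebra_simps)
  then show ?thesis using A0 aL by (cases "A t = 0") (auto simp: pos_divide_le_eq mult.commute)
qed

lemma grad_lower_bound:
  assumes E: "E0 \<le> 0" and pos: "0 < A 0" and t: "t \<in> I"
  shows "2 * \<beta> * L / (1 - a * L) \<le> A t"
proof (rule ccontr)
  define K where "K = 2 * \<beta> * L / (1 - a * L)"
  assume "\<not> 2 * \<beta> * L / (1 - a * L) \<le> A t"
  with grad_dichotomy[OF t E] have At: "A t = 0" by blast
  have K: "0 < K" using \<beta>_pos L_pos aL by (simp add: K_def)
  have K0: "K \<le> A 0" using grad_dichotomy[OF zero_in E] pos unfolding K_def by linarith
  have sub: "{0..t} \<subseteq> I"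
    using t by (auto simp: time_interval_def intro: le_less_trans[of "ereal _" "ereal t" T])
  \<comment> \<open>The value \<open>K / 2\<close> lies in the gap between 0 and \<open>K\<close>
    that the dichotomy forbids.\<close>
  have "\<exists>x. 0 \<le> x \<and> x \<le> t \<and> A x = K / 2"
  proof (rule IVT2')
    show "A t \<le> K / 2" using At K by simp
    show "K / 2 \<le> A 0" using K0 K by linarith
    show "0 \<le> t" using time_intervalD(1)[OF t] .
    show "continuous_on {0..t} A" using continuous_on_subset[OF A_continuous sub] .
  qed
  then obtain x where x: "0 \<le> x" "x \<le> t" "A x = K / 2" by blast
  then have "x \<in> I" using sub by auto
  from grad_dichotomy[OF this E, folded K_def] x(3) K show False by linarith
qed

text \<open>At a first time with \<open>N r = 0\<close> the uniform gradient bound passes to the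
  limit, so \<open>u r\<close> is nonzero and lies on the Nehari manifold. Then
  \<open>d3 \<le> J(u r) \<le> E0\<close>, against the assumption on the energy.\<close>

lemma stays_in_N3_minus:
  assumes T: "T = \<infinity>" and E: "ereal E0 < d3 \<Omega> a b lam" and N0: "N 0 < 0" and t: "0 \<le> t"
  shows "N t < 0"
proof (rule ccontr)
  assume "\<not> N t < 0"
  have I: "I = {0..}" using T by (auto simp: time_interval_def)
  obtain r where r: "0 < r" "N r = 0" "\<And>s. 0 \<le> s \<Longrightarrow> s < r \<Longrightarrow> N s < 0"
    using first_time[of N t] N_continuous N0 t \<open>\<not> N t < 0\<close> unfolding I by auto
  have rI: "r \<in> I" using r(1) by (simp add: I)
  have "\<beta> * L / (1 - a * L) \<le> A r"
  proof (rule continuous_ge_on_closure[where f = A and x = r and S = "{0..<r}"])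
    show "continuous_on (closure {0..<r}) A" using r(1) A_continuous unfolding I by (auto elim: continuous_on_subset)
    show "r \<in> closure {0..<r}" using r(1) by simp
    show "\<beta> * L / (1 - a * L) \<le> A s" if "s \<in> {0..<r}" for s
    proof -
      have s: "s \<in> I" using that by (simp add: I)
      have "kirchhoff_I \<Omega> a b lam (u s) < 0" using kirchhoff_I_u[OF s] r(3)[of s] that by simp
      from N3_minus_grad_lower(2)[OF u(1)[OF s] this] show ?thesis by (simp add: A_def)
    qed
  qed
  moreover have "0 < \<beta> * L / (1 - a * L)" using \<beta>_pos L_pos aL by simp
  ultimately have "0 < A r" by linarith
  then have "\<not> zero_on \<Omega> (u r)" using zero_on_norms(3)[OF \<Omega>(1) in_L2(5)[OF rI]] by (auto simp: A_def)
  then have "u r \<in> N3 \<Omega> a b lam" using u(1)[OF rI] kirchhoff_I_u[OF rI] r(2) by (simp add: N3_def)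
  then have "d3 \<Omega> a b lam \<le> ereal (kirchhoff_J \<Omega> a b lam (u r))" unfolding d3_def by (rule INF_lower)
  also have "\<dots> \<le> ereal E0" using kirchhoff_J_u[OF rI] V_nonneg[of r] by simp
  finally show False using E by simp
qed

lemma not_global:
  assumes cases: "E0 < 0
       \<or> E0 = 0 \<and> (LINT x|lebesgue_on \<Omega>. u0 x * u1 x) > 0
       \<or> ereal E0 < d3 \<Omega> a b lam \<and> u0 \<in> W3_minus \<Omega> a b lam
       \<or> (LINT x|lebesgue_on \<Omega>. u0 x * u1 x) > 0 \<and> (Lq_norm \<Omega> 2 u0)\<^sup>2 > 4 / (\<beta> * \<mu>) * E0"
  shows "T \<noteq> \<infinity>"
proof
  assume T: "T = \<infinity>"
  have I: "I = {0..}" using T by (auto simp: time_interval_def)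
  \<comment> \<open>Positive times are interior, so one-sided and two-sided derivatives coincide
    there.\<close>
  have at: "at t within I = at t" if "0 < t" for t :: real
    unfolding I using that by (intro at_within_interior) simp
  \<comment> \<open>The term \<open>6 V\<close> is what the concavity argument needs; the bracket is
    the surplus whose sign the four cases control.\<close>
  define th'' where "th'' t = 6 * V t + (2 * B t - 8 * E0)" for t
  have d1: "(th has_real_derivative th' t) (at t)" if "0 < t" for t
    using th_deriv[of t] that at[OF that] by (simp add: I)
  have d2: "(th' has_real_derivative th'' t) (at t)" if t: "0 < t" for t
  proof -
    have tI: "t \<in> I" using t by (simp add: I)
    have "2 * (V t - (a * (A t)\<^sup>2 + b * A t - lam * th t - Q t)) = th'' t"
      using N_eq[OF tI] by (simp add: th''_def N_def B_def)
    then show ?thesis using th'_deriv[OF tI] at[OF t] by (simp only:)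
  qed
  have c: "continuous_on {0..} th" "continuous_on {0..} th'"
    using th_continuous DERIV_continuous_on[OF th'_deriv] by (simp_all add: I)
  have CS: "(th' t)\<^sup>2 \<le> 4 * th t * V t" if "0 \<le> t" for t using th'_sq_le[of t] that by (simp add: I)
  have B0: "0 \<le> B t" if "0 \<le> t" for t
  proof -
    have "0 \<le> \<beta> * A t" using \<beta>_pos by (simp add: A_def grad_inner_nonneg)
    then show ?thesis using B_lower(1)[of t] that by (simp add: I)
  qed
  \<comment> \<open>The common target of the four cases: a nonnegative surplus, and either a uniform
    positive lower bound for it or an initially increasing \<theta>.\<close>
  have "(\<forall>t>0. 0 \<le> 2 * B t - 8 * E0) \<and> ((\<exists>\<delta>>0. \<forall>t>0. \<delta> \<le> 2 * B t - 8 * E0) \<or> 0 < th' 0)"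
    using cases
  proof (elim disjE conjE)
    assume E: "E0 < 0"
    have low: "- 8 * E0 \<le> 2 * B t - 8 * E0" if "0 < t" for t using B0[of t] that by simp
    moreover have "0 \<le> 2 * B t - 8 * E0" if "0 < t" for t using low[OF that] E by linarith
    moreover have "0 < - 8 * E0" using E by simp
    ultimately show ?thesis by blast
  next
    assume "E0 = 0" "(LINT x|lebesgue_on \<Omega>. u0 x * u1 x) > 0"
    then show ?thesis using B0 initial_values(5) by auto
  next
    assume E: "ereal E0 < d3 \<Omega> a b lam" and W: "u0 \<in> W3_minus \<Omega> a b lam"
    have "kirchhoff_I \<Omega> a b lam u0 = N 0"
      by (simp add: kirchhoff_I_eq[OF \<Omega>(1) H10_subset_H1[OF u0]] initial_values N_def B_def)
    then have N0: "N 0 < 0" using W by (simp add: W3_minus_def N3_minus_def)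
    have le: "d3 \<Omega> a b lam \<le> ereal (B t / 4)" if t: "0 \<le> t" for t
    proof -
      have tI: "t \<in> I" using t by (simp add: I)
      have "kirchhoff_I \<Omega> a b lam (u t) < 0" using stays_in_N3_minus[OF T E N0 t] kirchhoff_I_u[OF tI] by simp
      from N3_minus_d3_le[OF u(1)[OF tI] this] show ?thesis by (simp add: A_def B_def th_def)
    qed
    \<comment> \<open>As an extended real \<open>d3\<close> might be infinite; it lies above
      \<open>E0\<close> and below \<open>B 0 / 4\<close>, so it is a real number. The surplus is
      then at least \<open>8 (d - E0)\<close>.\<close>
    obtain d where d: "d3 \<Omega> a b lam = ereal d"
      using E le[of 0] by (cases "d3 \<Omega> a b lam") auto
    have "8 * (d - E0) \<le> 2 * B t - 8 * E0" if "0 < t" for t using le[of t] that by (simp add: d)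
    moreover have "0 < 8 * (d - E0)" using E by (simp add: d)
    ultimately show ?thesis by (meson less_imp_le order_trans)
  next
    assume p: "(LINT x|lebesgue_on \<Omega>. u0 x * u1 x) > 0" and n: "(Lq_norm \<Omega> 2 u0)\<^sup>2 > 4 / (\<beta> * \<mu>) * E0"
    define k where "k = \<beta> * \<mu>"
    have k: "0 < k" using \<beta>_pos \<mu>_pos by (simp add: k_def)
    have p': "0 < th' 0" using p initial_values(5) by simp
    have n': "4 / k * E0 < th 0" using n initial_values(2) by (simp add: k_def)
    have kE: "k * (4 / k * E0) = 4 * E0" using k by simp
    \<comment> \<open>With \<open>k = b0 \<lambda>1\<close>, Poincare's inequality bounds the
      surplus below by a multiple of the excess of \<theta> over \<open>4 E0 / k\<close>, which is
      the threshold that the initial datum exceeds.\<close>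
    have low: "2 * k * (th t - 4 / k * E0) \<le> 2 * B t - 8 * E0" if "0 < t" for t
      using B_lower(2)[of t] that kE k by (simp add: I k_def[symmetric] right_diff_distrib)
    have "th 0 \<le> th t" if "0 \<le> t" for t
    proof (rule growth_above_threshold[OF d1 d2 c, where k = "2 * k" and m = "4 / k * E0"])
      show "2 * k * (th s - 4 / k * E0) \<le> th'' s" if "0 < s" for s
        using low[OF that] V_nonneg[of s] by (simp add: th''_def)
    qed (use k n' p' that in auto)
    then have "0 \<le> 2 * k * (th t - 4 / k * E0)" if "0 < t" for t
      using k n' that by (intro mult_nonneg_nonneg) (auto intro: order_trans less_imp_le)
    then show ?thesis using low p' by (meson order_trans)
  qed
  note key = this
  show False
  proof (rule no_global_growth[OF d1 d2 c th_nonneg V_nonneg CS])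
    show "6 * V t \<le> th'' t" if "0 < t" for t using key that by (simp add: th''_def)
    show "(\<exists>\<delta>>0. \<forall>t>0. \<delta> \<le> th'' t) \<or> 0 < th' 0"
    proof (rule disjE[OF conjunct2[OF key]])
      assume "\<exists>\<delta>>0. \<forall>t>0. \<delta> \<le> 2 * B t - 8 * E0"
      then obtain \<delta> where \<delta>: "\<delta> > 0" "\<And>t. 0 < t \<Longrightarrow> \<delta> \<le> 2 * B t - 8 * E0" by blast
      have "\<delta> \<le> th'' t" if "0 < t" for t using \<delta>(2)[OF that] V_nonneg[of t] by (simp add: th''_def)
      with \<delta>(1) show ?thesis by blast
    qed simp
  qed
qed

end

theorem theorem2p6:
  fixes \<Omega> :: "(real ^ 3) set"
    and a b lam :: real
    and u0 u1 :: "real ^ 3 \<Rightarrow> real"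
    and u :: "real \<Rightarrow> real ^ 3 \<Rightarrow> real"
    and Tmax :: ereal
  assumes "open \<Omega>" and "bounded \<Omega>" and "smooth_boundary \<Omega>"
    and "b > 0"
    and "0 < a" and "a < 1 / Sobolev_Lambda \<Omega>"
    and "lam < b * principal_eigenvalue \<Omega>"
    and "u0 \<in> H2 \<Omega> \<inter> H10 \<Omega>" and "u1 \<in> H10 \<Omega>"
    and "maximal_kirchhoff_solution \<Omega> a b lam u0 u1 Tmax u"
    and "(N3 \<Omega> a b lam \<union> N3_minus \<Omega> a b lam) \<inter> H2 \<Omega> \<noteq> {}"
    and "initial_energy \<Omega> a b lam u0 u1 < 0
       \<or> initial_energy \<Omega> a b lam u0 u1 = 0 \<and> (LINT x|lebesgue_on \<Omega>. u0 x * u1 x) > 0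
       \<or> 0 < initial_energy \<Omega> a b lam u0 u1
           \<and> ereal (initial_energy \<Omega> a b lam u0 u1) < d3 \<Omega> a b lam
           \<and> u0 \<in> W3_minus \<Omega> a b lam
       \<or> ereal (initial_energy \<Omega> a b lam u0 u1) \<ge> d3 \<Omega> a b lam
           \<and> (LINT x|lebesgue_on \<Omega>. u0 x * u1 x) > 0
           \<and> (Lq_norm \<Omega> 2 u0)\<^sup>2
               > 4 / (b0 \<Omega> b lam * principal_eigenvalue \<Omega>) * initial_energy \<Omega> a b lam u0 u1"
  shows "Tmax < \<infinity> \<and>
    (initial_energy \<Omega> a b lam u0 u1 \<le> 0 \<and> Lq_norm \<Omega> 2 (weak_grad \<Omega> u0) > 0 \<longrightarrow>
      (\<forall>t\<in>time_interval Tmax.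
         (Lq_norm \<Omega> 2 (weak_grad \<Omega> (u t)))\<^sup>2
           \<ge> 2 * b0 \<Omega> b lam * Sobolev_Lambda \<Omega> / (1 - a * Sobolev_Lambda \<Omega>)))"
proof -
  have "kirchhoff_solution \<Omega> a b lam u0 u1 Tmax u"
    using assms(10) by (simp add: maximal_kirchhoff_solution_def)
  from kirchhoff_solution_flow[OF assms(1,2) this]
  obtain v w where flow: "kirchhoff_flow \<Omega> a b lam Tmax u v w"
    and init: "AE x in lebesgue_on \<Omega>. u 0 x = u0 x" "AE x in lebesgue_on \<Omega>. v 0 x = u1 x"
    by (elim exE conjE)
  interpret kirchhoff_flow \<Omega> a b lam Tmax u v w by (rule flow)
  interpret potential_well \<Omega> a b lam
    by unfold_locales (use assms in auto)
  interpret kirchhoff_evolution \<Omega> a b lam Tmax u v w u0 u1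
    by unfold_locales (use assms init in auto)
  have "Tmax \<noteq> \<infinity>" by (rule not_global) (use assms(12) in blast)
  moreover have "2 * b0 \<Omega> b lam * Sobolev_Lambda \<Omega> / (1 - a * Sobolev_Lambda \<Omega>) \<le> (Lq_norm \<Omega> 2 (weak_grad \<Omega> (u t)))\<^sup>2"
    if E: "initial_energy \<Omega> a b lam u0 u1 \<le> 0" and g: "Lq_norm \<Omega> 2 (weak_grad \<Omega> u0) > 0" and t: "t \<in> time_interval Tmax" for t
  proof -
    have "0 < A 0"
      using g grad_norm_sq[OF \<Omega>(1) H10_subset_H1[OF u0]] initial_values(1) by (metis zero_less_power)
    from grad_lower_bound[OF E this t] show ?thesis
      by (simp add: grad_norm_sq[OF \<Omega>(1) in_L2(5)[OF t]] A_def)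
  qed
  ultimately show ?thesis by (simp add: less_top[symmetric] top_ereal_def)
qed

end
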